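(* Let $S\in\mathcal{CPMM}$ be of operator type, let $\mathcal P$ be a Markov partition for $S$, and let $j\in\mathcal P$ be such that $S|_j$ is monotone. Then for every sufficiently large $k\in\mathbb N$, any window perturbation $T\in\mathcal{CPMM}$ of $S$ on $j$ of order $k$ is linearizable.
   Context: A continuous map on a closed interval is piecewise monotone if the interval splits into finitely many subintervals on each of which the map is monotone. A Markov partition for a continuous map $T:[0,1]\to[0,1]$ is a finite or countably infinite collection $\mathcal P$ of closed nondegenerate subintervals of $[0,1]$ such that: (1) distinct elements of $\mathcal P$ have disjoint interiors and $[0,1]\setminus\bigcup\mathcal P$ is at most countable; (2) $T|_i$ is monotone for each $i\in\mathcal P$ (classical), or piecewise monotone for each $i\in\mathcal P$ (slack); (3) for all $i,j\in\mathcal P$ and every maximal interval $i'\subset i$ of monotonicity of $T$, if $T(i')\cap j^\circ\ne\emptyset$ then $T(i')\supset j$. $\mathcal{CPMM}$ is the set of continuous maps $T:[0,1]\to[0,1]$ that are topologically mixing (for all nonempty open $U,V$ there is $n$ with $T^m(U)\cap V\neq\emptyset$ for all $m\ge n$), admit a countably infinite Markov partition, and have finite topological entropy $h_{top}(T)<\infty$. $T\in\mathcal{CPMM}$ is of operator type if there is $K>0$ with $\#T^{-1}(y)\le K$ for all $y\in[0,1]$. Window perturbation: for $S\in\mathcal{CPMM}$ with Markov partition $\mathcal P$ and $j\in\mathcal P$ such that $S|_j$ is monotone, $T\in\mathcal{CPMM}$ is a window perturbation of $S$ on $j$ of order $k\in\mathbb N$ if $T=S$ on $[0,1]\setminus j^\circ$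 and there is a nontrivial partition $(j_i)_{i=1}^{2k+1}$ of $j$ (into nondegenerate subintervals) such that $T(j_i)=S(j)$ and $T|_{j_i}$ is monotone for each $i$. A continuous interval map $S$ has constant slope $s$ if $|S'(x)|=s$ for all but countably many $x$. $T$ is linearizable if it is topologically conjugate to an interval map $[0,1]\to[0,1]$ of constant slope $e^{h_{top}(T)}$. *)

theory Defs
  imports "HOL-Analysis.Analysis"
begin

text \<open>
  Maps of the unit interval are total functions on the reals of which only the
  restriction to \<open>{0..1}\<close> is relevant.
\<close>

definition interval_map :: "(real \<Rightarrow> real) \<Rightarrow> bool" where
  "interval_map T \<longleftrightarrow> continuous_on {0..1} T \<and> T ` {0..1} \<subseteq> {0..1}"

definition monotone_int :: "(real \<Rightarrow> real) \<Rightarrow> real set \<Rightarrow> bool" where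
  "monotone_int T i \<longleftrightarrow> mono_on i T \<or> antimono_on i T"

definition piecewise_monotone :: "(real \<Rightarrow> real) \<Rightarrow> real set \<Rightarrow> bool" where
  "piecewise_monotone T i \<longleftrightarrow> (\<exists>\<D>. \<D> division_of i \<and> (\<forall>q\<in>\<D>. monotone_int T q))"

definition max_monotone_interval :: "(real \<Rightarrow> real) \<Rightarrow> real set \<Rightarrow> real set \<Rightarrow> bool" where
  "max_monotone_interval T i i' \<longleftrightarrow>
     is_interval i' \<and> i' \<subseteq> i \<and> monotone_int T i' \<and>
     (\<forall>q. is_interval q \<and> i' \<subseteq> q \<and> q \<subseteq> i \<and> monotone_int T q \<longrightarrow> q = i')"

text \<open>
  This is the slack notion. A classical Markov partition, on whose elements the map is
  monotone, is in particular a slack one: a nonempty interval on which the map is monotone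
  is its own only maximal interval of monotonicity.
\<close>

definition markov_partition :: "(real \<Rightarrow> real) \<Rightarrow> real set set \<Rightarrow> bool" where
  "markov_partition T P \<longleftrightarrow>
     countable P \<and>
     (\<forall>i\<in>P. \<exists>a b. 0 \<le> a \<and> a < b \<and> b \<le> 1 \<and> i = {a..b}) \<and>
     (\<forall>i\<in>P. \<forall>j\<in>P. i \<noteq> j \<longrightarrow> interior i \<inter> interior j = {}) \<and>
     countable ({0..1} - \<Union>P) \<and>
     (\<forall>i\<in>P. piecewise_monotone T i) \<and>
     (\<forall>i\<in>P. \<forall>j\<in>P. \<forall>i'. max_monotone_interval T i i' \<longrightarrow>
        T ` i' \<inter> interior j \<noteq> {} \<longrightarrow> j \<subseteq> T ` i')"

definition topologically_mixing :: "(real \<Rightarrow> real) \<Rightarrow> bool" where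
  "topologically_mixing T \<longleftrightarrow>
     (\<forall>U V. openin (top_of_set {0..1}) U \<and> U \<noteq> {} \<and> openin (top_of_set {0..1}) V \<and> V \<noteq> {} \<longrightarrow>
        (\<exists>n. \<forall>m\<ge>n. (T ^^ m) ` U \<inter> V \<noteq> {}))"

definition dyn_separated ::
  "('a::metric_space \<Rightarrow> 'a) \<Rightarrow> 'a set \<Rightarrow> nat \<Rightarrow> real \<Rightarrow> 'a set \<Rightarrow> bool" where
  "dyn_separated T X n \<epsilon> E \<longleftrightarrow>
     E \<subseteq> X \<and>
     (\<forall>x\<in>E. \<forall>y\<in>E. x \<noteq> y \<longrightarrow> (\<exists>m<n. dist ((T ^^ m) x) ((T ^^ m) y) > \<epsilon>))"

text \<open>
  Bowen's definition: \<open>lim\<^sub>\<epsilon>\<^sub>\<rightarrow>\<^sub>0 limsup\<^sub>n (1/n) ln s(n,\<epsilon>)\<close>, where \<open>s(n,\<epsilon>)\<close> is the largest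
  cardinality of an \<open>(n,\<epsilon>)\<close>-separated set. The expression grows as \<open>\<epsilon>\<close> decreases, so
  the limit is the supremum over \<open>\<epsilon> > 0\<close>. The empty set contributes \<open>ln 0 = 0\<close>, which
  does not exceed the contribution of a singleton.
\<close>

definition topological_entropy :: "('a::metric_space \<Rightarrow> 'a) \<Rightarrow> 'a set \<Rightarrow> ereal" where
  "topological_entropy T X =
     (SUP \<epsilon>\<in>{0<..}. limsup (\<lambda>n.
        SUP E\<in>{E. finite E \<and> dyn_separated T X n \<epsilon> E}. ereal (ln (real (card E)) / real n)))"

definition h_top :: "(real \<Rightarrow> real) \<Rightarrow> ereal" where
  "h_top T = topological_entropy T {0..1}"

definition CPMM :: "(real \<Rightarrow> real) set" where
  "CPMM = {T. interval_map T \<and> topologically_mixing T \<and>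
              (\<exists>P. markov_partition T P \<and> infinite P) \<and> h_top T < \<infinity>}"

definition operator_type :: "(real \<Rightarrow> real) \<Rightarrow> bool" where
  "operator_type T \<longleftrightarrow> T \<in> CPMM \<and>
     (\<exists>K::nat. K > 0 \<and> (\<forall>y\<in>{0..1}. finite {x\<in>{0..1}. T x = y} \<and> card {x\<in>{0..1}. T x = y} \<le> K))"

text \<open>
  The pieces of the partition of \<open>j\<close> are the elements of \<open>\<D>\<close>. Being nondegenerate with
  pairwise disjoint interiors they are distinct, so a set of \<open>2 * k + 1\<close> of them is the
  same as an indexed family.
\<close>

definition window_perturbation ::
  "(real \<Rightarrow> real) \<Rightarrow> real set set \<Rightarrow> real set \<Rightarrow> nat \<Rightarrow> (real \<Rightarrow> real) \<Rightarrow> bool" where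
  "window_perturbation S P j k T \<longleftrightarrow>
     S \<in> CPMM \<and> markov_partition S P \<and> j \<in> P \<and> monotone_int S j \<and>
     T \<in> CPMM \<and>
     (\<forall>x\<in>{0..1} - interior j. T x = S x) \<and>
     (\<exists>\<D>. \<D> division_of j \<and> card \<D> = 2 * k + 1 \<and>
        (\<forall>q\<in>\<D>. interior q \<noteq> {} \<and> T ` q = S ` j \<and> monotone_int T q))"

definition constant_slope :: "(real \<Rightarrow> real) \<Rightarrow> real \<Rightarrow> bool" where
  "constant_slope S s \<longleftrightarrow> interval_map S \<and>
     countable {x\<in>{0..1}. \<not> (\<exists>d. (S has_real_derivative d) (at x within {0..1}) \<and> \<bar>d\<bar> = s)}"

definition topologically_conjugate :: "(real \<Rightarrow> real) \<Rightarrow> (real \<Rightarrow> real) \<Rightarrow> bool" where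
  "topologically_conjugate T S \<longleftrightarrow>
     (\<exists>\<phi> \<psi>. homeomorphism {0..1} {0..1} \<phi> \<psi> \<and> (\<forall>x\<in>{0..1}. \<phi> (T x) = S (\<phi> x)))"

text \<open>Finiteness of the entropy is required explicitly because \<open>real_of_ereal \<infinity> = 0\<close>.\<close>

definition linearizable :: "(real \<Rightarrow> real) \<Rightarrow> bool" where
  "linearizable T \<longleftrightarrow> h_top T < \<infinity> \<and>
     (\<exists>S. constant_slope S (exp (real_of_ereal (h_top T))) \<and> topologically_conjugate T S)"

end

theory Submission
  imports Defs
begin

text \<open>
  Let \<open>M\<close> be the transition matrix of \<open>S\<close> on the classical Markov partition refining \<open>P\<close>. Operator type
  means that its column sums are at most some \<open>K\<close>, so that \<open>v = (\<Sum>n. x ^ Suc n * M ^ n * e\<^sub>j)\<close> is a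
  summable vector whenever \<open>x * K < 1\<close>. A window perturbation of order \<open>k\<close> multiplies the row of \<open>j\<close> by
  \<open>2 * k + 1\<close>, and \<open>v\<close> is an eigenvector of the new matrix for the eigenvalue \<open>1 / x\<close> as soon as
  \<open>2 * k * (\<Sum>n>0. x ^ n * (M ^ n)\<^sub>j\<^sub>j) = 1\<close>. For large \<open>k\<close> this equation has a solution with
  \<open>x \<le> 1 / (K + 3)\<close>. The summable eigenvector gives a conjugacy of \<open>T\<close> to a map of constant slope
  \<open>1 / x\<close>, whence \<open>h_top T \<le> ln (1 / x)\<close>. Conversely, the equation says that the
  first returns to \<open>j\<close> along the additional branches have total weight \<open>1\<close>, hence by renewal the loops at \<open>j\<close>
  are not summable at \<open>x\<close>; they yield horseshoes showing \<open>h_top T \<ge> ln (1 / x)\<close>.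
\<close>

section \<open>Real functions and topological entropy\<close>

text \<open>With infinitely many pieces there is no Perron-Frobenius theorem to supply an
  eigenvector, and a nonsummable one would be of no use: the new coordinate of a point is the total
  mass of the pieces to its left. The window changes the transition matrix only by a matrix of rank
  one, supported on row \<open>j\<close>, and this reduces the eigenvalue problem to a scalar
  equation: \<open>v\<close> is column \<open>j\<close> of the resolvent
  \<open>(1/x - M)^-1\<close>, so \<open>M v\<close> differs from \<open>v / x\<close> only in the
  entry at \<open>j\<close>, and the extra copies of that row can make up for the difference. In the
  partition of \<open>T\<close> the entry of \<open>v\<close> at \<open>j\<close> is shared equally
  by the pieces of the window, all of which have the same image. The constant \<open>K + 3\<close>
  serves two purposes. It gives \<open>x * K < 1\<close>, hence convergence of the resolvent series,
  and \<open>1 / x > 2\<close>, hence contraction in the construction of the conjugacy: pieces may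
  accumulate, so two points are compared through the exceptional set \<open>Q\<close> at the cost of
  at most two partial pieces, each contributing a factor \<open>x\<close>.\<close>

lemma countable_exception_mono:
  fixes h :: "real \<Rightarrow> real"
  assumes cont: "continuous_on {a..b} h" and "a \<le> b" and "countable Q"
    and loc: "\<And>z. \<lbrakk>a \<le> z; z < b; z \<notin> Q\<rbrakk> \<Longrightarrow> \<exists>d>0. \<forall>t. z < t \<and> t < z + d \<and> t \<le> b \<longrightarrow> h z \<le> h t"
  shows "h a \<le> h b"
proof (rule ccontr)
  assume "\<not> h a \<le> h b"
  then have less: "h b < h a" by simp
  \<comment> \<open>Pick a level \<open>c\<close> between the two values that avoids the countable
    set of values of \<open>h\<close> on \<open>Q\<close>. The last point at which \<open>h\<close>
    reaches \<open>c\<close> then lies outside \<open>Q\<close>, so the local hypothesis carries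
    \<open>h\<close> past it at height at least \<open>c\<close>.\<close>
  have "uncountable {h b<..<h a}"
    using less by (simp add: uncountable_open_interval)
  then have "\<not> {h b<..<h a} \<subseteq> h ` Q"
    using \<open>countable Q\<close> by (meson countable_image countable_subset)
  then obtain c where "c \<in> {h b<..<h a}" "c \<notin> h ` Q" by blast
  then have c: "h b < c" "c < h a" "c \<notin> h ` Q" by auto
  define A where "A = {t\<in>{a..b}. c \<le> h t}"
  have "closed A"
    unfolding A_def using cont by (intro continuous_on_closed_Collect_le) auto
  have "bdd_above A" "a \<in> A" unfolding A_def using c \<open>a \<le> b\<close> by auto
  define z where "z = Sup A"
  have zA: "z \<in> A"
    unfolding z_def using \<open>closed A\<close> \<open>bdd_above A\<close> \<open>a \<in> A\<close> by (intro closed_contains_Sup) auto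
  have zub: "t \<le> z" if "t \<in> A" for t
    unfolding z_def using \<open>bdd_above A\<close> that by (rule cSup_upper[rotated])
  have "a \<le> z" "z \<le> b" "c \<le> h z" using zA by (auto simp: A_def)
  have "z < b" using \<open>z \<le> b\<close> \<open>c \<le> h z\<close> c by (cases "z = b") auto
  obtain t where t: "z \<le> t" "t \<le> b" "h t = c"
    using IVT2'[of h b c z] c \<open>c \<le> h z\<close> \<open>z \<le> b\<close> \<open>a \<le> z\<close>
    by (meson atLeastatMost_subset_iff cont continuous_on_subset less_imp_le order_refl)
  then have "h z = c" using zub[of t] \<open>a \<le> z\<close> by (auto simp: A_def)
  then have "z \<notin> Q" using c by auto
  then obtain d where d: "d > 0" "\<And>t. z < t \<and> t < z + d \<and> t \<le> b \<Longrightarrow> h z \<le> h t"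
    using loc[of z] \<open>a \<le> z\<close> \<open>z < b\<close> by blast
  define u where "u = min (z + d/2) b"
  have u: "z < u" "u < z + d" "u \<le> b" unfolding u_def using \<open>z < b\<close> d by auto
  then have "u \<in> A" using d(2)[of u] \<open>h z = c\<close> \<open>a \<le> z\<close> by (auto simp: A_def)
  then show False using zub u by fastforce
qed

section \<open>Entropy bounded above by counting separated points\<close>

lemma card_separated_reals_le:
  fixes E :: "real set"
  assumes "finite E" "E \<subseteq> {0..1}" "\<eta> > 0"
    and sep: "\<And>x y. \<lbrakk>x \<in> E; y \<in> E; x \<noteq> y\<rbrakk> \<Longrightarrow> \<eta> \<le> \<bar>x - y\<bar>"
  shows "real (card E) \<le> 1 / \<eta> + 1"
proof -
  define f where "f x = \<lfloor>x / \<eta>\<rfloor>" for x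
  have "inj_on f E"
  proof (rule inj_onI, rule ccontr)
    fix x y assume xy: "x \<in> E" "y \<in> E" "f x = f y" "x \<noteq> y"
    have "\<bar>x / \<eta> - y / \<eta>\<bar> < 1" using xy(3) unfolding f_def by linarith
    then have "\<bar>x - y\<bar> < \<eta>" using \<open>\<eta> > 0\<close> by (simp add: diff_divide_distrib[symmetric] field_simps)
    then show False using sep xy by force
  qed
  moreover have "f ` E \<subseteq> {0..\<lfloor>1 / \<eta>\<rfloor>}"
  proof clarify
    fix x assume "x \<in> E"
    then have "0 \<le> x" "x \<le> 1" using assms by auto
    then have "0 \<le> x / \<eta>" "x / \<eta> \<le> 1 / \<eta>" using \<open>\<eta> > 0\<close> by (auto intro: divide_right_mono)
    then show "f x \<in> {0..\<lfloor>1 / \<eta>\<rfloor>}" unfolding f_def by (auto intro: floor_mono)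
  qed
  ultimately have "card E \<le> card {0..\<lfloor>1 / \<eta>\<rfloor>}" by (intro card_inj_on_le) auto
  also have "\<dots> = nat (\<lfloor>1 / \<eta>\<rfloor> + 1)" by simp
  finally have "real (card E) \<le> real (nat (\<lfloor>1 / \<eta>\<rfloor> + 1))" by simp
  moreover have "0 \<le> \<lfloor>1 / \<eta>\<rfloor>" using \<open>\<eta> > 0\<close> by simp
  then have "real (nat (\<lfloor>1 / \<eta>\<rfloor> + 1)) = of_int \<lfloor>1 / \<eta>\<rfloor> + 1" by simp
  ultimately show ?thesis using of_int_floor_le[of "1 / \<eta>"] by linarith
qed

lemma funpow_interval_map:
  assumes "interval_map T"
  shows "continuous_on {0..1} (T ^^ n)" "(T ^^ n) ` {0..1} \<subseteq> {0..1}"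
proof -
  have "continuous_on {0..1} (T ^^ n) \<and> (T ^^ n) ` {0..1} \<subseteq> {0..1}"
  proof (induction n)
    case (Suc n)
    have T: "continuous_on {0..1} T" "T ` {0..1} \<subseteq> {0..1}" using assms by (auto simp: interval_map_def)
    show ?case using Suc T by (auto intro!: continuous_on_compose2[OF T(1)])
  qed auto
  then show "continuous_on {0..1} (T ^^ n)" "(T ^^ n) ` {0..1} \<subseteq> {0..1}" by auto
qed

text \<open>Measured through \<open>\<phi>\<close>, one step of \<open>T\<close> stretches distances
  by at most \<open>\<rho>\<close>. Points that are \<open>\<epsilon>\<close>-separated within
  \<open>n\<close> steps therefore have \<open>\<phi>\<close>-images at least
  \<open>\<delta> / \<rho> ^ n\<close> apart, where \<open>\<delta>\<close> comes from the uniform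
  continuity of \<open>\<psi>\<close>, and the unit interval has room for only about
  \<open>\<rho> ^ n / \<delta>\<close> of them.\<close>

lemma h_top_le_of_lipschitz:
  assumes T: "interval_map T" and \<phi>: "homeomorphism {0..1} {0..1} \<phi> \<psi>" and "\<rho> > 1"
    and lip: "\<And>x y. \<lbrakk>x \<in> {0..1}; y \<in> {0..1}\<rbrakk> \<Longrightarrow> \<bar>\<phi> (T x) - \<phi> (T y)\<bar> \<le> \<rho> * \<bar>\<phi> x - \<phi> y\<bar>"
  shows "h_top T \<le> ereal (ln \<rho>)"
  unfolding h_top_def topological_entropy_def
proof (rule SUP_least)
  fix \<epsilon> :: real assume "\<epsilon> \<in> {0<..}"
  then have "\<epsilon> > 0" by simp
  have "uniformly_continuous_on {0..1} \<psi>"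
    using \<phi> by (intro compact_uniformly_continuous) (auto simp: homeomorphism_def)
  then obtain \<delta> where \<delta>: "\<delta> > 0"
    "\<And>u w. \<lbrakk>u \<in> {0..1}; w \<in> {0..1}; dist w u < \<delta>\<rbrakk> \<Longrightarrow> dist (\<psi> w) (\<psi> u) < \<epsilon>"
    using \<open>\<epsilon> > 0\<close> unfolding uniformly_continuous_on_def by metis
  have Tn: "(T ^^ m) x \<in> {0..1}" if "x \<in> {0..1}" for m x
    using funpow_interval_map(2)[OF T] that by blast
  have lipn: "\<bar>\<phi> ((T ^^ m) x) - \<phi> ((T ^^ m) y)\<bar> \<le> \<rho> ^ m * \<bar>\<phi> x - \<phi> y\<bar>"
    if "x \<in> {0..1}" "y \<in> {0..1}" for m x y
  proof (induction m)
    case (Suc m)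
    have "\<bar>\<phi> ((T ^^ Suc m) x) - \<phi> ((T ^^ Suc m) y)\<bar> \<le> \<rho> * \<bar>\<phi> ((T ^^ m) x) - \<phi> ((T ^^ m) y)\<bar>"
      using lip[OF Tn[OF that(1)] Tn[OF that(2)]] by simp
    also have "\<dots> \<le> \<rho> * (\<rho> ^ m * \<bar>\<phi> x - \<phi> y\<bar>)" using Suc \<open>\<rho> > 1\<close> by (intro mult_left_mono) auto
    finally show ?case by (simp add: mult.assoc)
  qed auto
  define F where "F n = (SUP E\<in>{E. finite E \<and> dyn_separated T {0..1} n \<epsilon> E}. ereal (ln (real (card E)) / real n))" for n
  have bound: "F n \<le> ereal (ln \<rho> + ln (1 / \<delta> + 1) / real n)" if "n > 0" for n
    unfolding F_def
  proof (rule SUP_least, clarsimp)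
    fix E assume E: "finite E" "dyn_separated T {0..1} n \<epsilon> E"
    have sub: "E \<subseteq> {0..1}" using E by (auto simp: dyn_separated_def)
    have inj: "inj_on \<phi> E" using sub \<phi> unfolding homeomorphism_def by (metis inj_on_def subsetD)
    have sep: "\<delta> / \<rho> ^ n \<le> \<bar>\<phi> x - \<phi> y\<bar>" if xy: "x \<in> E" "y \<in> E" "x \<noteq> y" for x y
    proof -
      obtain m where m: "m < n" "dist ((T ^^ m) x) ((T ^^ m) y) > \<epsilon>"
        using E xy unfolding dyn_separated_def by blast
      have x01: "x \<in> {0..1}" "y \<in> {0..1}" using xy sub by auto
      note h = Tn[OF x01(1), of m] Tn[OF x01(2), of m]
      have "\<phi> ((T ^^ m) x) \<in> {0..1}" "\<phi> ((T ^^ m) y) \<in> {0..1}"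
        using h \<phi> unfolding homeomorphism_def by blast+
      moreover have "\<psi> (\<phi> ((T ^^ m) x)) = (T ^^ m) x" "\<psi> (\<phi> ((T ^^ m) y)) = (T ^^ m) y"
        using h \<phi> by (auto simp: homeomorphism_def)
      ultimately have "\<not> dist (\<phi> ((T ^^ m) x)) (\<phi> ((T ^^ m) y)) < \<delta>"
        using \<delta>(2)[of "\<phi> ((T ^^ m) y)" "\<phi> ((T ^^ m) x)"] m by auto
      then have "\<delta> \<le> \<bar>\<phi> ((T ^^ m) x) - \<phi> ((T ^^ m) y)\<bar>" by (simp add: dist_real_def)
      also have "\<dots> \<le> \<rho> ^ m * \<bar>\<phi> x - \<phi> y\<bar>" using lipn x01 .
      also have "\<dots> \<le> \<rho> ^ n * \<bar>\<phi> x - \<phi> y\<bar>"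
        using m \<open>\<rho> > 1\<close> by (intro mult_right_mono power_increasing) auto
      finally show ?thesis using \<open>\<rho> > 1\<close> by (simp add: field_simps)
    qed
    have "real (card (\<phi> ` E)) \<le> 1 / (\<delta> / \<rho> ^ n) + 1"
    proof (rule card_separated_reals_le)
      show "\<phi> ` E \<subseteq> {0..1}" using sub \<phi> unfolding homeomorphism_def by blast
    qed (use E sep \<delta> \<open>\<rho> > 1\<close> in auto)
    then have c: "real (card E) \<le> \<rho> ^ n / \<delta> + 1" using card_image[OF inj] by simp
    also have "\<dots> \<le> \<rho> ^ n * (1 / \<delta> + 1)"
      using \<open>\<rho> > 1\<close> one_le_power[of \<rho> n] by (simp add: field_simps)
    finally have c: "real (card E) \<le> \<rho> ^ n * (1 / \<delta> + 1)" .
    have "ln (real (card E)) \<le> ln (\<rho> ^ n * (1 / \<delta> + 1))"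
    proof (cases "card E = 0")
      case True
      \<comment> \<open>The left side is \<open>ln 0 = 0\<close> here, so the argument of the
        right-hand logarithm has to be at least \<open>1\<close>.\<close>
      have "1 \<le> \<rho> ^ n" using one_le_power[of \<rho> n] \<open>\<rho> > 1\<close> by simp
      moreover have "1 \<le> 1 / \<delta> + 1" using \<delta> by simp
      ultimately have "1 * 1 \<le> \<rho> ^ n * (1 / \<delta> + 1)" by (intro mult_mono) auto
      then show ?thesis using True by simp
    next
      case False
      then show ?thesis using c by (subst ln_le_cancel_iff) (auto intro: less_le_trans)
    qed
    also have "\<dots> = real n * ln \<rho> + ln (1 / \<delta> + 1)"
    proof -
      have "1 / \<delta> + 1 > 0" using \<delta> by (simp add: add_pos_pos)
      then show ?thesis using \<open>\<rho> > 1\<close> by (subst ln_mult) (auto simp: ln_realpow)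
    qed
    finally show "ln (real (card E)) / real n \<le> ln \<rho> + ln (1 / \<delta> + 1) / real n"
      using \<open>n > 0\<close> by (simp add: field_simps)
  qed
  have lim: "(\<lambda>n. ereal (ln \<rho> + ln (1 / \<delta> + 1) / real n)) \<longlonglongrightarrow> ereal (ln \<rho> + 0)"
    by (intro tendsto_ereal tendsto_add tendsto_const lim_const_over_n)
  have "limsup F \<le> limsup (\<lambda>n. ereal (ln \<rho> + ln (1 / \<delta> + 1) / real n))"
    using bound by (intro Limsup_mono) (auto intro: eventually_mono[OF eventually_gt_at_top[of 0]])
  also have "\<dots> = ereal (ln \<rho>)"
    using lim_imp_Limsup[OF _ lim] by simp
  finally show "limsup (\<lambda>n. SUP E\<in>{E. finite E \<and> dyn_separated T {0..1} n \<epsilon> E}. ereal (ln (real (card E)) / real n)) \<le> ereal (ln \<rho>)"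
    unfolding F_def .
qed

section \<open>Entropy bounded below by horseshoes\<close>

lemma horseshoe_itinerary:
  assumes "\<And>A. A \<in> \<C> \<Longrightarrow> \<Union>\<C> \<subseteq> f ` A" and "\<And>A. A \<in> \<C> \<Longrightarrow> A \<noteq> {}"
    and "w \<noteq> []" "set w \<subseteq> \<C>"
  shows "\<exists>x. \<forall>l<length w. (f ^^ l) x \<in> w ! l"
  using assms(3,4)
proof (induction w)
  case (Cons A w)
  show ?case
  proof (cases "w = []")
    case True
    then show ?thesis using Cons assms(2)[of A] by auto
  next
    case False
    then obtain x where x: "\<And>l. l < length w \<Longrightarrow> (f ^^ l) x \<in> w ! l" using Cons by auto
    have "x \<in> w ! 0" using x[of 0] False by simp
    moreover have "w ! 0 \<in> \<C>" using Cons.prems False by (auto intro: nth_mem)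
    ultimately obtain y where "y \<in> A" "x = f y" using assms(1)[of A] Cons.prems by auto
    then have "(f ^^ l) y \<in> (A # w) ! l" if "l < length (A # w)" for l
      using x that by (cases l) (auto simp: funpow_swap1)
    then show ?thesis by blast
  qed
qed simp

lemma finite_disjoint_compact_gap:
  fixes \<C> :: "'a::heine_borel set set"
  assumes "finite \<C>" "\<And>A. A \<in> \<C> \<Longrightarrow> compact A" "\<And>A B. \<lbrakk>A \<in> \<C>; B \<in> \<C>; A \<noteq> B\<rbrakk> \<Longrightarrow> A \<inter> B = {}"
  shows "\<exists>\<epsilon>>0. \<forall>A\<in>\<C>. \<forall>B\<in>\<C>. A \<noteq> B \<longrightarrow> (\<forall>x\<in>A. \<forall>y\<in>B. dist x y > \<epsilon>)"
proof -
  have ex: "\<exists>e>0. \<forall>x\<in>fst p. \<forall>y\<in>snd p. dist x y > e"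
    if "p \<in> {(A, B). A \<in> \<C> \<and> B \<in> \<C> \<and> A \<noteq> B}" for p
  proof -
    have p: "compact (fst p)" "closed (snd p)" "fst p \<inter> snd p = {}"
      using that by (auto simp: case_prod_unfold intro: assms(2) compact_imp_closed[OF assms(2)] dest: assms(3))
    obtain d where d: "d > 0" "\<And>x y. \<lbrakk>x \<in> fst p; y \<in> snd p\<rbrakk> \<Longrightarrow> d \<le> dist x y"
      using separate_compact_closed[OF p] by blast
    \<comment> \<open>Halving makes the inequality strict, as \<open>dyn_separated\<close>
      demands.\<close>
    have "d / 2 < dist x y" if "x \<in> fst p" "y \<in> snd p" for x y
      using d(1) d(2)[OF that] by simp
    then show ?thesis using d(1) by (intro exI[of _ "d/2"]) auto
  qed
  define e where "e p = (SOME e. e > 0 \<and> (\<forall>x\<in>fst p. \<forall>y\<in>snd p. dist x y > e))" for p :: "'a set \<times> 'a set"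
  have e: "e p > 0 \<and> (\<forall>x\<in>fst p. \<forall>y\<in>snd p. dist x y > e p)"
    if "p \<in> {(A, B). A \<in> \<C> \<and> B \<in> \<C> \<and> A \<noteq> B}" for p
    unfolding e_def using someI_ex[OF ex[OF that]] by simp
  \<comment> \<open>The element \<open>1\<close> keeps \<open>Min R\<close> meaningful when there is
    no pair of distinct sets.\<close>
  define R where "R = insert 1 (e ` {(A, B). A \<in> \<C> \<and> B \<in> \<C> \<and> A \<noteq> B})"
  have "finite {(A, B). A \<in> \<C> \<and> B \<in> \<C> \<and> A \<noteq> B}"
    by (rule finite_subset[of _ "\<C> \<times> \<C>"]) (use \<open>finite \<C>\<close> in auto)
  then have "finite R" unfolding R_def by simp
  have "Min R > 0" using \<open>finite R\<close> e unfolding R_def by (subst Min_gr_iff) auto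
  moreover have "Min R < dist x y" if "A \<in> \<C>" "B \<in> \<C>" "A \<noteq> B" "x \<in> A" "y \<in> B" for A B x y
  proof -
    have "Min R \<le> e (A, B)" using \<open>finite R\<close> that unfolding R_def by (intro Min_le) auto
    moreover have "e (A, B) < dist x y" using e[of "(A, B)"] that by simp
    ultimately show ?thesis by simp
  qed
  ultimately show ?thesis by blast
qed

text \<open>Each word of length \<open>L\<close> over \<open>\<C>\<close> is the itinerary of a
  point under \<open>T ^^ N\<close>, and different words are told apart at a multiple of
  \<open>N\<close> by the gap between the compact sets. So \<open>card \<C> ^ L\<close> points are
  separated within \<open>N * L\<close> steps, and a bound along this subsequence of times is enough
  for the \<open>limsup\<close>.\<close>

lemma h_top_ge_of_horseshoe:
  assumes "finite \<C>" "\<C> \<noteq> {}" and sub: "\<And>A. A \<in> \<C> \<Longrightarrow> A \<subseteq> {0..1}"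
    and comp: "\<And>A. A \<in> \<C> \<Longrightarrow> compact A" and ne: "\<And>A. A \<in> \<C> \<Longrightarrow> A \<noteq> {}"
    and disj: "\<And>A B. \<lbrakk>A \<in> \<C>; B \<in> \<C>; A \<noteq> B\<rbrakk> \<Longrightarrow> A \<inter> B = {}"
    and cov: "\<And>A. A \<in> \<C> \<Longrightarrow> \<Union>\<C> \<subseteq> (T ^^ N) ` A" and "N > 0"
  shows "ereal (ln (real (card \<C>)) / real N) \<le> h_top T"
proof -
  obtain \<epsilon> where \<epsilon>: "\<epsilon> > 0" "\<And>A B x y. \<lbrakk>A \<in> \<C>; B \<in> \<C>; A \<noteq> B; x \<in> A; y \<in> B\<rbrakk> \<Longrightarrow> dist x y > \<epsilon>"
    using finite_disjoint_compact_gap[of \<C>] assms by metis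
  define F where "F n = (SUP E\<in>{E. finite E \<and> dyn_separated T {0..1} n \<epsilon> E}. ereal (ln (real (card E)) / real n))" for n
  have low: "ereal (ln (real (card \<C>)) / real N) \<le> F (N * L)" if "L > 0" for L
  proof -
    define W where "W = {w. set w \<subseteq> \<C> \<and> length w = L}"
    have cardW: "card W = card \<C> ^ L" "finite W"
      unfolding W_def using \<open>finite \<C>\<close> by (auto intro: card_lists_length_eq finite_lists_length_eq)
    have "\<exists>x. \<forall>l<L. ((T ^^ N) ^^ l) x \<in> w ! l" if "w \<in> W" for w
      using horseshoe_itinerary[of \<C> "T ^^ N" w] cov ne that \<open>L > 0\<close> by (auto simp: W_def)
    then obtain g where g: "\<And>w l. \<lbrakk>w \<in> W; l < L\<rbrakk> \<Longrightarrow> (T ^^ (N * l)) (g w) \<in> w ! l"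
      by (metis funpow_mult)
    have mem: "w ! l \<in> \<C>" if "w \<in> W" "l < L" for w l
      using that by (auto simp: W_def dest: nth_mem)
    have sep: "\<exists>m<N * L. dist ((T ^^ m) (g w)) ((T ^^ m) (g w')) > \<epsilon>"
      if w: "w \<in> W" "w' \<in> W" "w \<noteq> w'" for w w'
    proof -
      obtain l where l: "l < L" "w ! l \<noteq> w' ! l"
        using w nth_equalityI[of w w'] by (auto simp: W_def)
      then have "dist ((T ^^ (N * l)) (g w)) ((T ^^ (N * l)) (g w')) > \<epsilon>"
        using \<epsilon>(2) mem g w by blast
      moreover have "N * l < N * L" using l \<open>N > 0\<close> by simp
      ultimately show ?thesis by blast
    qed
    have inj: "inj_on g W"
    proof (rule inj_onI, rule ccontr)
      fix w w' assume "w \<in> W" "w' \<in> W" "g w = g w'" "w \<noteq> w'"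
      then show False using sep[of w w'] \<epsilon>(1) by auto
    qed
    have gsub: "g w \<in> {0..1}" if "w \<in> W" for w
      using g[OF that \<open>L > 0\<close>] sub[OF mem[OF that \<open>L > 0\<close>]] by auto
    have "dyn_separated T {0..1} (N * L) \<epsilon> (g ` W)"
      unfolding dyn_separated_def using gsub sep by fastforce
    then have "ereal (ln (real (card (g ` W))) / real (N * L)) \<le> F (N * L)"
      unfolding F_def using cardW by (intro SUP_upper) auto
    moreover have "card (g ` W) = card \<C> ^ L" using card_image[OF inj] cardW by simp
    moreover have "card \<C> > 0" using assms by (simp add: card_gt_0_iff)
    ultimately show ?thesis using \<open>L > 0\<close> by (simp add: ln_realpow)
  qed
  have "strict_mono (\<lambda>L. N * Suc L)" using \<open>N > 0\<close> by (simp add: strict_mono_def)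
  have "ereal (ln (real (card \<C>)) / real N) \<le> liminf (\<lambda>L. F (N * Suc L))"
    by (intro Liminf_bounded always_eventually allI low) simp
  also have "\<dots> \<le> limsup (\<lambda>L. F (N * Suc L))" by (intro Liminf_le_Limsup) simp
  also have "\<dots> \<le> limsup F"
    using limsup_subseq_mono[OF \<open>strict_mono _\<close>, of F] by (simp add: comp_def)
  also have "\<dots> \<le> h_top T"
    unfolding h_top_def topological_entropy_def F_def using \<epsilon>(1) by (intro SUP_upper) auto
  finally show ?thesis .
qed

section \<open>Linearization along an eigenvector\<close>

locale interval_markov =
  fixes T :: "real \<Rightarrow> real" and C :: "real set set"
  assumes T: "interval_map T"
    and countable_C: "countable C"
    and intervals: "\<And>c. c \<in> C \<Longrightarrow> \<exists>a b. 0 \<le> a \<and> a < b \<and> b \<le> 1 \<and> c = {a..b}"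
    and interiors_disjoint: "\<And>c d. \<lbrakk>c \<in> C; d \<in> C; c \<noteq> d\<rbrakk> \<Longrightarrow> interior c \<inter> interior d = {}"
    and countable_rest: "countable ({0..1} - \<Union>C)"
    and monotone: "\<And>c. c \<in> C \<Longrightarrow> monotone_int T c"
    and markov: "\<And>c d. \<lbrakk>c \<in> C; d \<in> C; T ` c \<inter> interior d \<noteq> {}\<rbrakk> \<Longrightarrow> d \<subseteq> T ` c"
begin

text \<open>The substitute for a finite set of partition points: the endpoints of the pieces and the
  points outside all pieces. It is countable but in general not discrete, so no argument can walk
  from one piece to the next.\<close>

definition Q :: "real set" where
  "Q = {0..1} - \<Union>(interior ` C)"

definition orient :: "real set \<Rightarrow> real" where
  "orient c = (if mono_on c T then 1 else - 1)"

lemma C_interval: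
  assumes "c \<in> C"
  obtains p q where "0 \<le> p" "p < q" "q \<le> 1" "c = {p..q}" "interior c = {p<..<q}"
  using intervals[OF assms] interior_atLeastAtMost_real by metis

lemma C_ordered:
  assumes "{p..q} \<in> C" "{e..f} \<in> C" "{p..q} \<noteq> {e..f}"
  shows "q \<le> e \<or> f \<le> p"
proof (rule ccontr)
  assume "\<not> (q \<le> e \<or> f \<le> p)"
  moreover have "p < q" "e < f" using intervals[OF assms(1)] intervals[OF assms(2)] by force+
  ultimately have "(max p e + min q f) / 2 \<in> {p<..<q} \<inter> {e<..<f}" by (auto simp: max_def min_def)
  then show False using interiors_disjoint[OF assms] by (auto simp: interior_atLeastAtMost_real)
qed

lemma T_in: "x \<in> {0..1} \<Longrightarrow> T x \<in> {0..1}"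
  using T unfolding interval_map_def by blast

lemma Tn_in: "x \<in> {0..1} \<Longrightarrow> (T ^^ n) x \<in> {0..1}"
  using funpow_interval_map(2)[OF T] by blast

lemma T_cont: "continuous_on {0..1} T"
  using T by (auto simp: interval_map_def)

lemma C_subset: "c \<in> C \<Longrightarrow> c \<subseteq> {0..1}"
  using intervals by fastforce

lemma countable_Q: "countable Q"
proof -
  have "countable (c - interior c)" if c: "c \<in> C" for c
  proof -
    obtain p q where "c = {p..q}" "interior c = {p<..<q}" using C_interval[OF c] by metis
    then have "c - interior c \<subseteq> {p, q}" by auto
    then show ?thesis by (meson countable_finite finite.emptyI finite.insertI countable_subset)
  qed
  then have "countable (({0..1} - \<Union>C) \<union> (\<Union>c\<in>C. c - interior c))"
    using countable_rest countable_C by auto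
  then show ?thesis by (rule countable_subset[rotated]) (auto simp: Q_def)
qed

lemma Q_subset: "Q \<subseteq> {0..1}"
  by (auto simp: Q_def)

lemma not_Q: "x \<in> {0..1} \<Longrightarrow> x \<notin> Q \<Longrightarrow> \<exists>c\<in>C. x \<in> interior c"
  by (auto simp: Q_def)

lemma QI:
  assumes "x \<in> {0..1}" "\<And>p q. {p..q} \<in> C \<Longrightarrow> p < x \<Longrightarrow> x < q \<Longrightarrow> False"
  shows "x \<in> Q"
proof (rule ccontr)
  assume "x \<notin> Q"
  then obtain c where c: "c \<in> C" "x \<in> interior c" using not_Q assms by blast
  then show False using C_interval[OF c(1)] assms(2) by (metis greaterThanLessThan_iff)
qed

lemma QD:
  assumes "x \<in> Q" "{p..q} \<in> C"
  shows "x \<le> p \<or> q \<le> x"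
  using assms by (force simp: Q_def interior_atLeastAtMost_real)

lemma endpoints_Q:
  assumes "{p..q} \<in> C"
  shows "p \<in> Q" "q \<in> Q"
proof -
  have pq: "0 \<le> p" "p < q" "q \<le> 1" using intervals[OF assms] by force+
  have ends: "e \<ge> p \<or> f \<le> p" "e \<ge> q \<or> f \<le> q" if "{e..f} \<in> C" for e f
  proof -
    have "e < f" using intervals[OF that] by force
    then show "e \<ge> p \<or> f \<le> p" "e \<ge> q \<or> f \<le> q"
      using C_ordered[OF assms that] pq by (cases "{p..q} = {e..f}"; force)+
  qed
  have "p \<in> {0..1}" "q \<in> {0..1}" using pq by auto
  then show "p \<in> Q" "q \<in> Q" using ends by (meson QI not_le)+
qed

lemma zero_one_Q: "0 \<in> Q" "1 \<in> Q"
  using intervals by (auto intro!: QI) (force)+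

lemma image_C:
  assumes c: "{p..q} \<in> C"
  shows "orient {p..q} = 1 \<and> T ` {p..q} = {T p..T q} \<and> mono_on {p..q} T \<or>
         orient {p..q} = - 1 \<and> T ` {p..q} = {T q..T p} \<and> antimono_on {p..q} T"
proof -
  have pq: "p < q" "{p..q} \<subseteq> {0..1}" using intervals[OF c] C_subset[OF c] by force+
  have conn: "is_interval (T ` {p..q})"
    using continuous_on_subset[OF T_cont pq(2)]
    by (simp add: is_interval_connected_1 connected_continuous_image)
  have ends: "T p \<in> T ` {p..q}" "T q \<in> T ` {p..q}" using pq by auto
  have mem: "y \<in> T ` {p..q}" if "T p \<le> y \<and> y \<le> T q \<or> T q \<le> y \<and> y \<le> T p" for y
    using conn ends that unfolding is_interval_1 by blast
  show ?thesis
  proof (cases "mono_on {p..q} T")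
    case True
    then have "T ` {p..q} \<subseteq> {T p..T q}" using pq by (auto simp: mono_on_def)
    then have "T ` {p..q} = {T p..T q}" using mem by auto
    then show ?thesis using True by (simp add: orient_def)
  next
    case False
    then have am: "antimono_on {p..q} T" using monotone[OF c] by (auto simp: monotone_int_def)
    then have "T ` {p..q} \<subseteq> {T q..T p}" using pq by (auto simp: monotone_on_def)
    then have "T ` {p..q} = {T q..T p}" using mem by auto
    then show ?thesis using False am by (simp add: orient_def)
  qed
qed

text \<open>\<open>T p\<close> and \<open>T q\<close> are the extreme points of the image of the
  piece. If one of them lay inside some piece, the Markov condition would force the image to contain
  that whole piece and so to extend beyond its own endpoint.\<close>

lemma T_endpoints_Q:
  assumes c: "{p..q} \<in> C"
  shows "T p \<in> Q" "T q \<in> Q"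
proof -
  have pq: "p \<in> {p..q}" "q \<in> {p..q}" "{p..q} \<subseteq> {0..1}" using intervals[OF c] C_subset[OF c] by force+
  have False if d: "{e..f} \<in> C" and x: "e < T x" "T x < f" "x = p \<or> x = q" for e f x
  proof -
    have "T x \<in> T ` {p..q} \<inter> interior {e..f}" using pq x by (auto simp: interior_atLeastAtMost_real)
    then have "{e..f} \<subseteq> T ` {p..q}" using markov[OF c d] by blast
    moreover have "e \<in> {e..f}" "f \<in> {e..f}" using x by auto
    ultimately have "e \<in> T ` {p..q}" "f \<in> T ` {p..q}" by blast+
    moreover obtain I where I: "T ` {p..q} = I" "I = {T p..T q} \<or> I = {T q..T p}"
      using image_C[OF c] by blast
    ultimately have "e \<in> I" "f \<in> I" by simp_all
    then show False using I(2) x by auto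
  qed
  then show "T p \<in> Q" "T q \<in> Q" using pq T_in by (auto intro!: QI)
qed

text \<open>Moving \<open>x\<close> to the right and \<open>y\<close> to the left, each to the
  boundary of its piece, crosses at most one partial piece on either side. An increment over
  \<open>{x..y}\<close> thus splits into an increment between points of \<open>Q\<close> and at most
  two increments within pieces; this is the origin of the factor \<open>2\<close> in the later
  estimates.\<close>

lemma between_pieces:
  assumes xy: "x \<in> {0..1}" "y \<in> {0..1}" "x < y"
  shows "(\<exists>c\<in>C. x \<in> c \<and> y \<in> c) \<or>
    (\<exists>u\<in>Q. \<exists>w\<in>Q. x \<le> u \<and> u \<le> w \<and> w \<le> y \<and>
       (x = u \<or> (\<exists>c\<in>C. x \<in> c \<and> u \<in> c)) \<and> (w = y \<or> (\<exists>c\<in>C. w \<in> c \<and> y \<in> c)))"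
proof (rule disjCI)
  assume neg: "\<not> (\<exists>u\<in>Q. \<exists>w\<in>Q. x \<le> u \<and> u \<le> w \<and> w \<le> y \<and>
       (x = u \<or> (\<exists>c\<in>C. x \<in> c \<and> u \<in> c)) \<and> (w = y \<or> (\<exists>c\<in>C. w \<in> c \<and> y \<in> c)))"
  show "\<exists>c\<in>C. x \<in> c \<and> y \<in> c"
  proof (rule ccontr)
    assume no: "\<not> (\<exists>c\<in>C. x \<in> c \<and> y \<in> c)"
    have "\<exists>u\<in>Q. x \<le> u \<and> (x = u \<or> (\<exists>p. {p..u} \<in> C \<and> p < x)) \<and> u \<le> y"
    proof (cases "x \<in> Q")
      case False
      then obtain c where c: "c \<in> C" "x \<in> interior c" using not_Q xy by blast
      then obtain p q where pq: "c = {p..q}" "p < x" "x < q" using C_interval[OF c(1)] by (metis greaterThanLessThan_iff)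
      then have "q \<le> y" using no c xy by fastforce
      then show ?thesis using pq c endpoints_Q by (intro bexI[of _ q]) auto
    qed (use xy in auto)
    then obtain u where u: "u \<in> Q" "x \<le> u" "u \<le> y" "x = u \<or> (\<exists>p. {p..u} \<in> C \<and> p < x)" by blast
    have "\<exists>w\<in>Q. w \<le> y \<and> (w = y \<or> (\<exists>q. {w..q} \<in> C \<and> y < q))"
    proof (cases "y \<in> Q")
      case False
      then obtain c where c: "c \<in> C" "y \<in> interior c" using not_Q xy by blast
      then obtain p q where pq: "c = {p..q}" "p < y" "y < q" using C_interval[OF c(1)] by (metis greaterThanLessThan_iff)
      then show ?thesis using c endpoints_Q by (intro bexI[of _ p]) auto
    qed auto
    then obtain w where w: "w \<in> Q" "w \<le> y" "w = y \<or> (\<exists>q. {w..q} \<in> C \<and> y < q)" by blast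
    \<comment> \<open>Otherwise \<open>u\<close> would lie inside the piece \<open>{w..q}\<close>
      around \<open>y\<close>, but a point of \<open>Q\<close> lies inside no piece.\<close>
    have "u \<le> w"
      using w(3)
    proof
      assume "\<exists>q. {w..q} \<in> C \<and> y < q"
      then obtain q where "{w..q} \<in> C" "y < q" by blast
      then show ?thesis using QD[OF u(1)] u(3) by fastforce
    qed (use u in simp)
    moreover have "x = u \<or> (\<exists>c\<in>C. x \<in> c \<and> u \<in> c)" using u by fastforce
    moreover have "w = y \<or> (\<exists>c\<in>C. w \<in> c \<and> y \<in> c)" using w by fastforce
    ultimately show False using neg u w by blast
  qed
qed

end

section \<open>From a summable eigenvector to a map of constant slope\<close>

locale markov_eigenvector = interval_markov +
  fixes m :: "real set \<Rightarrow> real" and r :: real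
  assumes r: "r > 2"
    and m_nonneg: "\<And>c. c \<in> C \<Longrightarrow> 0 \<le> m c"
    and m_summable: "m summable_on C"
    and m_eigen: "\<And>c. c \<in> C \<Longrightarrow> infsum m {d\<in>C. d \<subseteq> T ` c} = r * m c"
    and m_pos: "infsum m C > 0"
begin

text \<open>Up to normalization, \<open>m c\<close> is to become the length of \<open>c\<close> in
  the new coordinate, and \<open>V\<close> is that coordinate at the points of \<open>Q\<close>.
  Only whole pieces are counted, so \<open>V\<close> keeps the value \<open>V p\<close> until the
  right endpoint of a piece \<open>{p..q}\<close>.\<close>

definition V :: "real \<Rightarrow> real" where
  "V x = infsum m {c\<in>C. c \<subseteq> {0..x}}"

definition piece :: "real \<Rightarrow> real set" where
  "piece x = (SOME c. c \<in> C \<and> x \<in> interior c)"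

text \<open>The value \<open>0\<close> on \<open>Q\<close> cuts the series for \<open>\<phi>\<close>
  off as soon as the orbit reaches \<open>Q\<close>, where the coordinate is already known to be
  \<open>V\<close>.\<close>

definition sg :: "real \<Rightarrow> real" where
  "sg x = (if x \<in> Q then 0 else orient (piece x))"

text \<open>The inhomogeneous term of \<open>\<phi> x = A x + sg x / r * \<phi> (T x)\<close>.
  Inside a piece \<open>{p..q}\<close> the infimum is \<open>p\<close> and \<open>V x\<close> is
  \<open>V p\<close>; on \<open>Q\<close> only \<open>V x\<close> is left.\<close>

definition A :: "real \<Rightarrow> real" where
  "A x = V x - sg x / r * V (T (Inf (piece x)))"

text \<open>
  The series solves \<open>\<phi> x = V p \<plusminus> (\<phi> (T x) - V (T p)) / r\<close> on each piece \<open>{p..q}\<close>, with \<open>\<phi> = V\<close> on \<open>Q\<close>.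
\<close>

definition \<phi> :: "real \<Rightarrow> real" where
  "\<phi> x = (\<Sum>n. (\<Prod>i<n. sg ((T ^^ i) x) / r) * A ((T ^^ n) x))"

lemma summable_sub: "D \<subseteq> C \<Longrightarrow> m summable_on D"
  using m_summable summable_on_subset by blast

lemma V_bounds: "0 \<le> V x" "V x \<le> infsum m C"
  unfolding V_def using m_nonneg summable_sub
  by (auto intro!: infsum_nonneg infsum_mono2)

text \<open>No piece straddles a point of \<open>Q\<close>, so each piece inside
  \<open>{0..w}\<close> lies entirely on one side of \<open>u\<close>.\<close>

lemma V_diff:
  assumes "u \<in> Q" "u \<le> w"
  shows "V w = V u + infsum m {c\<in>C. c \<subseteq> {u..w}}"
proof -
  have u: "u \<ge> 0" using assms Q_subset by auto
  have eq: "{c\<in>C. c \<subseteq> {0..w}} = {c\<in>C. c \<subseteq> {0..u}} \<union> {c\<in>C. c \<subseteq> {u..w}}"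
  proof -
    have "c \<subseteq> {0..u}" if c: "c \<in> C" "c \<subseteq> {0..w}" "\<not> c \<subseteq> {u..w}" for c
    proof -
      obtain p q where pq: "c = {p..q}" "p < q" using C_interval[OF c(1)] by metis
      then have "q \<le> u" using QD[OF assms(1), of p q] c by auto
      then show ?thesis using c pq by auto
    qed
    moreover have "{0..u} \<subseteq> {0..w}" "{u..w} \<subseteq> {0..w}" using u assms by auto
    ultimately show ?thesis by blast
  qed
  have "{c\<in>C. c \<subseteq> {0..u}} \<inter> {c\<in>C. c \<subseteq> {u..w}} = {}"
  proof -
    have False if c: "c \<in> C" "c \<subseteq> {0..u}" "c \<subseteq> {u..w}" for c
    proof -
      obtain p q where "c = {p..q}" "p < q" using C_interval[OF c(1)] by metis
      then show False using c by auto
    qed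
    then show ?thesis by blast
  qed
  then show ?thesis unfolding V_def eq by (intro infsum_Un_disjoint summable_sub) auto
qed

lemma V_mono:
  assumes "u \<in> Q" "u \<le> w"
  shows "V u \<le> V w"
  unfolding V_diff[OF assms] using m_nonneg by (auto intro: infsum_nonneg)

lemma subset_of_piece:
  assumes "{p..q} \<in> C" "d \<in> C" "d \<subseteq> {p..q}"
  shows "d = {p..q}"
proof (rule ccontr)
  assume ne: "d \<noteq> {p..q}"
  obtain e f where "d = {e..f}" "e < f" using C_interval[OF assms(2)] by metis
  then show False using C_ordered[of p q e f] assms ne by auto
qed

lemma V_right_endpoint:
  assumes "{p..q} \<in> C"
  shows "V q = V p + m {p..q}"
proof -
  have "p \<le> q" using intervals[OF assms] by force
  then have "V q = V p + infsum m {c\<in>C. c \<subseteq> {p..q}}" by (rule V_diff[OF endpoints_Q(1)[OF assms]])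
  also have "{c\<in>C. c \<subseteq> {p..q}} = {{p..q}}" using subset_of_piece[OF assms] assms by auto
  finally show ?thesis by simp
qed

lemma V_interior:
  assumes c: "{p..q} \<in> C" and x: "p < x" "x < q"
  shows "V x = V p"
proof -
  have False if d: "d \<in> C" "d \<subseteq> {p..x}" for d
  proof -
    have "d \<subseteq> {p..q}" using d x by auto
    then have "d = {p..q}" using subset_of_piece[OF c d(1)] by simp
    then show False using d x by auto
  qed
  then have "{c\<in>C. c \<subseteq> {p..x}} = {}" by blast
  then show ?thesis using V_diff[OF endpoints_Q(1)[OF c] less_imp_le[OF x(1)]] by (simp only: infsum_empty add_0_right)
qed

lemma V_0: "V 0 = 0" and V_1: "V 1 = infsum m C"
proof -
  have False if c: "c \<in> C" "c \<subseteq> {0..0}" for c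
  proof -
    obtain p q where "c = {p..q}" "p < q" using C_interval[OF c(1)] by metis
    moreover have "y = 0" if "y \<in> c" for y using c(2) that by auto
    ultimately show False by (metis atLeastAtMost_iff less_imp_le order_refl less_irrefl)
  qed
  then have "{c\<in>C. c \<subseteq> {0..0}} = {}" by blast
  then show "V 0 = 0" unfolding V_def by (simp only: infsum_empty add_0_right)
  have "{c\<in>C. c \<subseteq> {0..1}} = C" using C_subset by auto
  then show "V 1 = infsum m C" by (simp add: V_def)
qed

lemma piece_eq:
  assumes "{p..q} \<in> C" "p < x" "x < q"
  shows "piece x = {p..q}" "x \<notin> Q"
proof -
  have x: "x \<in> interior {p..q}" using assms by (simp add: interior_atLeastAtMost_real)
  then have "piece x \<in> C \<and> x \<in> interior (piece x)"
    unfolding piece_def using assms(1) by (intro someI[where P="\<lambda>c. c \<in> C \<and> x \<in> interior c"] conjI)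
  then show "piece x = {p..q}" using interiors_disjoint[of "piece x" "{p..q}"] assms(1) x by blast
  show "x \<notin> Q" using QD[OF _ assms(1), of x] assms by auto
qed

lemma abs_sg: "\<bar>sg x\<bar> \<le> 1"
  by (simp add: sg_def orient_def)

lemma abs_A: "\<bar>A x\<bar> \<le> 2 * infsum m C"
proof -
  have "\<bar>sg x / r * V (T (Inf (piece x)))\<bar> \<le> 1 * infsum m C"
    unfolding abs_mult
    using abs_sg[of x] r V_bounds by (intro mult_mono) (auto simp: field_simps)
  then show ?thesis using V_bounds[of x] unfolding A_def by linarith
qed

lemma abs_prod_sg: "\<bar>\<Prod>i<n. sg ((T ^^ i) x) / r\<bar> \<le> (1 / r) ^ n"
proof -
  have "\<bar>\<Prod>i<n. sg ((T ^^ i) x) / r\<bar> \<le> (\<Prod>i<n. 1 / r)"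
    unfolding abs_prod using abs_sg r by (intro prod_mono) (auto simp: divide_right_mono)
  then show ?thesis by simp
qed

lemma term_bound:
  "\<bar>(\<Prod>i<n. sg ((T ^^ i) x) / r) * A ((T ^^ n) x)\<bar> \<le> (1 / r) ^ n * (2 * infsum m C)"
  unfolding abs_mult using abs_prod_sg abs_A r by (intro mult_mono) auto

lemma geometric_bound_summable: "summable (\<lambda>n. (1 / r) ^ n * (2 * infsum m C))"
  using r by (intro summable_mult2 summable_geometric) auto

lemma terms_summable: "summable (\<lambda>n. (\<Prod>i<n. sg ((T ^^ i) x) / r) * A ((T ^^ n) x))"
  by (rule summable_comparison_test'[OF geometric_bound_summable]) (use term_bound in auto)

lemma phi_bounded: "\<exists>B. \<forall>x. \<bar>\<phi> x\<bar> \<le> B"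
proof (intro exI allI)
  fix x
  show "\<bar>\<phi> x\<bar> \<le> (\<Sum>n. (1 / r) ^ n * (2 * infsum m C))"
    unfolding \<phi>_def real_norm_def[symmetric]
    by (rule norm_suminf_le) (unfold real_norm_def, rule term_bound, rule geometric_bound_summable)
qed

lemma phi_unfold: "\<phi> x = A x + sg x / r * \<phi> (T x)"
proof -
  let ?f = "\<lambda>x n. (\<Prod>i<n. sg ((T ^^ i) x) / r) * A ((T ^^ n) x)"
  have prods: "(\<Prod>i<Suc n. sg ((T ^^ i) x) / r) = sg x / r * (\<Prod>i<n. sg ((T ^^ i) (T x)) / r)" for n
    unfolding prod.lessThan_Suc_shift by (simp add: funpow_swap1)
  then have Suc: "?f x (Suc n) = sg x / r * ?f (T x) n" for n
    by (simp only: prods funpow_Suc_right o_apply mult.assoc)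
  have "\<phi> x = ?f x 0 + (\<Sum>n. ?f x (Suc n))"
    unfolding \<phi>_def using suminf_split_head[OF terms_summable, of x] by simp
  also have "(\<Sum>n. ?f x (Suc n)) = sg x / r * \<phi> (T x)"
    unfolding Suc \<phi>_def by (rule suminf_mult[OF terms_summable])
  finally show ?thesis by simp
qed

lemma phi_Q: "x \<in> Q \<Longrightarrow> \<phi> x = V x"
  using phi_unfold[of x] by (simp add: A_def sg_def)

lemma phi_piece:
  assumes c: "{p..q} \<in> C" and x: "x \<in> {p..q}"
  shows "\<phi> x = V p + orient {p..q} / r * (\<phi> (T x) - V (T p))"
proof -
  have "p < q" using intervals[OF c] by force
  consider "p < x" "x < q" | "x = p" | "x = q" using x by fastforce
  then show ?thesis
  proof cases
    case 1
    then show ?thesis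
      using phi_unfold[of x] V_interior[OF c 1] piece_eq[OF c 1] \<open>p < q\<close>
      by (simp add: A_def sg_def algebra_simps)
  next
    case 2
    then show ?thesis using phi_Q endpoints_Q[OF c] T_endpoints_Q[OF c] by simp
  next
    case 3
    \<comment> \<open>At the right endpoint the value \<open>V q\<close> prescribed on
      \<open>Q\<close> has to agree with the formula for the piece. This is where the eigenvector
      equation enters.\<close>
    have "orient {p..q} * (V (T q) - V (T p)) = r * m {p..q}"
      using image_C[OF c]
    proof (elim disjE conjE)
      assume *: "orient {p..q} = 1" "T ` {p..q} = {T p..T q}"
      have "T q \<in> T ` {p..q}" using \<open>p < q\<close> by auto
      then have "T p \<le> T q" unfolding *(2) by simp
      then have "V (T q) = V (T p) + infsum m {d\<in>C. d \<subseteq> T ` {p..q}}"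
        unfolding *(2) by (rule V_diff[OF T_endpoints_Q(1)[OF c]])
      then show ?thesis unfolding m_eigen[OF c] *(1) by simp
    next
      assume *: "orient {p..q} = - 1" "T ` {p..q} = {T q..T p}"
      have "T q \<in> T ` {p..q}" using \<open>p < q\<close> by auto
      then have "T q \<le> T p" unfolding *(2) by simp
      then have "V (T p) = V (T q) + infsum m {d\<in>C. d \<subseteq> T ` {p..q}}"
        unfolding *(2) by (rule V_diff[OF T_endpoints_Q(2)[OF c]])
      then show ?thesis unfolding m_eigen[OF c] *(1) by simp
    qed
    then have "V q = V p + orient {p..q} / r * (V (T q) - V (T p))"
      using V_right_endpoint[OF c] r by (simp add: field_simps)
    then show ?thesis using 3 phi_Q endpoints_Q[OF c] T_endpoints_Q[OF c] by simp
  qed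
qed

lemma phi_piece_diff:
  assumes c: "c \<in> C" and "x \<in> c" "y \<in> c"
  shows "\<phi> x - \<phi> y = orient c / r * (\<phi> (T x) - \<phi> (T y))"
proof -
  obtain p q where pq: "c = {p..q}" using C_interval[OF c] by metis
  show ?thesis using phi_piece[of p q x] phi_piece[of p q y] assms pq by (simp add: algebra_simps)
qed

text \<open>
  On a piece, \<open>T\<close> turns a violation of monotonicity into one that is \<open>r\<close> times larger. Two points
  in different pieces lose at most two such contributions, since \<open>V\<close> is monotone on \<open>Q\<close>; as \<open>r > 2\<close>, the
  supremum of the violations vanishes. Continuity follows by the same contraction.
\<close>

lemma phi_mono:
  assumes xy: "x \<in> {0..1}" "y \<in> {0..1}" "x \<le> y"
  shows "\<phi> x \<le> \<phi> y"
proof -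
  define W where "W = {\<phi> x - \<phi> y |x y. x \<in> {0..1} \<and> y \<in> {0..1} \<and> x \<le> y}"
  define \<omega> where "\<omega> = Sup W"
  obtain B where B: "\<And>x. \<bar>\<phi> x\<bar> \<le> B" using phi_bounded by blast
  have bdd: "bdd_above W"
  proof (rule bdd_aboveI)
    fix z assume "z \<in> W"
    then show "z \<le> 2 * B" unfolding W_def using B by (smt (verit) mem_Collect_eq)
  qed
  have le: "\<phi> x - \<phi> y \<le> \<omega>" if "x \<in> {0..1}" "y \<in> {0..1}" "x \<le> y" for x y
  proof -
    have "\<phi> x - \<phi> y \<in> W" unfolding W_def using that by blast
    then show ?thesis unfolding \<omega>_def using bdd by (rule cSup_upper)
  qed
  have \<omega>0: "\<omega> \<ge> 0" using le[of 0 0] by simp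
  have piece: "\<phi> x - \<phi> y \<le> \<omega> / r" if c: "c \<in> C" "x \<in> c" "y \<in> c" "x \<le> y" for c x y
  proof -
    obtain p q where pq: "c = {p..q}" using C_interval[OF c(1)] by metis
    have in01: "T x \<in> {0..1}" "T y \<in> {0..1}" using T_in C_subset[OF c(1)] c by blast+
    have "orient c * (\<phi> (T x) - \<phi> (T y)) \<le> \<omega>"
      using image_C[OF c(1)[unfolded pq]] unfolding pq
    proof (elim disjE conjE)
      assume "orient {p..q} = 1" "mono_on {p..q} T"
      then show "orient {p..q} * (\<phi> (T x) - \<phi> (T y)) \<le> \<omega>"
        using le[OF in01] c pq by (auto simp: mono_on_def)
    next
      assume "orient {p..q} = -1" "antimono_on {p..q} T"
      then show "orient {p..q} * (\<phi> (T x) - \<phi> (T y)) \<le> \<omega>"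
        using le[OF in01(2,1)] c pq by (auto simp: monotone_on_def)
    qed
    then show ?thesis unfolding phi_piece_diff[OF c(1-3)] using r by (simp add: divide_right_mono)
  qed
  have "\<phi> x - \<phi> y \<le> 2 / r * \<omega>" if xy: "x \<in> {0..1}" "y \<in> {0..1}" "x \<le> y" for x y
  proof (cases "x = y")
    case False
    then have "x < y" using xy by simp
    have wr: "0 \<le> \<omega> / r" using \<omega>0 r by simp
    show ?thesis
      using between_pieces[OF xy(1,2) \<open>x < y\<close>]
    proof
      assume "\<exists>c\<in>C. x \<in> c \<and> y \<in> c"
      then obtain c where "c \<in> C" "x \<in> c" "y \<in> c" by blast
      then show ?thesis using piece[of c x y] xy wr by simp
    next
      assume "\<exists>u\<in>Q. \<exists>w\<in>Q. x \<le> u \<and> u \<le> w \<and> w \<le> y \<and>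
        (x = u \<or> (\<exists>c\<in>C. x \<in> c \<and> u \<in> c)) \<and> (w = y \<or> (\<exists>c\<in>C. w \<in> c \<and> y \<in> c))"
      then obtain u w where uw: "u \<in> Q" "w \<in> Q" "x \<le> u" "u \<le> w" "w \<le> y"
        and x: "x = u \<or> (\<exists>c\<in>C. x \<in> c \<and> u \<in> c)" and y: "w = y \<or> (\<exists>c\<in>C. w \<in> c \<and> y \<in> c)"
        by blast
      have "\<phi> x - \<phi> u \<le> \<omega> / r" using x piece[of _ x u] uw wr by auto
      moreover have "\<phi> w - \<phi> y \<le> \<omega> / r" using y piece[of _ w y] uw wr by auto
      moreover have "\<phi> u \<le> \<phi> w" using V_mono phi_Q uw by simp
      ultimately show ?thesis by simp
    qed
  qed (use \<omega>0 r in auto)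
  then have "z \<le> 2 / r * \<omega>" if "z \<in> W" for z using that unfolding W_def by blast
  moreover have "\<phi> 0 - \<phi> 0 \<in> W" unfolding W_def by force
  ultimately have "Sup W \<le> 2 / r * \<omega>" by (intro cSup_least) blast+
  then have "\<omega> \<le> 2 / r * \<omega>" by (simp only: \<omega>_def)
  then have "\<omega> * r \<le> 2 * \<omega>" using r by (simp add: field_simps)
  then have "\<omega> \<le> 0" using r \<omega>0 mult_strict_left_mono[of 2 r \<omega>] by (smt (verit) mult.commute)
  then show ?thesis using le[OF xy] by simp
qed

text \<open>Finitely many pieces carry all but \<open>\<epsilon>\<close> of the total mass. An
  interval shorter than each of them contains none of them, so \<open>V\<close> grows over it by at
  most the remaining mass.\<close>

lemma V_uniform:
  assumes "\<epsilon> > 0"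
  shows "\<exists>\<eta>>0. \<forall>u\<in>Q. \<forall>w\<in>Q. u \<le> w \<and> w - u < \<eta> \<longrightarrow> V w - V u \<le> \<epsilon>"
proof -
  obtain F where F: "finite F" "F \<subseteq> C" "dist (sum m F) (infsum m C) \<le> \<epsilon>"
    using infsum_finite_approximation[OF m_summable assms] by blast
  have "\<forall>c\<in>C. \<exists>l>0. \<forall>u w. c \<subseteq> {u..w} \<longrightarrow> l \<le> w - u"
  proof
    fix c assume "c \<in> C"
    then obtain p q where "c = {p..q}" "p < q" using C_interval by metis
    then show "\<exists>l>0. \<forall>u w. c \<subseteq> {u..w} \<longrightarrow> l \<le> w - u" by (intro exI[of _ "q - p"]) auto
  qed
  then obtain l where l: "\<And>c. c \<in> C \<Longrightarrow> l c > 0" "\<And>c u w. \<lbrakk>c \<in> C; c \<subseteq> {u..w}\<rbrakk> \<Longrightarrow> l c \<le> w - u"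
    by metis
  define \<eta> where "\<eta> = Min (insert 1 (l ` F))"
  have "\<eta> > 0" unfolding \<eta>_def using F l by (subst Min_gr_iff) auto
  moreover have "V w - V u \<le> \<epsilon>" if uw: "u \<in> Q" "w \<in> Q" "u \<le> w" "w - u < \<eta>" for u w
  proof -
    have *: "{c\<in>C. c \<subseteq> {u..w}} \<subseteq> C - F"
    proof safe
      fix c assume c: "c \<in> C" "c \<subseteq> {u..w}" "c \<in> F"
      have "\<eta> \<le> l c" unfolding \<eta>_def using c F by (intro Min_le) auto
      then show False using l(2)[OF c(1,2)] uw by simp
    qed
    have "V w - V u = infsum m {c\<in>C. c \<subseteq> {u..w}}" using V_diff[OF uw(1,3)] by linarith
    also have "\<dots> \<le> infsum m (C - F)"
      using * m_nonneg by (intro infsum_mono2 summable_sub) auto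
    also have "\<dots> = infsum m C - sum m F"
      using infsum_Un_disjoint[of m F "C - F"] F summable_sub[of F] summable_sub[of "C - F"]
      by (simp add: Un_absorb1)
    also have "\<dots> \<le> \<epsilon>" using F(3) by (simp add: dist_real_def)
    finally show ?thesis .
  qed
  ultimately show ?thesis by blast
qed

lemma phi_modulus:
  assumes B: "\<And>x. \<bar>\<phi> x\<bar> \<le> B" and "\<epsilon> > 0"
  shows "\<exists>\<eta>>0. \<forall>x\<in>{0..1}. \<forall>y\<in>{0..1}. \<bar>x - y\<bar> < \<eta> \<longrightarrow> \<bar>\<phi> x - \<phi> y\<bar> \<le> (2 / r) ^ n * (2 * B) + \<epsilon>"
  using \<open>\<epsilon> > 0\<close>
proof (induction n arbitrary: \<epsilon>)
  case 0
  have "\<bar>\<phi> x - \<phi> y\<bar> \<le> 2 * B" for x y using B[of x] B[of y] by linarith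
  then have "\<bar>\<phi> x - \<phi> y\<bar> \<le> 2 * B + \<epsilon>" for x y using 0 by (meson add_increasing2 less_imp_le)
  then show ?case by (auto intro: exI[of _ 1])
next
  case (Suc n)
  \<comment> \<open>Splitting of the error: the \<open>\<epsilon> / 2\<close> inside
    \<open>\<beta>\<close> returns as \<open>\<epsilon> / r\<close>, which is at most
    \<open>\<epsilon> / 2\<close>, and the increment of \<open>V\<close> between points of
    \<open>Q\<close> takes another \<open>\<epsilon> / 4\<close>.\<close>
  define \<beta> where "\<beta> = (2 / r) ^ n * (2 * B) + \<epsilon> / 2"
  obtain \<eta>1 where \<eta>1: "\<eta>1 > 0"
    "\<And>x y. \<lbrakk>x \<in> {0..1}; y \<in> {0..1}; \<bar>x - y\<bar> < \<eta>1\<rbrakk> \<Longrightarrow> \<bar>\<phi> x - \<phi> y\<bar> \<le> \<beta>"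
    unfolding \<beta>_def using Suc.IH[of "\<epsilon> / 2"] Suc.prems by (metis half_gt_zero)
  have "uniformly_continuous_on {0..1} T"
    using T_cont by (intro compact_uniformly_continuous) auto
  then obtain \<eta>2 where \<eta>2: "\<eta>2 > 0"
    "\<And>x y. \<lbrakk>x \<in> {0..1}; y \<in> {0..1}; \<bar>x - y\<bar> < \<eta>2\<rbrakk> \<Longrightarrow> \<bar>T x - T y\<bar> < \<eta>1"
    using \<eta>1(1) unfolding uniformly_continuous_on_def dist_real_def by metis
  obtain \<eta>3 where \<eta>3: "\<eta>3 > 0" "\<And>u w. \<lbrakk>u \<in> Q; w \<in> Q; u \<le> w; w - u < \<eta>3\<rbrakk> \<Longrightarrow> V w - V u \<le> \<epsilon> / 4"
    using V_uniform[of "\<epsilon> / 4"] Suc.prems by auto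
  have \<beta>0: "\<beta> \<ge> 0" using \<eta>1(2)[of 0 0] \<eta>1(1) by simp
  have r\<beta>: "\<beta> / r \<ge> 0" using \<beta>0 r by simp
  have piece: "\<phi> y - \<phi> x \<le> \<beta> / r" if "c \<in> C" "x \<in> c" "y \<in> c" "\<bar>x - y\<bar> < \<eta>2" for c x y
  proof -
    have in01: "x \<in> {0..1}" "y \<in> {0..1}" using C_subset that by blast+
    have "\<bar>orient c\<bar> = 1" by (simp add: orient_def)
    then have "\<bar>\<phi> x - \<phi> y\<bar> = \<bar>\<phi> (T x) - \<phi> (T y)\<bar> / r"
      unfolding phi_piece_diff[OF that(1-3)] using r by (simp add: abs_mult)
    also have "\<dots> \<le> \<beta> / r"
      using \<eta>1(2)[OF T_in[OF in01(1)] T_in[OF in01(2)] \<eta>2(2)[OF in01 that(4)]] r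
      by (simp add: divide_right_mono)
    finally show ?thesis by linarith
  qed
  have lt: "\<phi> y - \<phi> x \<le> 2 * (\<beta> / r) + \<epsilon> / 4"
    if xy: "x \<in> {0..1}" "y \<in> {0..1}" "x < y" "\<bar>x - y\<bar> < min \<eta>2 \<eta>3" for x y
    using between_pieces[OF xy(1,2,3)]
  proof
    assume "\<exists>c\<in>C. x \<in> c \<and> y \<in> c"
    then obtain c where "c \<in> C" "x \<in> c" "y \<in> c" by blast
    then have "\<phi> y - \<phi> x \<le> \<beta> / r" using piece xy by auto
    then show ?thesis using r\<beta> Suc.prems by linarith
  next
    assume "\<exists>u\<in>Q. \<exists>w\<in>Q. x \<le> u \<and> u \<le> w \<and> w \<le> y \<and>
      (x = u \<or> (\<exists>c\<in>C. x \<in> c \<and> u \<in> c)) \<and> (w = y \<or> (\<exists>c\<in>C. w \<in> c \<and> y \<in> c))"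
    then obtain u w where uw: "u \<in> Q" "w \<in> Q" "x \<le> u" "u \<le> w" "w \<le> y"
      and x: "x = u \<or> (\<exists>c\<in>C. x \<in> c \<and> u \<in> c)" and y: "w = y \<or> (\<exists>c\<in>C. w \<in> c \<and> y \<in> c)"
      by blast
    have "\<phi> u - \<phi> x \<le> \<beta> / r" using x piece[of _ x u] uw xy r\<beta> by auto
    moreover have "\<phi> y - \<phi> w \<le> \<beta> / r" using y piece[of _ w y] uw xy r\<beta> by auto
    moreover have "\<phi> w - \<phi> u \<le> \<epsilon> / 4" using \<eta>3(2)[of u w] phi_Q uw xy by simp
    ultimately show ?thesis by simp
  qed
  have "2 * (\<beta> / r) + \<epsilon> / 4 = (2 / r) ^ Suc n * (2 * B) + \<epsilon> / r + \<epsilon> / 4"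
  proof -
    have "2 * ((z * (2 * B) + \<epsilon> / 2) / r) + \<epsilon> / 4 = (2 / r * z) * (2 * B) + \<epsilon> / r + \<epsilon> / 4" for z
      using r by (simp add: field_simps)
    then show ?thesis unfolding \<beta>_def power_Suc .
  qed
  also have "\<dots> \<le> (2 / r) ^ Suc n * (2 * B) + \<epsilon>"
  proof -
    have "\<epsilon> / r \<le> \<epsilon> / 2" using r Suc.prems by (intro divide_left_mono) auto
    then show ?thesis using Suc.prems by linarith
  qed
  finally have fin: "2 * (\<beta> / r) + \<epsilon> / 4 \<le> (2 / r) ^ Suc n * (2 * B) + \<epsilon>" .
  have "\<bar>\<phi> x - \<phi> y\<bar> \<le> (2 / r) ^ Suc n * (2 * B) + \<epsilon>"
    if xy: "x \<in> {0..1}" "y \<in> {0..1}" "\<bar>x - y\<bar> < min \<eta>2 \<eta>3" for x y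
  proof (cases x y rule: linorder_cases)
    case less
    then show ?thesis using lt[OF xy(1,2) less xy(3)] phi_mono[OF xy(1,2)] fin by linarith
  next
    case equal
    have "0 \<le> 2 * (\<beta> / r) + \<epsilon> / 4" using r\<beta> Suc.prems by simp
    then show ?thesis using equal fin by simp
  next
    case greater
    then show ?thesis using lt[OF xy(2,1) greater] xy(3) phi_mono[OF xy(2,1)] fin
      by (simp add: abs_minus_commute)
  qed
  then show ?case using \<eta>2(1) \<eta>3(1) by (intro exI[of _ "min \<eta>2 \<eta>3"]) auto
qed

lemma phi_continuous: "continuous_on {0..1} \<phi>"
  unfolding continuous_on_iff
proof (intro ballI allI impI)
  fix x e :: real assume x: "x \<in> {0..1}" and "e > 0"
  obtain B where B: "\<And>x. \<bar>\<phi> x\<bar> \<le> B" using phi_bounded by blast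
  have "(\<lambda>n. (2 / r) ^ n * (2 * B)) \<longlonglongrightarrow> 0 * (2 * B)"
    using r by (intro tendsto_mult tendsto_const LIMSEQ_realpow_zero) auto
  then have "\<forall>\<^sub>F n in sequentially. (2 / r) ^ n * (2 * B) < e / 2"
    using \<open>e > 0\<close> by (intro order_tendstoD(2)) auto
  then obtain n where n: "(2 / r) ^ n * (2 * B) < e / 2"
    by (auto simp: eventually_sequentially)
  obtain \<eta> where \<eta>: "\<eta> > 0" "\<forall>x\<in>{0..1}. \<forall>y\<in>{0..1}. \<bar>x - y\<bar> < \<eta> \<longrightarrow> \<bar>\<phi> x - \<phi> y\<bar> \<le> (2 / r) ^ n * (2 * B) + e / 4"
    using phi_modulus[OF B, of "e / 4" n] \<open>e > 0\<close> by auto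
  show "\<exists>d>0. \<forall>x'\<in>{0..1}. dist x' x < d \<longrightarrow> dist (\<phi> x') (\<phi> x) < e"
  proof (intro exI[of _ \<eta>] conjI ballI impI)
    fix x' assume "x' \<in> {0..1}" "dist x' x < \<eta>"
    then have "\<bar>\<phi> x' - \<phi> x\<bar> \<le> (2 / r) ^ n * (2 * B) + e / 4"
      using \<eta>(2) x by (auto simp: dist_real_def)
    then show "dist (\<phi> x') (\<phi> x) < e" using n \<open>e > 0\<close> unfolding dist_real_def by linarith
  qed (use \<eta> in simp)
qed

lemma phi_T_continuous: "continuous_on {0..1} (\<lambda>x. \<phi> (T x))"
  using T_in by (intro continuous_on_compose2[OF phi_continuous T_cont]) auto

text \<open>Within a piece, \<open>phi_piece_diff\<close> gives equality. To pass across the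
  countable set \<open>Q\<close>, the bound is expressed as monotonicity of both
  \<open>r * \<phi> x - \<phi> (T x)\<close> and \<open>r * \<phi> x + \<phi> (T x)\<close>, which
  \<open>countable_exception_mono\<close> allows to be tested outside \<open>Q\<close>.\<close>

lemma phi_lipschitz_le:
  assumes xy: "x \<in> {0..1}" "y \<in> {0..1}" "x \<le> y"
  shows "\<bar>\<phi> (T x) - \<phi> (T y)\<bar> \<le> r * (\<phi> y - \<phi> x)"
proof -
  have one: "r * \<phi> x - s * \<phi> (T x) \<le> r * \<phi> y - s * \<phi> (T y)" if s: "\<bar>s\<bar> = 1" for s
  proof (rule countable_exception_mono[where h = "\<lambda>x. r * \<phi> x - s * \<phi> (T x)" and Q = Q])
    show "continuous_on {x..y} (\<lambda>x. r * \<phi> x - s * \<phi> (T x))"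
      using xy by (intro continuous_intros continuous_on_subset[OF phi_continuous]
        continuous_on_subset[OF phi_T_continuous]) auto
    fix z assume z: "x \<le> z" "z < y" "z \<notin> Q"
    then have "z \<in> {0..1}" using xy by auto
    then obtain c where c: "c \<in> C" "z \<in> interior c" using not_Q z by blast
    then obtain p q where pq: "c = {p..q}" "p < z" "z < q"
      using C_interval[OF c(1)] by (metis greaterThanLessThan_iff)
    have "r * \<phi> z - s * \<phi> (T z) \<le> r * \<phi> t - s * \<phi> (T t)" if t: "z < t" "t < z + (q - z)" for t
    proof -
      have tc: "t \<in> c" "z \<in> c" using pq t by auto
      then have t01: "t \<in> {0..1}" using C_subset[OF c(1)] by blast
      have "r * (\<phi> t - \<phi> z) = orient c * (\<phi> (T t) - \<phi> (T z))"
        unfolding phi_piece_diff[OF c(1) tc] using r by simp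
      moreover have "r * (\<phi> t - \<phi> z) \<ge> 0"
        using phi_mono[OF \<open>z \<in> {0..1}\<close> t01] t r by simp
      moreover have "orient c = 1 \<or> orient c = -1" by (simp add: orient_def)
      moreover have "s = 1 \<or> s = -1" using s by linarith
      ultimately show ?thesis by (auto simp: algebra_simps)
    qed
    then show "\<exists>d>0. \<forall>t. z < t \<and> t < z + d \<and> t \<le> y \<longrightarrow> r * \<phi> z - s * \<phi> (T z) \<le> r * \<phi> t - s * \<phi> (T t)"
      using pq by (intro exI[of _ "q - z"]) auto
  qed (use xy countable_Q in auto)
  show ?thesis using one[of 1] one[of "-1"] by (simp add: algebra_simps)
qed

lemma phi_lipschitz:
  assumes "x \<in> {0..1}" "y \<in> {0..1}"
  shows "\<bar>\<phi> (T x) - \<phi> (T y)\<bar> \<le> r * \<bar>\<phi> x - \<phi> y\<bar>"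
proof (cases "x \<le> y")
  case True
  then show ?thesis using phi_lipschitz_le[OF assms] phi_mono[OF assms] by simp
next
  case False
  then show ?thesis using phi_lipschitz_le[OF assms(2,1)] phi_mono[OF assms(2,1)] by simp
qed

lemma phi_0: "\<phi> 0 = 0" and phi_1: "\<phi> 1 = infsum m C"
  using phi_Q zero_one_Q V_0 V_1 by auto

text \<open>If \<open>\<phi>\<close> were constant on an interval, the Lipschitz bound would make it
  constant on every image of that interval. By mixing, a late image meets both the region where
  \<open>\<phi>\<close> is below half of the total mass and the region where it is above.\<close>

lemma phi_strict_mono:
  assumes mix: "topologically_mixing T" and xy: "x \<in> {0..1}" "y \<in> {0..1}" "x < y"
  shows "\<phi> x < \<phi> y"
proof (rule ccontr)
  assume "\<not> \<phi> x < \<phi> y"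
  then have const: "\<phi> u = \<phi> x" if "u \<in> {x<..<y}" for u
    using phi_mono[of x u] phi_mono[of u y] that xy by force
  have const_n: "\<phi> ((T ^^ n) u) = \<phi> ((T ^^ n) w)" if uw: "u \<in> {x<..<y}" "w \<in> {x<..<y}" for n u w
  proof (induction n)
    case 0
    then show ?case using const uw by simp
  next
    case (Suc n)
    have "(T ^^ n) u \<in> {0..1}" "(T ^^ n) w \<in> {0..1}" using uw xy by (auto intro!: Tn_in simp del: atLeastAtMost_iff) auto
    then show ?case using phi_lipschitz Suc by fastforce
  qed
  define M where "M = infsum m C"
  define V1 V2 where "V1 = {0..1} \<inter> \<phi> -` {..<M/2}" and "V2 = {0..1} \<inter> \<phi> -` {M/2<..}"
  have op: "openin (top_of_set {0..1}) V1" "openin (top_of_set {0..1}) V2"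
    unfolding V1_def V2_def by (intro continuous_openin_preimage_gen[OF phi_continuous] open_lessThan open_greaterThan)+
  have ne: "0 \<in> V1" "1 \<in> V2" using phi_0 phi_1 m_pos by (auto simp: V1_def V2_def M_def)
  have U: "openin (top_of_set {0..1}) {x<..<y}" "{x<..<y} \<noteq> {}"
    using xy by (auto intro!: open_subset)
  obtain n1 where n1: "\<And>k. k \<ge> n1 \<Longrightarrow> (T ^^ k) ` {x<..<y} \<inter> V1 \<noteq> {}"
    using mix op(1) ne(1) U unfolding topologically_mixing_def by blast
  obtain n2 where n2: "\<And>k. k \<ge> n2 \<Longrightarrow> (T ^^ k) ` {x<..<y} \<inter> V2 \<noteq> {}"
    using mix op(2) ne(2) U unfolding topologically_mixing_def by blast
  obtain u where u: "u \<in> {x<..<y}" "(T ^^ (max n1 n2)) u \<in> V1" using n1[of "max n1 n2"] by force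
  obtain w where w: "w \<in> {x<..<y}" "(T ^^ (max n1 n2)) w \<in> V2" using n2[of "max n1 n2"] by force
  show False using const_n[OF u(1) w(1), of "max n1 n2"] u(2) w(2) by (simp add: V1_def V2_def)
qed

lemma linearizing_conjugacy:
  assumes mix: "topologically_mixing T"
  shows "\<exists>\<Phi> \<Psi>. homeomorphism {0..1} {0..1} \<Phi> \<Psi> \<and>
    (\<forall>x\<in>{0..1}. \<forall>y\<in>{0..1}. \<bar>\<Phi> (T x) - \<Phi> (T y)\<bar> \<le> r * \<bar>\<Phi> x - \<Phi> y\<bar>) \<and>
    constant_slope (\<lambda>y. \<Phi> (T (\<Psi> y))) r"
proof -
  define M where "M = infsum m C"
  have M: "M > 0" using m_pos by (simp add: M_def)
  define \<Phi> where "\<Phi> x = \<phi> x / M" for x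
  have cont: "continuous_on {0..1} \<Phi>"
    unfolding \<Phi>_def using phi_continuous M by (intro continuous_intros) auto
  have strict: "\<Phi> x < \<Phi> y" if "x \<in> {0..1}" "y \<in> {0..1}" "x < y" for x y
    unfolding \<Phi>_def using phi_strict_mono[OF mix that] M by (simp add: divide_strict_right_mono)
  have ends: "\<Phi> 0 = 0" "\<Phi> 1 = 1" using phi_0 phi_1 M by (auto simp: \<Phi>_def M_def)
  have mono: "\<Phi> x \<le> \<Phi> y" if "x \<in> {0..1}" "y \<in> {0..1}" "x \<le> y" for x y
    using strict[OF that(1,2)] that by (cases "x = y") auto
  have image: "\<Phi> ` {0..1} = {0..1}"
  proof
    show "\<Phi> ` {0..1} \<subseteq> {0..1}" using mono[of 0] mono[of _ 1] ends by auto
    show "{0..1} \<subseteq> \<Phi> ` {0..1}" using IVT'[of \<Phi> 0 _ 1] cont ends by fastforce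
  qed
  have "inj_on \<Phi> {0..1}"
    using strict by (intro linorder_inj_onI) force+
  then obtain \<Psi> where hom: "homeomorphism {0..1} {0..1} \<Phi> \<Psi>"
    using homeomorphism_compact[OF _ cont image] by blast
  have lip: "\<bar>\<Phi> (T x) - \<Phi> (T y)\<bar> \<le> r * \<bar>\<Phi> x - \<Phi> y\<bar>" if "x \<in> {0..1}" "y \<in> {0..1}" for x y
    using phi_lipschitz[OF that] M
    by (simp add: \<Phi>_def diff_divide_distrib[symmetric] abs_divide divide_right_mono)
  have \<Psi>: "\<Psi> y \<in> {0..1}" "\<Phi> (\<Psi> y) = y" if "y \<in> {0..1}" for y
    using hom that unfolding homeomorphism_def by blast+
  have \<Psi>\<Phi>: "\<Psi> (\<Phi> x) = x" if "x \<in> {0..1}" for x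
    using hom that unfolding homeomorphism_def by blast
  define f where "f y = \<Phi> (T (\<Psi> y))" for y
  have "continuous_on {0..1} \<Psi>" using hom by (simp add: homeomorphism_def)
  then have "continuous_on {0..1} f"
    unfolding f_def
    by (rule continuous_on_compose2[OF cont continuous_on_compose2[OF T_cont]]) (use \<Psi>(1) T_in in blast)+
  moreover have "f ` {0..1} \<subseteq> {0..1}"
    unfolding f_def using \<Psi>(1) T_in image by blast
  ultimately have "interval_map f" by (simp add: interval_map_def)
  have slope: "\<exists>d. (f has_real_derivative d) (at y within {0..1}) \<and> \<bar>d\<bar> = r"
    if y: "y \<in> {0..1}" "y \<notin> \<Phi> ` Q" for y
  proof -
    define x where "x = \<Psi> y"
    have x: "x \<in> {0..1}" "\<Phi> x = y" using \<Psi> y by (auto simp: x_def)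
    then have "x \<notin> Q" using y by auto
    then obtain c where c: "c \<in> C" "x \<in> interior c" using not_Q x by blast
    then obtain p q where pq: "0 \<le> p" "q \<le> 1" "c = {p..q}" "p < x" "x < q"
      using C_interval[OF c(1)] by (metis greaterThanLessThan_iff)
    have mem: "y \<in> {\<Phi> p<..<\<Phi> q}" using strict[of p x] strict[of x q] x pq by auto
    \<comment> \<open>On the image of one piece the conjugated map is affine, since there the
      increments of \<open>\<phi>\<close> and of \<open>\<phi>\<close> after \<open>T\<close> are
      proportional.\<close>
    have eq: "f z = \<Phi> (T x) + r * orient c * (z - y)" if z: "z \<in> {\<Phi> p<..<\<Phi> q}" for z
    proof -
      have "\<Phi> p \<in> {0..1}" "\<Phi> q \<in> {0..1}" using image pq by fastforce+
      then have "z \<in> {0..1}" using z by auto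
      define t where "t = \<Psi> z"
      have t: "t \<in> {0..1}" "\<Phi> t = z" using \<Psi> \<open>z \<in> {0..1}\<close> by (auto simp: t_def)
      have "p < t" using z t mono[of t p] pq by (force simp: not_less[symmetric])
      moreover have "t < q" using z t mono[of q t] pq by (force simp: not_less[symmetric])
      ultimately have "t \<in> c" "x \<in> c" using pq by auto
      from phi_piece_diff[OF c(1) this] have "orient c * (\<phi> (T t) - \<phi> (T x)) = r * (\<phi> t - \<phi> x)"
        using r by simp
      moreover have "orient c = 1 \<or> orient c = -1" by (simp add: orient_def)
      ultimately have "\<phi> (T t) = \<phi> (T x) + r * orient c * (\<phi> t - \<phi> x)" by auto
      then have "\<Phi> (T t) = \<Phi> (T x) + r * orient c * (\<Phi> t - \<Phi> x)"
        using M by (simp add: \<Phi>_def field_simps)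
      then show ?thesis unfolding f_def t_def[symmetric] t(2) x(2) .
    qed
    have "((\<lambda>z. \<Phi> (T x) + r * orient c * (z - y)) has_real_derivative r * orient c) (at y)"
      by (auto intro!: derivative_eq_intros)
    then have "(f has_real_derivative r * orient c) (at y)"
      by (rule has_field_derivative_transform_within_open[OF _ open_greaterThanLessThan mem]) (use eq in auto)
    then have "(f has_real_derivative r * orient c) (at y within {0..1})"
      by (rule has_field_derivative_at_within)
    moreover have "\<bar>r * orient c\<bar> = r" using r by (simp add: orient_def)
    ultimately show ?thesis by blast
  qed
  have "countable (\<Phi> ` Q)" using countable_Q by simp
  then have "countable {y\<in>{0..1}. \<not> (\<exists>d. (f has_real_derivative d) (at y within {0..1}) \<and> \<bar>d\<bar> = r)}"
    by (rule countable_subset[rotated]) (use slope in blast)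
  then have "constant_slope f r" using \<open>interval_map f\<close> by (simp add: constant_slope_def)
  then show ?thesis using hom lip unfolding f_def by blast
qed

end

section \<open>Refining a slack Markov partition\<close>

text \<open>The iterated images of such an interval would be single points, and a single point
  cannot meet both open halves of the unit interval. This is what gives a monotone branch only one
  orientation.\<close>

lemma mixing_not_constant:
  assumes mix: "topologically_mixing T" and ab: "0 \<le> a" "a < b" "b \<le> 1"
  shows "\<not> (\<forall>x\<in>{a..b}. T x = k)"
proof
  assume k: "\<forall>x\<in>{a..b}. T x = k"
  have "(T ^^ Suc n) x = (T ^^ n) k" if "x \<in> {a<..<b}" for n x
    using k that by (simp add: funpow_swap1)
  then have img: "(T ^^ Suc n) ` {a<..<b} \<subseteq> {(T ^^ n) k}" for n by blast
  have U: "openin (top_of_set {0..1}) {a<..<b}" "{a<..<b} \<noteq> {}"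
    using ab by (auto intro!: open_subset)
  have V: "openin (top_of_set {0..1}) {0<..<1/2::real}" "openin (top_of_set {0..1}) {1/2<..<1::real}"
    by (auto intro!: open_subset)
  have V': "{0<..<1/2::real} \<noteq> {}" "{1/2<..<1::real} \<noteq> {}" by auto
  obtain n1 where n1: "\<And>m. m \<ge> n1 \<Longrightarrow> (T ^^ m) ` {a<..<b} \<inter> {0<..<1/2} \<noteq> {}"
    using mix U V(1) V'(1) unfolding topologically_mixing_def by meson
  obtain n2 where n2: "\<And>m. m \<ge> n2 \<Longrightarrow> (T ^^ m) ` {a<..<b} \<inter> {1/2<..<1} \<noteq> {}"
    using mix U V(2) V'(2) unfolding topologically_mixing_def by meson
  define l where "l = (T ^^ (n1 + n2)) k"
  have single: "l \<in> V" if "A \<subseteq> {l}" "A \<inter> V \<noteq> {}" for A V using that by blast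
  have l: "(T ^^ Suc (n1 + n2)) ` {a<..<b} \<subseteq> {l}" unfolding l_def by (rule img)
  have "l \<in> {0<..<1/2}" "l \<in> {1/2<..<1}" by (rule single[OF l n1] single[OF l n2], simp)+
  then show False by auto
qed

lemma mono_on_closure:
  fixes f :: "real \<Rightarrow> real"
  assumes cont: "continuous_on (closure b) f" and mono: "mono_on b f"
  shows "mono_on (closure b) f"
proof (rule mono_onI)
  fix x y assume xy: "x \<in> closure b" "y \<in> closure b" "x \<le> y"
  show "f x \<le> f y"
  proof (cases "x = y")
    case False
    then have "x < y" using xy by simp
    obtain s where s: "\<And>n. s n \<in> b" "s \<longlonglongrightarrow> x" using xy(1) by (auto simp: closure_sequential)
    obtain t where t: "\<And>n. t n \<in> b" "t \<longlonglongrightarrow> y" using xy(2) by (auto simp: closure_sequential)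
    have "(\<lambda>n. f (s n)) \<longlonglongrightarrow> f x"
      by (rule continuous_on_tendsto_compose[OF cont s(2) xy(1)]) (use s closure_subset in \<open>auto intro!: always_eventually\<close>)
    moreover have "(\<lambda>n. f (t n)) \<longlonglongrightarrow> f y"
      by (rule continuous_on_tendsto_compose[OF cont t(2) xy(2)]) (use t closure_subset in \<open>auto intro!: always_eventually\<close>)
    \<comment> \<open>A point strictly between \<open>x\<close> and \<open>y\<close> separates the
      two approximating sequences, so they are eventually in the right order.\<close>
    moreover obtain c where "x < c" "c < y" using \<open>x < y\<close> dense by blast
    then have "\<forall>\<^sub>F n in sequentially. s n < c" "\<forall>\<^sub>F n in sequentially. c < t n"
      using order_tendstoD[OF s(2)] order_tendstoD[OF t(2)] by auto
    then have "\<forall>\<^sub>F n in sequentially. f (s n) \<le> f (t n)"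
      by eventually_elim (use mono s t in \<open>auto simp: mono_on_def\<close>)
    ultimately show ?thesis by (intro tendsto_le[OF sequentially_bot]) auto
  qed simp
qed

lemma mono_on_glue:
  fixes f :: "real \<Rightarrow> real"
  assumes b: "mono_on b f" "is_interval b" and c: "mono_on c f" "is_interval c" and z: "z \<in> b" "z \<in> c"
  shows "mono_on (b \<union> c) f"
proof (rule mono_onI)
  fix x y assume xy: "x \<in> b \<union> c" "y \<in> b \<union> c" "x \<le> y"
  have *: "f x \<le> f y"
    if b: "mono_on b f" "is_interval b" "z \<in> b" and c: "mono_on c f" "is_interval c" "z \<in> c"
      and "x \<in> b" "y \<in> c" for b c
  proof -
    consider "x \<le> z" "z \<le> y" | "y < z" | "z < x" by linarith
    then show ?thesis
    proof cases
      case 1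
      then have "f x \<le> f z" "f z \<le> f y" using that by (auto simp: mono_on_def)
      then show ?thesis by simp
    next
      case 2
      then have "y \<in> b" using b(2,3) \<open>x \<in> b\<close> xy unfolding is_interval_1 by (meson less_imp_le)
      then show ?thesis using b \<open>x \<in> b\<close> xy by (auto simp: mono_on_def)
    next
      case 3
      then have "x \<in> c" using c(2,3) \<open>y \<in> c\<close> xy unfolding is_interval_1 by (meson less_imp_le)
      then show ?thesis using c \<open>y \<in> c\<close> xy by (auto simp: mono_on_def)
    qed
  qed
  have same: "f x \<le> f y" if "x \<in> b \<and> y \<in> b \<or> x \<in> c \<and> y \<in> c"
    using that assms xy by (auto simp: mono_on_def)
  show "f x \<le> f y" using xy same *[of b c] *[of c b] assms by blast
qed

lemma antimono_on_iff_uminus: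
  fixes f :: "real \<Rightarrow> real"
  shows "antimono_on b f \<longleftrightarrow> mono_on b (\<lambda>x. - f x)"
  by (auto simp: monotone_on_def)

lemma monotone_int_closure:
  assumes "continuous_on (closure b) f" "monotone_int f b"
  shows "monotone_int f (closure b)"
  using assms mono_on_closure[of b f] mono_on_closure[of b "\<lambda>x. - f x"]
  by (auto simp: monotone_int_def antimono_on_iff_uminus intro: continuous_intros)

lemma monotone_int_cong:
  "(\<And>x. x \<in> b \<Longrightarrow> f x = g x) \<Longrightarrow> monotone_int f b \<longleftrightarrow> monotone_int g b"
  by (auto simp: monotone_int_def monotone_on_def)

lemma nondegenerate_subinterval:
  fixes b :: "real set"
  assumes "z \<in> interior b"
  obtains p q where "p < z" "z < q" "{p..q} \<subseteq> b"
proof -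
  obtain e where "e > 0" "cball z e \<subseteq> b" using assms mem_interior_cball by blast
  then show ?thesis using that[of "z - e" "z + e"] by (simp add: cball_eq_atLeastAtMost)
qed

section \<open>Maximal intervals of monotonicity of a mixing map\<close>

locale mixing_map =
  fixes S :: "real \<Rightarrow> real"
  assumes S: "interval_map S" and mix: "topologically_mixing S"
begin

lemma not_mono_and_antimono:
  assumes "interior b \<noteq> {}" "b \<subseteq> {0..1}" "mono_on b S" "antimono_on b S"
  shows False
proof -
  obtain z where "z \<in> interior b" using assms by blast
  then obtain p q where pq: "p < z" "z < q" "{p..q} \<subseteq> b" by (rule nondegenerate_subinterval)
  have "\<forall>x\<in>{p..q}. S x = S p"
  proof
    fix x assume x: "x \<in> {p..q}"
    then have mem: "p \<in> b" "x \<in> b" "p \<le> x" using pq by auto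
    show "S x = S p"
      using monotone_onD[OF assms(3) mem] monotone_onD[OF assms(4) mem] by simp
  qed
  moreover have "p < q" using pq by simp
  moreover have "{p..q} \<subseteq> {0..1}" using pq assms by blast
  then have "0 \<le> p" "q \<le> 1" using \<open>p < q\<close> by auto
  ultimately show False using mixing_not_constant[OF mix] by blast
qed

text \<open>By continuity \<open>S\<close> is monotone on the closure of \<open>b\<close> as well,
  so maximality makes \<open>b\<close> closed.\<close>

lemma max_monotone_closed_interval:
  assumes b: "max_monotone_interval S {a..c} b" and ac: "{a..c} \<subseteq> {0..1}" and int: "interior b \<noteq> {}"
  shows "\<exists>p q. a \<le> p \<and> p < q \<and> q \<le> c \<and> b = {p..q}"
proof -
  have bi: "is_interval b" "b \<subseteq> {a..c}" "monotone_int S b"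
    and max: "\<And>q. \<lbrakk>is_interval q; b \<subseteq> q; q \<subseteq> {a..c}; monotone_int S q\<rbrakk> \<Longrightarrow> q = b"
    using b by (auto simp: max_monotone_interval_def)
  have sub: "closure b \<subseteq> {a..c}" using bi by (intro closure_minimal) auto
  have "continuous_on (closure b) S"
    using S order_trans[OF sub ac] unfolding interval_map_def by (blast intro: continuous_on_subset)
  then have "monotone_int S (closure b)" using bi monotone_int_closure by blast
  moreover have "is_interval (closure b)"
    using bi by (simp add: is_interval_connected_1 connected_imp_connected_closure)
  ultimately have "closure b = b" using max sub closure_subset by blast
  then have "closed b" by (metis closed_closure)
  moreover have "bounded b" using bi bounded_subset bounded_closed_interval by blast
  ultimately have "compact b" by (simp add: compact_eq_bounded_closed)
  then obtain p q where pq: "b = {p..q}"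
    using bi by (metis connected_compact_interval_1 is_interval_connected_1)
  moreover have "p < q" using int pq by (force simp: interior_atLeastAtMost_real)
  ultimately show ?thesis using bi by (intro exI[of _ p] exI[of _ q]) auto
qed

text \<open>The overlap has nonempty interior and \<open>S\<close> is constant on no nondegenerate
  interval. Hence the overlap carries a single orientation, which both sets must share.\<close>

lemma same_orientation:
  assumes b: "monotone_int S b" and c: "monotone_int S c"
    and z: "z \<in> interior b" "z \<in> interior c" and "b \<subseteq> {0..1}"
  shows "mono_on b S \<and> mono_on c S \<or> antimono_on b S \<and> antimono_on c S"
proof -
  have int: "interior (b \<inter> c) \<noteq> {}" using z by auto
  have sub: "b \<inter> c \<subseteq> {0..1}" using assms by blast
  have "\<not> (mono_on (b \<inter> c) S \<and> antimono_on (b \<inter> c) S)"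
    using not_mono_and_antimono[OF int sub] by blast
  moreover have "mono_on (b \<inter> c) S" if "mono_on b S \<or> mono_on c S"
    using that by (metis inf_le1 inf_le2 monotone_on_subset)
  moreover have "antimono_on (b \<inter> c) S" if "antimono_on b S \<or> antimono_on c S"
    using that by (metis inf_le1 inf_le2 monotone_on_subset)
  ultimately show ?thesis using b c unfolding monotone_int_def by blast
qed

lemma monotone_int_glue:
  assumes b: "monotone_int S b" "is_interval b" and c: "monotone_int S c" "is_interval c"
    and z: "z \<in> interior b" "z \<in> interior c" and "b \<subseteq> {0..1}"
  shows "monotone_int S (b \<union> c)"
  using same_orientation[OF b(1) c(1) z \<open>b \<subseteq> {0..1}\<close>]
proof
  have z': "z \<in> b" "z \<in> c" using z interior_subset by blast+
  { assume "mono_on b S \<and> mono_on c S"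
    then have "mono_on (b \<union> c) S" using b c z' by (intro mono_on_glue) auto
    then show ?thesis by (simp add: monotone_int_def) }
  { assume "antimono_on b S \<and> antimono_on c S"
    then have "mono_on (b \<union> c) (\<lambda>x. - S x)"
      using b c z' by (intro mono_on_glue) (auto simp: antimono_on_iff_uminus)
    then show ?thesis by (simp add: monotone_int_def antimono_on_iff_uminus) }
qed

lemma is_interval_Un:
  fixes b c :: "real set"
  assumes "is_interval b" "is_interval c" "z \<in> b" "z \<in> c"
  shows "is_interval (b \<union> c)"
  using assms connected_Un[of b c] by (auto simp: is_interval_connected_1)

lemma max_monotone_interiors_disjoint:
  assumes b: "max_monotone_interval S i b" and c: "max_monotone_interval S i c"
    and "i \<subseteq> {0..1}" and "b \<noteq> c"
  shows "interior b \<inter> interior c = {}"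
proof (rule ccontr)
  assume "interior b \<inter> interior c \<noteq> {}"
  then obtain z where z: "z \<in> interior b" "z \<in> interior c" by blast
  then have z': "z \<in> b" "z \<in> c" using interior_subset by blast+
  have B: "is_interval b" "b \<subseteq> i" "monotone_int S b"
    "\<And>q. \<lbrakk>is_interval q; b \<subseteq> q; q \<subseteq> i; monotone_int S q\<rbrakk> \<Longrightarrow> q = b"
    using b by (auto simp: max_monotone_interval_def)
  have C: "is_interval c" "c \<subseteq> i" "monotone_int S c"
    "\<And>q. \<lbrakk>is_interval q; c \<subseteq> q; q \<subseteq> i; monotone_int S q\<rbrakk> \<Longrightarrow> q = c"
    using c by (auto simp: max_monotone_interval_def)
  have "monotone_int S (b \<union> c)" 
    by (rule monotone_int_glue[OF B(3,1) C(3,1) z]) (use B(2) assms(3) in blast)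
  moreover have "is_interval (b \<union> c)" using is_interval_Un B C z' by blast
  ultimately have "b \<union> c = b" "b \<union> c = c" using B C by auto
  then show False using \<open>b \<noteq> c\<close> by simp
qed

text \<open>The maximal interval is the union of all monotone intervals between \<open>q\<close> and
  \<open>i\<close>. They all have the orientation of \<open>q\<close>, and the union of two of them
  is again one of them, so any two points of the whole union can be compared inside a single
  member.\<close>

lemma max_monotone_interval_exists:
  assumes q: "is_interval q" "interior q \<noteq> {}" "q \<subseteq> i" "monotone_int S q" and i: "i \<subseteq> {0..1}"
  shows "\<exists>b. max_monotone_interval S i b \<and> q \<subseteq> b"
proof -
  define \<F> where "\<F> = {b. is_interval b \<and> q \<subseteq> b \<and> b \<subseteq> i \<and> monotone_int S b}"
  obtain z where z: "z \<in> interior q" using q by blast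
  have zF: "z \<in> interior b" "z \<in> b" if "b \<in> \<F>" for b
    using z that interior_mono[of q b] interior_subset[of b] by (auto simp: \<F>_def)
  define m where "m = \<Union>\<F>"
  have Un: "b \<union> c \<in> \<F>" if bc: "b \<in> \<F>" "c \<in> \<F>" for b c
  proof -
    have "is_interval (b \<union> c)" 
      using is_interval_Un[of b c z] bc zF(2)[OF bc(1)] zF(2)[OF bc(2)] by (auto simp: \<F>_def)
    moreover have "monotone_int S (b \<union> c)"
      using bc i zF[OF bc(1)] zF[OF bc(2)] by (intro monotone_int_glue) (auto simp: \<F>_def)
    ultimately show ?thesis using bc by (auto simp: \<F>_def)
  qed
  have qF: "q \<in> \<F>" using q by (simp add: \<F>_def)
  have "z \<in> \<Inter>\<F>" using zF(2) by blast
  then have "is_interval m"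
    unfolding m_def is_interval_connected_1
    by (intro connected_Union) (auto simp: \<F>_def is_interval_connected_1)
  moreover have "q \<subseteq> m" "m \<subseteq> i" using qF by (auto simp: m_def \<F>_def)
  moreover have "monotone_int S m"
  proof (cases "mono_on q S")
    case True
    have "mono_on b S" if "b \<in> \<F>" for b
      using same_orientation[of q b z] that q z zF(1)[OF that] i not_mono_and_antimono[of q] True
      by (auto simp: \<F>_def)
    then have "mono_on m S"
      using Un unfolding m_def mono_on_def by (metis UnI1 UnI2 UnionE)
    then show ?thesis by (simp add: monotone_int_def)
  next
    case False
    have "antimono_on b S" if "b \<in> \<F>" for b
      using same_orientation[of q b z] that q z zF(1)[OF that] i False
      by (auto simp: \<F>_def)
    then have "antimono_on m S"
      using Un unfolding m_def monotone_on_def by (metis UnI1 UnI2 UnionE)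
    then show ?thesis by (simp add: monotone_int_def)
  qed
  ultimately have m: "m \<in> \<F>" by (simp add: \<F>_def)
  have "b = m" if "is_interval b" "m \<subseteq> b" "b \<subseteq> i" "monotone_int S b" for b
  proof -
    have "b \<in> \<F>" using that m by (auto simp: \<F>_def)
    then show ?thesis using \<open>m \<subseteq> b\<close> unfolding m_def by blast
  qed
  then have "max_monotone_interval S i m" "q \<subseteq> m"
    using m by (auto simp: max_monotone_interval_def \<F>_def)
  then show ?thesis by blast
qed

end

text \<open>The classical partition behind a slack one. Nonempty interior makes a maximal interval
  of monotonicity nondegenerate, and \<open>max_monotone_closed_interval\<close> makes it
  closed.\<close>

definition laps :: "(real \<Rightarrow> real) \<Rightarrow> real set set \<Rightarrow> real set set" where
  "laps S P = {b. interior b \<noteq> {} \<and> (\<exists>i\<in>P. max_monotone_interval S i b)}"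

text \<open>If the image of a lap meets the interior of a lap \<open>c\<close> inside an element
  \<open>k\<close> of \<open>P\<close>, it meets the interior of \<open>k\<close>, hence covers
  \<open>k\<close> and with it \<open>c\<close>. Only countably many points are lost, because each
  nondegenerate interval of a monotone division of an element lies in a lap.\<close>

lemma (in mixing_map) interval_markov_laps:
  assumes P: "markov_partition S P"
  shows "interval_markov S (laps S P)"
proof -
  note U = P[unfolded markov_partition_def]
  have P1: "\<exists>a b. 0 \<le> a \<and> a < b \<and> b \<le> 1 \<and> i = {a..b}" if "i \<in> P" for i
    using bspec[OF U[THEN conjunct2, THEN conjunct1] that] .
  have P2: "interior i \<inter> interior j = {}" if "i \<in> P" "j \<in> P" "i \<noteq> j" for i j
    using U[THEN conjunct2, THEN conjunct2, THEN conjunct1] that by simp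
  have P3: "countable P" "countable ({0..1} - \<Union>P)" "\<And>i. i \<in> P \<Longrightarrow> piecewise_monotone S i"
    using U by simp_all
  have P4: "j \<subseteq> S ` b" if "i \<in> P" "j \<in> P" "max_monotone_interval S i b" "S ` b \<inter> interior j \<noteq> {}" for i j b
    using U[THEN conjunct2, THEN conjunct2, THEN conjunct2, THEN conjunct2, THEN conjunct2] that by simp
  have i01: "i \<subseteq> {0..1}" if "i \<in> P" for i using P1[OF that] by force
  have disj: "interior b \<inter> interior c = {}" if bc: "b \<in> laps S P" "c \<in> laps S P" "b \<noteq> c" for b c
  proof -
    obtain i k where ik: "i \<in> P" "max_monotone_interval S i b" "k \<in> P" "max_monotone_interval S k c"
      using bc by (auto simp: laps_def)
    show ?thesis
    proof (cases "i = k")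
      case True
      then show ?thesis using max_monotone_interiors_disjoint ik i01 bc by blast
    next
      case False
      have "b \<subseteq> i" "c \<subseteq> k" using ik by (auto simp: max_monotone_interval_def)
      then show ?thesis using P2[OF ik(1,3) False] interior_mono by blast
    qed
  qed
  show ?thesis
  proof
    show "interval_map S" by (rule S)
    have "inj_on interior (laps S P)"
      using disj by (intro inj_onI) (auto simp: laps_def)
    moreover have "countable (interior ` laps S P)"
      using disj by (intro countable_disjoint_open_subsets) (auto simp: pairwise_def disjnt_def)
    ultimately show "countable (laps S P)" using countable_image_inj_on by blast
    have "countable (i - \<Union>(laps S P))" if i: "i \<in> P" for i
    proof -
      obtain \<D> where \<D>: "\<D> division_of i" "\<And>q. q \<in> \<D> \<Longrightarrow> monotone_int S q"
        using P3(3)[OF i] by (auto simp: piecewise_monotone_def)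
      have q: "countable (q - \<Union>(laps S P))" if q: "q \<in> \<D>" for q
      proof -
        obtain a b where ab: "q = {a..b}" using division_ofD(4)[OF \<D>(1) q] by auto
        show ?thesis
        proof (cases "interior q = {}")
          case True
          then have "b \<le> a" unfolding ab by (simp add: interior_atLeastAtMost_real)
          then have "q \<subseteq> {a}" unfolding ab by auto
          then show ?thesis by (meson countable_Diff countable_finite countable_subset finite.emptyI finite.insertI)
        next
          case False
          have "is_interval q" "q \<subseteq> i" using ab division_ofD(2)[OF \<D>(1) q] by (auto simp: is_interval_cc)
          then obtain b where b: "max_monotone_interval S i b" "q \<subseteq> b"
            using max_monotone_interval_exists False \<D>(2)[OF q] i01[OF i] by blast
          then have "interior b \<noteq> {}" using False interior_mono by blast
          then have "b \<in> laps S P" using b i by (auto simp: laps_def)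
          then have "q - \<Union>(laps S P) = {}" using b by blast
          then show ?thesis by (simp only: countable_empty)
        qed
      qed
      have "i - \<Union>(laps S P) \<subseteq> (\<Union>q\<in>\<D>. q - \<Union>(laps S P))" using division_ofD(6)[OF \<D>(1)] by blast
      moreover have "countable (\<Union>q\<in>\<D>. q - \<Union>(laps S P))"
        using q division_ofD(1)[OF \<D>(1)] by (intro countable_UN) (auto intro: countable_finite)
      ultimately show ?thesis by (rule countable_subset)
    qed
    then have "countable (({0..1} - \<Union>P) \<union> (\<Union>i\<in>P. i - \<Union>(laps S P)))"
      using P3(1,2) by (intro countable_Un countable_UN)
    then show "countable ({0..1} - \<Union>(laps S P))" by (rule countable_subset[rotated]) blast
  next
    fix b assume "b \<in> laps S P"
    then obtain i where i: "i \<in> P" "max_monotone_interval S i b" "interior b \<noteq> {}" by (auto simp: laps_def)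
    then show "monotone_int S b" by (auto simp: max_monotone_interval_def)
    obtain a c where ac: "0 \<le> a" "c \<le> 1" "i = {a..c}" using P1[OF i(1)] by blast
    have "\<exists>p q. a \<le> p \<and> p < q \<and> q \<le> c \<and> b = {p..q}"
      using i(2,3) i01[OF i(1)] unfolding ac(3) by (intro max_monotone_closed_interval)
    then show "\<exists>p q. 0 \<le> p \<and> p < q \<and> q \<le> 1 \<and> b = {p..q}" using ac by force
  next
    fix b c assume bc: "b \<in> laps S P" "c \<in> laps S P" "S ` b \<inter> interior c \<noteq> {}"
    then obtain i k where ik: "i \<in> P" "max_monotone_interval S i b" "k \<in> P" "max_monotone_interval S k c"
      by (auto simp: laps_def)
    have "c \<subseteq> k" using ik by (auto simp: max_monotone_interval_def)
    then have "S ` b \<inter> interior k \<noteq> {}" using bc(3) interior_mono by blast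
    then show "c \<subseteq> S ` b" using P4[OF ik(1,3,2)] \<open>c \<subseteq> k\<close> by blast
  qed (use disj in blast)
qed

lemma laps_monotone_element:
  assumes "markov_partition S P" "j \<in> P" "monotone_int S j"
  shows "j \<in> laps S P"
proof -
  obtain a b where ab: "a < b" "j = {a..b}" 
    using bspec[OF assms(1)[unfolded markov_partition_def, THEN conjunct2, THEN conjunct1] assms(2)] by blast
  then have "max_monotone_interval S j j" "interior j \<noteq> {}"
    using assms(3) by (auto simp: max_monotone_interval_def is_interval_cc interior_atLeastAtMost_real)
  then show ?thesis using assms(2) by (auto simp: laps_def)
qed

text \<open>This turns a bound on the fibres into a bound on column sums. Choose \<open>y\<close>
  inside \<open>c\<close> but outside the countable set of images of \<open>Q\<close>. Each piece
  whose image covers \<open>c\<close> then has a preimage of \<open>y\<close> in its interior, and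
  these preimages are distinct because the interiors are disjoint.\<close>

lemma (in interval_markov) card_column_le:
  assumes fin: "\<And>y. y \<in> {0..1} \<Longrightarrow> finite {x\<in>{0..1}. T x = y} \<and> card {x\<in>{0..1}. T x = y} \<le> K"
    and c: "c \<in> C" and F: "F \<subseteq> {b\<in>C. c \<subseteq> T ` b}"
  shows "card F \<le> K"
proof -
  obtain p q where pq: "0 \<le> p" "p < q" "q \<le> 1" "c = {p..q}" "interior c = {p<..<q}" using C_interval[OF c] .
  have "uncountable {p<..<q}" using pq by (simp add: uncountable_open_interval)
  then have "\<not> {p<..<q} \<subseteq> T ` Q" using countable_Q by (meson countable_image countable_subset)
  then obtain y where y: "y \<in> {p<..<q}" "y \<notin> T ` Q" by blast
  then have y01: "y \<in> {0..1}" "y \<in> c" using pq by auto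
  have "\<exists>x. x \<in> b \<and> T x = y" if "b \<in> F" for b using F y01 that by blast
  then obtain g where g: "\<And>b. b \<in> F \<Longrightarrow> g b \<in> b \<and> T (g b) = y" by metis
  have g01: "g b \<in> {0..1}" if "b \<in> F" for b using g[OF that] F C_subset that by blast
  have gi: "g b \<in> interior b" if b: "b \<in> F" for b
  proof -
    have "b \<in> C" using F b by blast
    then obtain e f where ef: "b = {e..f}" "interior b = {e<..<f}" using C_interval by metis
    have "g b \<notin> Q" using g[OF b] y by blast
    then have "g b \<noteq> e" "g b \<noteq> f" using endpoints_Q[of e f] \<open>b \<in> C\<close> ef by auto
    then show ?thesis using g[OF b] ef by auto
  qed
  have "inj_on g F"
  proof (rule inj_onI, rule ccontr)
    fix b b' assume b: "b \<in> F" "b' \<in> F" "g b = g b'" "b \<noteq> b'"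
    then have "interior b \<inter> interior b' = {}" using interiors_disjoint F by blast
    then show False using gi[OF b(1)] gi[OF b(2)] b(3) by auto
  qed
  moreover have "g ` F \<subseteq> {x\<in>{0..1}. T x = y}" using g g01 by blast
  ultimately have "card F \<le> card {x\<in>{0..1}. T x = y}"
    using fin[OF y01(1)] by (intro card_inj_on_le) auto
  then show ?thesis using fin[OF y01(1)] by simp
qed

section \<open>Counting paths\<close>

text \<open>For the values \<open>A\<close> and \<open>U\<close> at \<open>x\<close> of the
  generating functions of \<open>a\<close> and \<open>t\<close>, the recursion reads
  \<open>(p + 1) * U = A + p * A * U\<close>, while the normalization says
  \<open>p * A = p + 1\<close>. A finite \<open>U\<close> would force \<open>A = 0\<close>. In the
  application \<open>a\<close> counts the loops at \<open>j\<close> for the original map and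
  \<open>t\<close> those for the perturbed one.\<close>

lemma renewal_not_summable:
  fixes a t :: "nat \<Rightarrow> real"
  assumes nonneg: "\<And>n. 0 \<le> a n" "\<And>n. 0 \<le> t n" and "a 0 = 1" and "x > 0" "p > 0"
    and sum: "summable (\<lambda>n. a n * x ^ n)" and eq1: "p * (\<Sum>n. a (Suc n) * x ^ Suc n) = 1"
    and renew: "\<And>n. (p + 1) * t n = a n + p * (\<Sum>i\<le>n. a i * t (n - i))"
  shows "\<not> summable (\<lambda>n. t n * x ^ n)"
proof
  assume sumt: "summable (\<lambda>n. t n * x ^ n)"
  define A where "A = (\<Sum>n. a n * x ^ n)"
  define U where "U = (\<Sum>n. t n * x ^ n)"
  have A: "A = 1 + 1 / p"
  proof -
    have "A = 1 + (\<Sum>n. a (Suc n) * x ^ Suc n)"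
      unfolding A_def using suminf_split_head[OF sum] \<open>a 0 = 1\<close> by simp
    then show ?thesis using eq1 \<open>p > 0\<close> by (simp add: field_simps)
  qed
  have "(\<lambda>n. \<Sum>i\<le>n. (a i * x ^ i) * (t (n - i) * x ^ (n - i))) sums (A * U)"
    unfolding A_def U_def
    using nonneg \<open>x > 0\<close> sum sumt by (intro Cauchy_product_sums) auto
  moreover have "(\<Sum>i\<le>n. (a i * x ^ i) * (t (n - i) * x ^ (n - i))) = (\<Sum>i\<le>n. a i * t (n - i)) * x ^ n" for n
    unfolding sum_distrib_right
  proof (rule sum.cong)
    fix i assume "i \<in> {..n}"
    then have "x ^ i * x ^ (n - i) = x ^ n" by (simp flip: power_add)
    then show "(a i * x ^ i) * (t (n - i) * x ^ (n - i)) = a i * t (n - i) * x ^ n"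
      by (metis (no_types, opaque_lifting) mult.assoc mult.left_commute)
  qed simp
  ultimately have conv: "(\<lambda>n. (\<Sum>i\<le>n. a i * t (n - i)) * x ^ n) sums (A * U)" by simp
  have "(\<lambda>n. a n * x ^ n + p * ((\<Sum>i\<le>n. a i * t (n - i)) * x ^ n)) sums (A + p * (A * U))"
    using sum conv unfolding A_def by (intro sums_add sums_mult summable_sums)
  moreover have "a n * x ^ n + p * ((\<Sum>i\<le>n. a i * t (n - i)) * x ^ n) = (p + 1) * (t n * x ^ n)" for n
  proof -
    have "(p + 1) * (t n * x ^ n) = ((p + 1) * t n) * x ^ n" by (rule mult.assoc[symmetric])
    also have "\<dots> = (a n + p * (\<Sum>i\<le>n. a i * t (n - i))) * x ^ n" by (simp only: renew)
    also have "\<dots> = a n * x ^ n + p * ((\<Sum>i\<le>n. a i * t (n - i)) * x ^ n)" by (simp only: distrib_right mult.assoc)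
    finally show ?thesis by (rule sym)
  qed
  moreover have "(\<lambda>n. (p + 1) * (t n * x ^ n)) sums ((p + 1) * U)"
    using sumt unfolding U_def by (intro sums_mult summable_sums)
  ultimately have "A + p * (A * U) = (p + 1) * U" by (simp add: sums_unique2)
  moreover have "p * A = p + 1" using A \<open>p > 0\<close> by (simp add: field_simps)
  ultimately have "A = 0" by (metis add_cancel_left_left mult.assoc)
  then show False using A \<open>p > 0\<close> by (simp add: field_simps)
qed

section \<open>Paths to \<open>j\<close> in the transition graph\<close>

locale markov_counting = interval_markov +
  fixes j :: "real set" and K :: nat
  assumes j: "j \<in> C"
    and column: "\<And>c F. c \<in> C \<Longrightarrow> F \<subseteq> {b\<in>C. c \<subseteq> T ` b} \<Longrightarrow> card F \<le> K"
begin

definition follow :: "real set \<Rightarrow> real set set" where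
  "follow b = {c\<in>C. c \<subseteq> T ` b}"

text \<open>
  Number of paths of length \<open>n\<close> from \<open>b\<close> to \<open>j\<close>, the edges leaving any \<open>c\<close> being counted \<open>w c\<close> times.
\<close>

primrec paths :: "(real set \<Rightarrow> nat) \<Rightarrow> nat \<Rightarrow> real set \<Rightarrow> nat" where
  "paths w 0 b = (if b = j then 1 else 0)"
| "paths w (Suc n) b = w b * (\<Sum>c | c \<in> follow b \<and> paths w n c \<noteq> 0. paths w n c)"

lemma follow_subset: "follow b \<subseteq> C"
  by (auto simp: follow_def)

text \<open>Rows of the transition matrix may be infinite, but the column bound lets only finitely
  many pieces reach \<open>j\<close> in \<open>n\<close> steps. The sum in \<open>paths\<close>,
  restricted to nonzero terms, is therefore a genuine finite sum and never takes the default value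
  \<open>0\<close> of an infinite one. Finiteness at length \<open>n\<close> follows from the bound
  at length \<open>n\<close> and is used for the bound at \<open>Suc n\<close>.\<close>

lemma paths_sum_bound:
  assumes w: "\<And>b. w b \<le> D"
  shows "finite {c\<in>C. paths w n c \<noteq> 0} \<and> (\<forall>F. finite F \<and> F \<subseteq> C \<longrightarrow> (\<Sum>b\<in>F. paths w n b) \<le> (D * K) ^ n)"
proof -
  have fin: "finite {c\<in>C. paths w n c \<noteq> 0}" if "\<And>F. finite F \<Longrightarrow> F \<subseteq> C \<Longrightarrow> (\<Sum>b\<in>F. paths w n b) \<le> M" for n M
  proof (rule finite_if_finite_subsets_card_bdd[THEN conjunct1])
    show "card F \<le> M" if F: "F \<subseteq> {c\<in>C. paths w n c \<noteq> 0}" "finite F" for F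
    proof -
      have "card F = (\<Sum>b\<in>F. 1)" by simp
      also have "\<dots> \<le> (\<Sum>b\<in>F. paths w n b)" using F by (intro sum_mono) (auto simp: Suc_le_eq)
      also have "\<dots> \<le> M" using F \<open>\<And>F. finite F \<Longrightarrow> F \<subseteq> C \<Longrightarrow> (\<Sum>b\<in>F. paths w n b) \<le> M\<close> by blast
      finally show ?thesis .
    qed
  qed
  have "(\<Sum>b\<in>F. paths w n b) \<le> (D * K) ^ n" if "finite F" "F \<subseteq> C" for F
    using that
  proof (induction n arbitrary: F)
    case 0
    have "(\<Sum>b\<in>F. paths w 0 b) = (if j \<in> F then 1 else 0)" using 0 by simp
    then show ?case by simp
  next
    case (Suc n)
    define Z where "Z = {c\<in>C. paths w n c \<noteq> 0}"
    have Z: "finite Z" "Z \<subseteq> C" unfolding Z_def using fin[OF Suc.IH] by auto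
    have "(\<Sum>b\<in>F. paths w (Suc n) b) \<le> (\<Sum>b\<in>F. D * (\<Sum>c\<in>Z. if c \<in> follow b then paths w n c else 0))"
    proof (rule sum_mono)
      fix b assume "b \<in> F"
      have "(\<Sum>c | c \<in> follow b \<and> paths w n c \<noteq> 0. paths w n c) = (\<Sum>c\<in>Z. if c \<in> follow b then paths w n c else 0)"
        using Z follow_subset by (intro sum.mono_neutral_cong_left) (auto simp: Z_def)
      then show "paths w (Suc n) b \<le> D * (\<Sum>c\<in>Z. if c \<in> follow b then paths w n c else 0)"
        using w[of b] by simp
    qed
    also have "\<dots> = D * (\<Sum>c\<in>Z. \<Sum>b\<in>F. if c \<in> follow b then paths w n c else 0)"
      unfolding sum_distrib_left[symmetric] by (subst sum.swap) simp
    also have "\<dots> \<le> D * (\<Sum>c\<in>Z. K * paths w n c)"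
    proof (intro mult_left_mono sum_mono)
      fix c assume "c \<in> Z"
      have "(\<Sum>b\<in>F. if c \<in> follow b then paths w n c else 0) = card {b\<in>F. c \<in> follow b} * paths w n c"
        using Suc.prems by (simp add: sum.If_cases Int_def)
      also have "\<dots> \<le> K * paths w n c"
      proof (rule mult_right_mono)
        have "{b\<in>F. c \<in> follow b} \<subseteq> {b\<in>C. c \<subseteq> T ` b}" using Suc.prems by (auto simp: follow_def)
        then show "card {b\<in>F. c \<in> follow b} \<le> K" using column \<open>c \<in> Z\<close> Z by blast
      qed simp
      finally show "(\<Sum>b\<in>F. if c \<in> follow b then paths w n c else 0) \<le> K * paths w n c" .
    qed simp
    also have "\<dots> = D * K * (\<Sum>c\<in>Z. paths w n c)" by (simp add: sum_distrib_left[symmetric] mult.assoc)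
    also have "\<dots> \<le> D * K * (D * K) ^ n" using Suc.IH[OF Z] by (intro mult_left_mono) auto
    finally show ?case by simp
  qed
  then show ?thesis using fin by blast
qed

lemma paths_finite: "(\<And>b. w b \<le> D) \<Longrightarrow> finite {c\<in>C. paths w n c \<noteq> 0}"
  using paths_sum_bound by blast

lemma paths_sum_le: "finite F \<Longrightarrow> F \<subseteq> C \<Longrightarrow> (\<Sum>b\<in>F. paths (\<lambda>_. 1) n b) \<le> K ^ n"
  using paths_sum_bound[of "\<lambda>_. 1" 1 n] by simp

lemma paths_le: "b \<in> C \<Longrightarrow> paths (\<lambda>_. 1) n b \<le> K ^ n"
  using paths_sum_le[of "{b}"] by simp

lemma paths_Suc:
  assumes "finite Z" "{c\<in>C. paths w n c \<noteq> 0} \<subseteq> Z"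
  shows "paths w (Suc n) b = w b * (\<Sum>c\<in>Z \<inter> follow b. paths w n c)"
proof -
  have "(\<Sum>c | c \<in> follow b \<and> paths w n c \<noteq> 0. paths w n c) = (\<Sum>c\<in>Z \<inter> follow b. paths w n c)"
    using assms follow_subset by (intro sum.mono_neutral_left) auto
  then show ?thesis by simp
qed

text \<open>An orbit that avoids \<open>Q\<close> runs through interiors of pieces, and by the
  Markov condition the pieces it visits form a path.\<close>

lemma paths_positive:
  assumes "x \<in> interior b" "b \<in> C" "\<And>m. m \<le> n \<Longrightarrow> (T ^^ m) x \<notin> Q" "(T ^^ n) x \<in> interior j"
  shows "paths (\<lambda>_. 1) n b > 0"
  using assms
proof (induction n arbitrary: x b)
  case 0
  then have "b = j" using interiors_disjoint[OF _ j, of b] by auto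
  then show ?case by simp
next
  case (Suc n)
  have x: "x \<in> b" using Suc.prems interior_subset by blast
  then have "x \<in> {0..1}" using C_subset Suc.prems by blast
  then have "T x \<in> {0..1}" by (rule T_in)
  moreover have "T x \<notin> Q" using Suc.prems(3)[of 1] by simp
  ultimately obtain c where c: "c \<in> C" "T x \<in> interior c" using not_Q by blast
  have pos: "paths (\<lambda>_. 1) n c > 0"
  proof (rule Suc.IH[OF c(2,1)])
    show "(T ^^ m) (T x) \<notin> Q" if "m \<le> n" for m
      using Suc.prems(3)[of "Suc m"] that by (simp add: funpow_swap1)
    show "(T ^^ n) (T x) \<in> interior j" using Suc.prems(4) by (simp add: funpow_swap1)
  qed
  have "T ` b \<inter> interior c \<noteq> {}" using c x by blast
  then have follow: "c \<in> follow b" using markov[OF Suc.prems(2) c(1)] c by (simp add: follow_def)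
  define Z where "Z = {c\<in>C. paths (\<lambda>_. 1) n c \<noteq> 0}"
  have Z: "finite Z" unfolding Z_def by (rule paths_finite[of _ 1]) simp
  have "paths (\<lambda>_. 1) n c \<le> (\<Sum>c\<in>Z \<inter> follow b. paths (\<lambda>_. 1) n c)"
    using Z pos c follow by (intro member_le_sum) (auto simp: Z_def)
  also have "\<dots> = paths (\<lambda>_. 1) (Suc n) b"
    using paths_Suc[OF Z, of "\<lambda>_. 1" n b] by (simp add: Z_def)
  finally show ?case using pos by simp
qed

lemma countable_funpow_vimage_Q:
  assumes fin: "\<And>y. y \<in> {0..1} \<Longrightarrow> finite {x\<in>{0..1}. T x = y}"
  shows "countable {x\<in>{0..1}. (T ^^ m) x \<in> Q}"
proof (induction m)
  case 0
  then show ?case using countable_Q by (simp add: countable_Int2 Collect_conj_eq Int_commute)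
next
  case (Suc m)
  have "{x\<in>{0..1}. (T ^^ Suc m) x \<in> Q} \<subseteq> (\<Union>y\<in>{x\<in>{0..1}. (T ^^ m) x \<in> Q}. {x\<in>{0..1}. T x = y})"
    using T_in by (auto simp: funpow_swap1)
  moreover have "countable (\<Union>y\<in>{x\<in>{0..1}. (T ^^ m) x \<in> Q}. {x\<in>{0..1}. T x = y})"
    using Suc fin by (intro countable_UN) (auto intro: countable_finite)
  ultimately show ?case by (rule countable_subset)
qed

text \<open>By mixing, the points of the interior of \<open>j\<close> that return there after
  \<open>n\<close> steps form a nonempty open set, which is uncountable. The points whose orbits
  meet \<open>Q\<close> up to time \<open>n\<close> are only countably many since fibres are finite,
  so some returning orbit traces a path.\<close>

lemma return_path_exists:
  assumes fin: "\<And>y. y \<in> {0..1} \<Longrightarrow> finite {x\<in>{0..1}. T x = y}" and mix: "topologically_mixing T"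
  shows "\<exists>n>0. paths (\<lambda>_. 1) n j > 0"
proof -
  obtain p q where pq: "0 \<le> p" "p < q" "q \<le> 1" "j = {p..q}" "interior j = {p<..<q}" using C_interval[OF j] .
  have U: "openin (top_of_set {0..1}) (interior j)" "interior j \<noteq> {}"
    using pq by (auto intro!: open_subset)
  obtain n0 where n0: "\<And>m. m \<ge> n0 \<Longrightarrow> (T ^^ m) ` interior j \<inter> interior j \<noteq> {}"
    using mix U unfolding topologically_mixing_def by meson
  define n where "n = Suc n0"
  define W where "W = interior j \<inter> (T ^^ n) -` interior j"
  have sub: "interior j \<subseteq> {0..1}" using pq by auto
  have "continuous_on (interior j) (T ^^ n)"
    using funpow_interval_map(1)[OF T] sub continuous_on_subset by blast
  then have "open W" unfolding W_def by (intro continuous_open_preimage) auto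
  have "n0 \<le> n" by (simp add: n_def)
  then obtain z where "z \<in> W" using n0[of n] unfolding W_def by fast
  then have "z \<in> interior W" using \<open>open W\<close> by (simp add: interior_open)
  then obtain e f where "e < z" "z < f" "{e..f} \<subseteq> W" by (rule nondegenerate_subinterval)
  then have "uncountable W"
    using uncountable_closed_interval[of e f] countable_subset[of "{e..f}" W] by fastforce
  moreover have "countable (\<Union>m\<le>n. {x\<in>{0..1}. (T ^^ m) x \<in> Q})"
    using countable_funpow_vimage_Q[OF fin] by (intro countable_UN) auto
  ultimately have "\<not> W \<subseteq> (\<Union>m\<le>n. {x\<in>{0..1}. (T ^^ m) x \<in> Q})" using countable_subset by blast
  then obtain x where x: "x \<in> W" "\<And>m. m \<le> n \<Longrightarrow> (T ^^ m) x \<notin> Q"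
    using sub unfolding W_def by blast
  then have "paths (\<lambda>_. 1) n j > 0" using paths_positive[of x j n] j unfolding W_def by blast
  then show ?thesis by (intro exI[of _ n]) (simp add: n_def)
qed

section \<open>Path counts with \<open>2 * k + 1\<close> copies of the edges leaving
  \<open>j\<close>\<close>

definition weight :: "nat \<Rightarrow> real set \<Rightarrow> nat" where
  "weight k b = (if b = j then 2 * k + 1 else 1)"

lemma weight_le: "weight k b \<le> 2 * k + 1"
  by (simp add: weight_def)

text \<open>Decomposition of a path at the first use of one of the \<open>2 * k\<close> extra copies of an edge leaving \<open>j\<close>.\<close>

lemma paths_weight_decomposition:
  assumes "b \<in> C"
  shows "(2 * k + 1) * paths (weight k) n b =
    (2 * k + 1) * paths (\<lambda>_. 1) n b + 2 * k * (\<Sum>m<n. paths (\<lambda>_. 1) m b * paths (weight k) (n - m) j)"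
  using assms
proof (induction n arbitrary: b)
  case (Suc n)
  let ?a = "paths (\<lambda>_. 1)" and ?t = "paths (weight k)"
  define Z where "Z = {c\<in>C. ?t n c \<noteq> 0} \<union> (\<Union>m\<le>n. {c\<in>C. ?a m c \<noteq> 0})"
  have "finite {c\<in>C. ?t n c \<noteq> 0}" using weight_le by (rule paths_finite)
  moreover have "finite {c\<in>C. ?a m c \<noteq> 0}" for m by (rule paths_finite[of _ 1]) simp
  ultimately have Z: "finite Z" unfolding Z_def by blast
  have t_Suc: "?t (Suc n) b = weight k b * (\<Sum>c\<in>Z \<inter> follow b. ?t n c)" for b
    by (rule paths_Suc[OF Z]) (auto simp: Z_def)
  have a_Suc: "?a (Suc m) b = (\<Sum>c\<in>Z \<inter> follow b. ?a m c)" if "m \<le> n" for m b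
    using paths_Suc[OF Z, of "\<lambda>_. 1" m b] that by (auto simp: Z_def)
  have "(2 * k + 1) * (\<Sum>c\<in>Z \<inter> follow b. ?t n c) =
    (\<Sum>c\<in>Z \<inter> follow b. (2 * k + 1) * ?a n c + 2 * k * (\<Sum>m<n. ?a m c * ?t (n - m) j))"
    by (subst sum_distrib_left, rule sum.cong[OF refl]) (use Suc.IH follow_subset in blast)
  also have "\<dots> = (2 * k + 1) * ?a (Suc n) b + 2 * k * (\<Sum>m<n. ?a (Suc m) b * ?t (n - m) j)"
  proof -
    have "(\<Sum>c\<in>Z \<inter> follow b. \<Sum>m<n. ?a m c * ?t (n - m) j) = (\<Sum>m<n. ?a (Suc m) b * ?t (n - m) j)"
      by (subst sum.swap) (intro sum.cong refl, simp only: lessThan_iff a_Suc less_imp_le sum_distrib_right)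
    then show ?thesis
      by (simp only: sum.distrib sum_distrib_left[symmetric] a_Suc[OF order_refl])
  qed
  finally have *: "(2 * k + 1) * (\<Sum>c\<in>Z \<inter> follow b. ?t n c) =
    (2 * k + 1) * ?a (Suc n) b + 2 * k * (\<Sum>m<n. ?a (Suc m) b * ?t (n - m) j)" .
  \<comment> \<open>The terms with \<open>m > 0\<close> come from the induction hypothesis. The term
    \<open>m = 0\<close> stands for an extra copy used at the very first step: it vanishes unless
    \<open>b = j\<close>, and for \<open>b = j\<close> a fraction \<open>2 * k / (2 * k + 1)\<close>
    of the paths counted by \<open>?t (Suc n) j\<close> begin with such a copy. Clearing this
    denominator is the reason for the factor \<open>2 * k + 1\<close> in the statement.\<close>
  have shift: "(\<Sum>m<Suc n. ?a m b * ?t (Suc n - m) j) =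
    ?a 0 b * ?t (Suc n) j + (\<Sum>m<n. ?a (Suc m) b * ?t (n - m) j)"
    by (subst sum.lessThan_Suc_shift) simp
  show ?case
  proof (cases "b = j")
    case True
    have "?t (Suc n) j = (2 * k + 1) * (\<Sum>c\<in>Z \<inter> follow b. ?t n c)" using t_Suc[of j] True by (simp add: weight_def)
    then have "(2 * k + 1) * ?t (Suc n) b = 2 * k * ?t (Suc n) j + (2 * k + 1) * (\<Sum>c\<in>Z \<inter> follow b. ?t n c)"
      using True by simp
    then show ?thesis unfolding * shift using True by (simp add: distrib_left)
  next
    case False
    then have "?t (Suc n) b = (\<Sum>c\<in>Z \<inter> follow b. ?t n c)" using t_Suc[of b] by (simp add: weight_def)
    then show ?thesis using * False unfolding shift by simp
  qed
qed simp

text \<open>As \<open>paths (weight k) 0 j = 1\<close>, the new term \<open>m = n\<close> takes up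
  \<open>2 * k\<close> of the \<open>2 * k + 1\<close> copies of the first summand in the
  decomposition. This leaves a full convolution, the form required by
  \<open>renewal_not_summable\<close>.\<close>

lemma paths_weight_renewal:
  "real (2 * k + 1) * paths (weight k) n j =
    real (paths (\<lambda>_. 1) n j) + real (2 * k) * (\<Sum>m\<le>n. real (paths (\<lambda>_. 1) m j) * real (paths (weight k) (n - m) j))"
proof -
  have "{..n} = insert n {..<n}" by auto
  then have "(2 * k + 1) * paths (weight k) n j =
    paths (\<lambda>_. 1) n j + 2 * k * (\<Sum>m\<le>n. paths (\<lambda>_. 1) m j * paths (weight k) (n - m) j)"
    using paths_weight_decomposition[OF j, of k n] by (simp add: algebra_simps)
  from arg_cong[OF this, of real] show ?thesis
    by (simp only: of_nat_mult of_nat_add of_nat_sum)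
qed

section \<open>The resolvent column of \<open>j\<close> and the choice of the parameter\<close>

definition green :: "real \<Rightarrow> real set \<Rightarrow> real" where
  "green x b = (\<Sum>n. x ^ Suc n * real (paths (\<lambda>_. 1) n b))"

context
  fixes x :: real
  assumes x: "0 < x" "x * K < 1"
begin

lemma geometric_summable: "summable (\<lambda>n. x * (x * K) ^ n)"
  using x by (intro summable_mult summable_geometric) auto

lemma green_term_le: "b \<in> C \<Longrightarrow> x ^ Suc n * real (paths (\<lambda>_. 1) n b) \<le> x * (x * K) ^ n"
proof -
  assume "b \<in> C"
  then have "real (paths (\<lambda>_. 1) n b) \<le> real (K ^ n)" using paths_le of_nat_mono by blast
  then have "x ^ Suc n * real (paths (\<lambda>_. 1) n b) \<le> x ^ Suc n * real (K ^ n)"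
    using x by (intro mult_left_mono) auto
  then show ?thesis by (simp add: power_mult_distrib mult.assoc)
qed

lemma green_summable: "b \<in> C \<Longrightarrow> summable (\<lambda>n. x ^ Suc n * real (paths (\<lambda>_. 1) n b))"
  by (rule summable_comparison_test'[OF geometric_summable]) (use green_term_le x in auto)

lemma green_nonneg: "b \<in> C \<Longrightarrow> 0 \<le> green x b"
  unfolding green_def using x by (intro suminf_nonneg green_summable) auto

text \<open>Interchange of the sums over lengths and over starting pieces. For a fixed length only
  finitely many pieces contribute, with total at most \<open>x * (x * K) ^ n\<close>, so the
  nonnegative double family is summable.\<close>

lemma green_has_sum:
  assumes R: "R \<subseteq> C"
  shows "(green x has_sum (\<Sum>n. x ^ Suc n * real (\<Sum>c\<in>{c\<in>C. paths (\<lambda>_. 1) n c \<noteq> 0} \<inter> R. paths (\<lambda>_. 1) n c))) R"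
proof -
  define s where "s n = (\<Sum>c\<in>{c\<in>C. paths (\<lambda>_. 1) n c \<noteq> 0} \<inter> R. paths (\<lambda>_. 1) n c)" for n
  have fin: "finite {c\<in>C. paths (\<lambda>_. 1) n c \<noteq> 0}" for n by (rule paths_finite[of _ 1]) simp
  define f where "f = (\<lambda>(n, c). x ^ Suc n * real (paths (\<lambda>_. 1) n c))"
  have inner: "((\<lambda>c. f (n, c)) has_sum x ^ Suc n * real (s n)) R" for n
  proof -
    have "((\<lambda>c. f (n, c)) has_sum (\<Sum>c\<in>{c\<in>C. paths (\<lambda>_. 1) n c \<noteq> 0} \<inter> R. f (n, c))) ({c\<in>C. paths (\<lambda>_. 1) n c \<noteq> 0} \<inter> R)"
      using fin by (intro has_sum_finite) auto
    moreover have "(\<Sum>c\<in>{c\<in>C. paths (\<lambda>_. 1) n c \<noteq> 0} \<inter> R. f (n, c)) = x ^ Suc n * real (s n)"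
      unfolding f_def s_def by (simp add: sum_distrib_left)
    ultimately have "((\<lambda>c. f (n, c)) has_sum x ^ Suc n * real (s n)) ({c\<in>C. paths (\<lambda>_. 1) n c \<noteq> 0} \<inter> R)" by simp
    then show ?thesis
      by (rule has_sum_cong_neutral[THEN iffD1, rotated -1]) (use R in \<open>auto simp: f_def\<close>)
  qed
  have s_le: "x ^ Suc n * real (s n) \<le> x * (x * K) ^ n" for n
  proof -
    have "s n \<le> K ^ n" unfolding s_def using fin by (intro paths_sum_le) auto
    then have "real (s n) \<le> real (K ^ n)" using of_nat_mono by blast
    then have "x ^ Suc n * real (s n) \<le> x ^ Suc n * real (K ^ n)"
      using x by (intro mult_left_mono) auto
    then show ?thesis by (simp add: power_mult_distrib mult.assoc)
  qed
  have sums: "summable (\<lambda>n. x ^ Suc n * real (s n))"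
    by (rule summable_comparison_test'[OF geometric_summable]) (use s_le x in auto)
  have outer: "((\<lambda>n. x ^ Suc n * real (s n)) has_sum (\<Sum>n. x ^ Suc n * real (s n))) UNIV"
    using sums x by (intro norm_summable_imp_has_sum) (auto simp: summable_sums)
  have "f summable_on UNIV \<times> R"
  proof (rule summable_on_SigmaI[OF inner])
    show "(\<lambda>n. x ^ Suc n * real (s n)) summable_on UNIV" using outer by (auto simp: summable_on_def)
  qed (use x in \<open>auto simp: f_def\<close>)
  then have "(f has_sum (\<Sum>n. x ^ Suc n * real (s n))) (UNIV \<times> R)"
    using inner outer by (intro has_sum_SigmaI)
  then have swap: "((\<lambda>(c, n). f (n, c)) has_sum (\<Sum>n. x ^ Suc n * real (s n))) (R \<times> UNIV)"
    by (subst (asm) has_sum_swap)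
  have "((\<lambda>n. f (n, c)) has_sum green x c) UNIV" if "c \<in> R" for c
  proof -
    have "c \<in> C" using that R by blast
    then show ?thesis
      unfolding f_def green_def using green_summable x
      by (intro norm_summable_imp_has_sum) (auto simp: summable_sums)
  qed
  then show ?thesis
    using has_sum_SigmaD[OF swap, of "green x"] unfolding s_def by simp
qed

lemma green_summable_on: "green x summable_on C"
  using green_has_sum[of C] unfolding summable_on_def by blast

lemma infsum_green_follow:
  assumes "b \<in> C"
  shows "infsum (green x) (follow b) = (\<Sum>n. x ^ Suc n * real (paths (\<lambda>_. 1) (Suc n) b))"
proof -
  have "paths (\<lambda>_. 1) (Suc n) b = (\<Sum>c\<in>{c\<in>C. paths (\<lambda>_. 1) n c \<noteq> 0} \<inter> follow b. paths (\<lambda>_. 1) n c)" for n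
    using paths_Suc[of "{c\<in>C. paths (\<lambda>_. 1) n c \<noteq> 0}" "\<lambda>_. 1" n b] paths_finite[of "\<lambda>_. 1" 1 n] by simp
  then show ?thesis using infsumI[OF green_has_sum[OF follow_subset]] by simp
qed

text \<open>Summing over the followers lengthens every path by one edge and so shifts the series by
  one index. The correction at \<open>j\<close> is the lost path of length \<open>0\<close>.\<close>

lemma green_eigen:
  assumes "b \<in> C"
  shows "infsum (green x) (follow b) = green x b / x - (if b = j then 1 else 0)"
proof -
  let ?f = "\<lambda>n. x ^ Suc n * real (paths (\<lambda>_. 1) n b)"
  have "summable (\<lambda>n. ?f (Suc n))" using green_summable[OF assms] by (subst summable_Suc_iff)
  then have "(\<Sum>n. ?f (Suc n)) = x * (\<Sum>n. x ^ Suc n * real (paths (\<lambda>_. 1) (Suc n) b))"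
  proof -
    have eq: "?f (Suc n) = x * (x ^ Suc n * real (paths (\<lambda>_. 1) (Suc n) b))" for n
      by (simp only: power_Suc mult.assoc)
    have "summable (\<lambda>n. x * (x ^ Suc n * real (paths (\<lambda>_. 1) (Suc n) b)))"
      using \<open>summable (\<lambda>n. ?f (Suc n))\<close> unfolding eq .
    then have "summable (\<lambda>n. x ^ Suc n * real (paths (\<lambda>_. 1) (Suc n) b))"
      using x by (subst (asm) summable_cmult_iff) auto
    then show ?thesis unfolding eq by (rule suminf_mult)
  qed
  moreover have "green x b = ?f 0 + (\<Sum>n. ?f (Suc n))"
    unfolding green_def using suminf_split_head[OF green_summable[OF assms]] by linarith
  moreover have "?f 0 = (if b = j then x else 0)" by simp
  ultimately show ?thesis
    unfolding infsum_green_follow[OF assms] using x by (simp add: field_simps)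
qed

end

text \<open>Without the path of length \<open>0\<close>, the generating function of the loops at
  \<open>j\<close> vanishes at \<open>0\<close>, and the given return path makes it positive at
  \<open>y\<close>. For large \<open>k\<close> its multiple by \<open>2 * k\<close> exceeds
  \<open>1\<close> at \<open>y\<close>, and the intermediate value theorem applies.\<close>

lemma green_parameter_exists:
  assumes "n > 0" "paths (\<lambda>_. 1) n j > 0"
  shows "\<exists>k0. \<forall>k\<ge>k0. \<exists>x>0. x * (real K + 3) \<le> 1 \<and>
    real (2 * k) * (\<Sum>n. x ^ Suc n * real (paths (\<lambda>_. 1) (Suc n) j)) = 1"
proof -
  define c where "c n = (if n = 0 then 0 else real (paths (\<lambda>_. 1) n j))" for n
  define G where "G x = (\<Sum>n. c n * x ^ n)" for x :: real
  \<comment> \<open>\<open>y\<close> is the largest admissible parameter. The point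
    \<open>z > y\<close> still satisfies \<open>K * z < 1\<close>, so \<open>{0..y}\<close> lies
    inside the open disc of convergence, where \<open>G\<close> is continuous.\<close>
  define z y where "z = 1 / (real K + 2)" and "y = 1 / (real K + 3)"
  have zy: "0 < y" "y < z" by (auto simp: z_def y_def frac_less2)
  have c_le: "\<bar>c n\<bar> \<le> real K ^ n" for n
  proof -
    have "real (paths (\<lambda>_. 1) n j) \<le> real (K ^ n)" using paths_le[OF j] by (rule of_nat_mono)
    then show ?thesis by (simp add: c_def)
  qed
  have Kz: "real K * z < 1" "0 \<le> real K * z" by (auto simp: z_def)
  have sum_z: "summable (\<lambda>n. c n * z ^ n)"
  proof (rule summable_comparison_test')
    show "summable (\<lambda>n. (real K * z) ^ n)" using Kz by (intro summable_geometric) simp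
    show "norm (c n * z ^ n) \<le> (real K * z) ^ n" for n
      using c_le[of n] zy by (simp add: abs_mult power_mult_distrib mult_right_mono)
  qed
  have sum: "summable (\<lambda>n. c n * x ^ n)" if "0 \<le> x" "x \<le> y" for x
    using powser_inside[OF sum_z, of x] that zy by auto
  have cont: "isCont G x" if "0 \<le> x" "x \<le> y" for x
    unfolding G_def by (rule isCont_powser[OF sum_z]) (use that zy in auto)
  have G0: "G 0 = 0" unfolding G_def by (simp add: c_def)
  have "c n * y ^ n \<le> G y"
    unfolding G_def using sum_le_suminf[OF sum[of y], of "{n}"] zy by (auto simp: c_def)
  moreover have "c n * y ^ n > 0" using assms zy by (simp add: c_def)
  ultimately have Gy: "G y > 0" by simp
  obtain k0 :: nat where k0: "real k0 > 1 / G y" using reals_Archimedean2 by blast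
  have "\<exists>x>0. x * (real K + 3) \<le> 1 \<and> real (2 * k) * (\<Sum>n. x ^ Suc n * real (paths (\<lambda>_. 1) (Suc n) j)) = 1"
    if "k \<ge> k0" for k
  proof -
    have kpos: "real k > 1 / G y" using k0 that by simp
    then have "real k * G y > 1" using Gy by (simp add: field_simps)
    then have big: "1 \<le> real (2 * k) * G y" by simp
    have "real (2 * k) * G 0 \<le> 1" using G0 by simp
    moreover have "\<forall>x. 0 \<le> x \<and> x \<le> y \<longrightarrow> isCont (\<lambda>x. real (2 * k) * G x) x"
      using cont by (auto intro!: continuous_intros)
    ultimately obtain x where x: "0 \<le> x" "x \<le> y" "real (2 * k) * G x = 1"
      using IVT[of "\<lambda>x. real (2 * k) * G x" 0 1 y] big zy by auto
    have "x \<noteq> 0" using x G0 by auto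
    have "x * (real K + 3) \<le> 1" using x(2) by (simp add: y_def field_simps)
    moreover have "G x = (\<Sum>n. x ^ Suc n * real (paths (\<lambda>_. 1) (Suc n) j))"
    proof -
      have "G x = c 0 * x ^ 0 + (\<Sum>n. c (Suc n) * x ^ Suc n)"
        unfolding G_def using suminf_split_head[OF sum[OF x(1,2)]] by linarith
      also have "\<dots> = (\<Sum>n. x ^ Suc n * real (paths (\<lambda>_. 1) (Suc n) j))"
        by (simp only: c_def) (simp add: mult.commute)
      finally show ?thesis .
    qed
    ultimately show ?thesis using x \<open>x \<noteq> 0\<close> by (intro exI[of _ x]) auto
  qed
  then show ?thesis by blast
qed

end

section \<open>Window perturbations\<close>

text \<open>Stand-ins for the inverse branches of \<open>T ^^ n\<close> over \<open>V\<close>. They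
  will be taken inside interiors of pieces, since closed neighbouring branches could share endpoints
  and fail to be disjoint.\<close>

definition branch_family :: "(real \<Rightarrow> real) \<Rightarrow> nat \<Rightarrow> real set \<Rightarrow> real set \<Rightarrow> real set set \<Rightarrow> bool" where
  "branch_family T n U V \<A> \<longleftrightarrow> finite \<A> \<and>
    (\<forall>A\<in>\<A>. is_interval A \<and> A \<noteq> {} \<and> A \<subseteq> U \<and> V \<subseteq> (T ^^ n) ` A) \<and>
    (\<forall>A\<in>\<A>. \<forall>A'\<in>\<A>. A \<noteq> A' \<longrightarrow> A \<inter> A' = {})"

lemma branch_familyD:
  assumes "branch_family T n U V \<A>"
  shows "finite \<A>"
    and "\<And>A. A \<in> \<A> \<Longrightarrow> is_interval A \<and> A \<noteq> {} \<and> A \<subseteq> U \<and> V \<subseteq> (T ^^ n) ` A"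
    and "\<And>A A'. A \<in> \<A> \<Longrightarrow> A' \<in> \<A> \<Longrightarrow> A \<noteq> A' \<Longrightarrow> A \<inter> A' = {}"
  using assms by (simp_all add: branch_family_def)

text \<open>A horseshoe needs compact sets, whereas branches need not be closed. One time
  \<open>r\<close> with three branches provides a compact interval \<open>{d..e}\<close> inside the
  open one whose image under \<open>T ^^ r\<close> covers \<open>{a..b}\<close>. Each branch of
  length \<open>n\<close> is cut down to a compact set that still covers \<open>{d..e}\<close>, and
  the result is a horseshoe for \<open>T ^^ (r + n)\<close> with \<open>t n\<close> members. The
  fixed delay \<open>r\<close> does not affect the growth rate.\<close>

lemma h_top_ge_of_branches:
  assumes T: "interval_map T" and ab: "0 \<le> a" "a < b" "b \<le> 1"
    and branches: "\<And>n. \<exists>\<A>. branch_family T n {a<..<b} {a<..<b} \<A> \<and> card \<A> = t n"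
    and x: "0 < x" "x < 1" and div: "\<not> summable (\<lambda>n. real (t n) * x ^ n)"
  shows "ereal (ln (1 / x)) \<le> h_top T"
proof -
  have "\<exists>r. t r \<ge> 3"
  proof (rule ccontr)
    assume "\<not> (\<exists>r. t r \<ge> 3)"
    then have le: "t n \<le> 2" for n by (metis not_less_eq_eq numeral_2_eq_2 numeral_3_eq_3)
    have "summable (\<lambda>n. real (t n) * x ^ n)"
    proof (rule summable_comparison_test')
      show "summable (\<lambda>n. 2 * x ^ n)" using x by (intro summable_mult summable_geometric) auto
      have "real (t n) \<le> 2" for n using of_nat_mono[OF le[of n], where ?'a = real] by simp
      then show "norm (real (t n) * x ^ n) \<le> 2 * x ^ n" for n
        using x by (simp add: abs_mult mult_right_mono)
    qed
    then show False using div by simp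
  qed
  then obtain r where r: "t r \<ge> 3" by blast
  \<comment> \<open>The middle one of three disjoint branches stays away from the endpoints of \<open>{a..b}\<close>.\<close>
  have "\<exists>d e. a < d \<and> d < e \<and> e < b \<and> {a<..<b} \<subseteq> (T ^^ r) ` {d..e}"
  proof -
    obtain \<A> where fam: "branch_family T r {a<..<b} {a<..<b} \<A>" and cardA: "card \<A> = t r"
      using branches[of r] by blast
    note \<A> = branch_familyD(1)[OF fam] cardA branch_familyD(2,3)[OF fam]
    obtain \<B> where "\<B> \<subseteq> \<A>" "card \<B> = 3" using obtain_subset_with_card_n[of 3 \<A>] r \<A>(2) by metis
    then obtain A B C where ABC: "A \<in> \<A>" "B \<in> \<A>" "C \<in> \<A>" "A \<noteq> B" "B \<noteq> C" "A \<noteq> C"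
      by (auto simp: card_3_iff)
    obtain u v w where uvw: "u \<in> A" "v \<in> B" "w \<in> C"
      using \<A>(3)[OF ABC(1)] \<A>(3)[OF ABC(2)] \<A>(3)[OF ABC(3)] by (meson ex_in_conv)
    have mid: "\<exists>d e. a < d \<and> d < e \<and> e < b \<and> {a<..<b} \<subseteq> (T ^^ r) ` {d..e}"
      if m: "A \<in> \<A>" "B \<in> \<A>" "C \<in> \<A>" "A \<noteq> B" "B \<noteq> C" "u \<in> A" "v \<in> B" "w \<in> C" "u < v" "v < w" for A B C u v w
    proof -
      have "y \<in> {u..w}" if y: "y \<in> B" for y
      proof (rule ccontr)
        assume "y \<notin> {u..w}"
        then consider "y < u" | "w < y" by force
        then have "u \<in> B \<or> w \<in> B"
          using \<A>(3)[OF m(2)] y m(7,9,10) unfolding is_interval_1 by (metis less_imp_le)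
        then show False using \<A>(4)[OF m(1,2,4)] \<A>(4)[OF m(2,3,5)] m(6,8) by blast
      qed
      then have "B \<subseteq> {u..w}" by blast
      then have "{a<..<b} \<subseteq> (T ^^ r) ` {u..w}" using \<A>(3)[OF m(2)] by blast
      moreover have "u \<in> {a<..<b}" "w \<in> {a<..<b}" using \<A>(3) m by blast+
      ultimately show ?thesis using m(9,10) by (intro exI[of _ u] exI[of _ w]) auto
    qed
    have "u \<noteq> v" "v \<noteq> w" "u \<noteq> w" using \<A>(4) ABC uvw by blast+
    then consider "u < v" "v < w" | "u < w" "w < v" | "v < u" "u < w" | "v < w" "w < u" | "w < u" "u < v" | "w < v" "v < u"
      by linarith
    then show ?thesis
      by cases (rule mid; use ABC uvw in \<open>simp; fail\<close>)+
  qed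
  then obtain d e where de: "a < d" "d < e" "e < b" "{a<..<b} \<subseteq> (T ^^ r) ` {d..e}" by blast
  have "compact ((T ^^ r) ` {d..e})"
    using de ab continuous_on_subset[OF funpow_interval_map(1)[OF T], of "{d..e}" r]
    by (intro compact_continuous_image) auto
  then have "closure {a<..<b} \<subseteq> (T ^^ r) ` {d..e}"
    using de(4) by (intro closure_minimal compact_imp_closed)
  then have full: "{a..b} \<subseteq> (T ^^ r) ` {d..e}" using ab by simp
  have bound: "ereal (ln (real (t n)) / real (r + n)) \<le> h_top T" if n: "n > 0" "t n > 0" for n
  proof -
    obtain \<A> where fam: "branch_family T n {a<..<b} {a<..<b} \<A>" and cardA: "card \<A> = t n"
      using branches[of n] by blast
    note \<A> = branch_familyD(1)[OF fam] cardA branch_familyD(2,3)[OF fam]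
    have "\<exists>C. C \<subseteq> A \<and> C \<noteq> {} \<and> compact C \<and> {d..e} \<subseteq> (T ^^ n) ` C" if A: "A \<in> \<A>" for A
    proof -
      have "d \<in> {a<..<b}" "e \<in> {a<..<b}" using de by auto
      moreover have sub: "{a<..<b} \<subseteq> (T ^^ n) ` A" using \<A>(3)[OF A] by simp
      ultimately have "d \<in> (T ^^ n) ` A" "e \<in> (T ^^ n) ` A" by (simp_all only: subsetD[OF sub])
      then obtain u w where uw: "u \<in> A" "w \<in> A" "(T ^^ n) u = d" "(T ^^ n) w = e"
        by (metis imageE)
      \<comment> \<open>The segment between a preimage of \<open>d\<close> and a preimage of
        \<open>e\<close> covers \<open>{d..e}\<close> by connectedness, and it stays in
        \<open>A\<close> because \<open>A\<close> is an interval.\<close>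
      define C where "C = {min u w..max u w}"
      have CA: "C \<subseteq> A"
        unfolding C_def
      proof (rule connected_contains_Icc)
        show "connected A" using \<A>(3)[OF A] by (simp add: is_interval_connected_1)
      qed (use uw in \<open>simp_all add: min_def max_def\<close>)
      have "A \<subseteq> {a<..<b}" using \<A>(3)[OF A] by simp
      moreover have "{a<..<b} \<subseteq> {0..1}" using ab by auto
      ultimately have "C \<subseteq> {0..1}" using CA by (meson order_trans)
      then have "connected ((T ^^ n) ` C)"
        using continuous_on_subset[OF funpow_interval_map(1)[OF T]]
        by (intro connected_continuous_image) (auto simp: C_def)
      moreover have "u \<in> C" "w \<in> C" by (auto simp: C_def)
      then have "d \<in> (T ^^ n) ` C" "e \<in> (T ^^ n) ` C" using uw by blast+
      ultimately have "{d..e} \<subseteq> (T ^^ n) ` C" by (intro connected_contains_Icc)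
      moreover have "C \<noteq> {}" "compact C" using \<open>u \<in> C\<close> by (auto simp: C_def)
      ultimately show ?thesis using CA by blast
    qed
    then obtain g where g: "\<And>A. A \<in> \<A> \<Longrightarrow> g A \<subseteq> A \<and> g A \<noteq> {} \<and> compact (g A) \<and> {d..e} \<subseteq> (T ^^ n) ` g A"
      by metis
    have disj: "g A \<inter> g B = {}" if "A \<in> \<A>" "B \<in> \<A>" "A \<noteq> B" for A B
      using g[OF that(1)] g[OF that(2)] \<A>(4)[OF that] by blast
    have "inj_on g \<A>"
    proof (rule inj_onI, rule ccontr)
      fix A B assume "A \<in> \<A>" "B \<in> \<A>" "g A = g B" "A \<noteq> B"
      then show False using disj[of A B] g[of A] by simp
    qed
    then have card: "card (g ` \<A>) = t n" using \<A>(2) card_image by metis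
    have gsub: "g A \<subseteq> {a..b}" if "A \<in> \<A>" for A
    proof -
      have "g A \<subseteq> A" "A \<subseteq> {a<..<b}" using g[OF that] \<A>(3)[OF that] by simp_all
      then show ?thesis by (meson greaterThanLessThan_subseteq_atLeastAtMost_iff order_refl order_trans)
    qed
    have "ereal (ln (real (card (g ` \<A>))) / real (r + n)) \<le> h_top T"
    proof (rule h_top_ge_of_horseshoe)
      show "finite (g ` \<A>)" using \<A> by simp
      show "g ` \<A> \<noteq> {}" using card n by force
      show "0 < r + n" using n by simp
      fix A assume "A \<in> g ` \<A>"
      then obtain A' where A': "A' \<in> \<A>" "A = g A'" by blast
      have "{a..b} \<subseteq> {0..1}" using ab by simp
      then show "A \<subseteq> {0..1}" using gsub[OF A'(1)] A'(2) by (meson order_trans)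
      show "compact A" "A \<noteq> {}" using g[OF A'(1)] A'(2) by auto
      show "A \<inter> B = {}" if "B \<in> g ` \<A>" "A \<noteq> B" for B using that A' disj by blast
      have "{d..e} \<subseteq> (T ^^ n) ` A" using g[OF A'(1)] A'(2) by blast
      then have "{a..b} \<subseteq> (T ^^ (r + n)) ` A"
        using full unfolding funpow_add image_comp[symmetric] by blast
      then show "\<Union> (g ` \<A>) \<subseteq> (T ^^ (r + n)) ` A" using gsub by blast
    qed
    then show ?thesis unfolding card .
  qed
  show ?thesis
  proof (rule ccontr)
    assume "\<not> ereal (ln (1 / x)) \<le> h_top T"
    then have "max (h_top T) 0 < ereal (ln (1 / x))" using x by simp
    then obtain s1 where s1: "max (h_top T) 0 < ereal s1" "ereal s1 < ereal (ln (1 / x))"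
      using ereal_dense2 by blast
    then have s1': "s1 > 0" "h_top T < ereal s1" "s1 < ln (1 / x)" by (simp_all add: max_less_iff_conj)
    then obtain s where s: "s1 < s" "s < ln (1 / x)" using dense by blast
    \<comment> \<open>Beyond \<open>n0\<close>, growth at rate \<open>s\<close> over
      \<open>n\<close> steps outweighs growth at rate \<open>s1\<close> over \<open>r + n\<close>
      steps.\<close>
    obtain n0 :: nat where "real n0 > s1 * real r / (s - s1)" using reals_Archimedean2 by blast
    then have n0: "real n0 * (s - s1) > s1 * real r" using s by (simp add: field_simps)
    \<comment> \<open>Otherwise the divergent series would be dominated by a geometric one of ratio
      \<open>exp s * x < 1\<close>.\<close>
    have "\<exists>n\<ge>Suc n0. exp s ^ n \<le> real (t n)"
    proof (rule ccontr)
      assume "\<not> (\<exists>n\<ge>Suc n0. exp s ^ n \<le> real (t n))"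
      then have le: "real (t n) \<le> exp s ^ n" if "n \<ge> Suc n0" for n using that by (meson le_cases)
      have "exp s < exp (ln (1 / x))" using s(2) by simp
      then have "exp s * x < 1" using x by (simp add: field_simps)
      have "summable (\<lambda>n. real (t n) * x ^ n)"
      proof (rule summable_comparison_test')
        show "summable (\<lambda>n. (exp s * x) ^ n)"
          using \<open>exp s * x < 1\<close> x by (intro summable_geometric) simp
        show "norm (real (t n) * x ^ n) \<le> (exp s * x) ^ n" if "n \<ge> Suc n0" for n
          using le[OF that] x by (simp add: abs_mult power_mult_distrib mult_right_mono)
      qed
      then show False using div by simp
    qed
    then obtain n where n: "n \<ge> Suc n0" "exp s ^ n \<le> real (t n)" by blast
    then have pos: "t n > 0" by (metis exp_gt_zero zero_less_power less_le_trans of_nat_0_less_iff)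
    have "real n * s = ln (exp s ^ n)" by (simp add: ln_realpow)
    also have "\<dots> \<le> ln (real (t n))" using n pos by simp
    finally have ln: "real n * s \<le> ln (real (t n))" .
    have "real n0 * (s - s1) \<le> real n * (s - s1)" using n(1) s by (intro mult_right_mono) auto
    then have "s1 * real (r + n) \<le> real n * s" using n0 by (simp add: algebra_simps)
    then have "s1 \<le> ln (real (t n)) / real (r + n)" using ln n(1) by (simp add: field_simps)
    then have "ereal s1 \<le> ereal (ln (real (t n)) / real (r + n))" by simp
    also have "\<dots> \<le> h_top T" using bound[of n] n(1) pos by simp
    finally show False using s1'(2) by simp
  qed
qed

section \<open>The perturbed map, its partition and its eigenvector\<close>

locale window = markov_counting S B j K for S B j K +
  fixes T :: "real \<Rightarrow> real" and \<D> :: "real set set" and k :: nat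
  assumes map_T: "interval_map T"
    and off_window: "\<And>x. x \<in> {0..1} - interior j \<Longrightarrow> T x = S x"
    and division: "\<D> division_of j" and card_division: "card \<D> = 2 * k + 1"
    and division_pieces: "\<And>q. q \<in> \<D> \<Longrightarrow> interior q \<noteq> {} \<and> T ` q = S ` j \<and> monotone_int T q"
begin

definition C :: "real set set" where
  "C = (B - {j}) \<union> \<D>"

text \<open>All members of \<open>refine b\<close> have the same image under \<open>T\<close>,
  namely that of \<open>b\<close> under \<open>S\<close>. Hence the transitions of \<open>T\<close>
  can be counted on the partition \<open>B\<close> of \<open>S\<close>, with multiplicities
  \<open>weight k\<close>.\<close>

definition refine :: "real set \<Rightarrow> real set set" where
  "refine b = (if b = j then \<D> else {b})"

lemma T_eq_S:
  assumes "b \<in> B" "b \<noteq> j" "x \<in> b"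
  shows "T x = S x"
proof (rule off_window)
  obtain e f where ef: "j = {e..f}" "interior j = {e<..<f}" using C_interval[OF j] by metis
  obtain p q where pq: "b = {p..q}" using C_interval[OF assms(1)] by metis
  have "x \<notin> interior j" using C_ordered[of p q e f] assms j ef pq by auto
  then show "x \<in> {0..1} - interior j" using C_subset[OF assms(1)] assms(3) by blast
qed

lemma division_interval:
  assumes "q \<in> \<D>"
  obtains p s where "p < s" "q = {p..s}" "interior q = {p<..<s}" "q \<subseteq> j"
proof -
  obtain p s where ps: "q = {p..s}" using division_ofD(4)[OF division assms] by auto
  moreover have "p < s" using division_pieces[OF assms] ps by (simp add: interior_atLeastAtMost_real)
  ultimately show ?thesis using that division_ofD(2)[OF division assms] interior_atLeastAtMost_real by metis
qed

lemma refine_piece: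
  assumes "b \<in> B" "q \<in> refine b"
  shows "q \<in> C" "q \<subseteq> b" "interior q \<noteq> {}" "T ` q = S ` b" "monotone_int T q"
proof -
  have "q \<in> C \<and> q \<subseteq> b \<and> interior q \<noteq> {} \<and> T ` q = S ` b \<and> monotone_int T q"
  proof (cases "b = j")
    case True
    then have "q \<in> \<D>" using assms by (simp add: refine_def)
    then show ?thesis using True division_pieces division_interval by (metis C_def UnI2)
  next
    case False
    then have q: "q = b" using assms by (simp add: refine_def)
    obtain e f where "e < f" "b = {e..f}" "interior b = {e<..<f}" using C_interval[OF assms(1)] by metis
    then have "interior b \<noteq> {}" by simp
    moreover have eq: "T x = S x" if "x \<in> b" for x using T_eq_S[OF assms(1) False that] .
    then have "T ` b = S ` b" by (rule image_cong[OF refl])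
    moreover have "monotone_int T b" using monotone[OF assms(1)] monotone_int_cong[of b T S] eq by simp
    ultimately show ?thesis using False assms(1) unfolding q C_def by blast
  qed
  then show "q \<in> C" "q \<subseteq> b" "interior q \<noteq> {}" "T ` q = S ` b" "monotone_int T q" by auto
qed

lemma C_refine:
  assumes "c \<in> C"
  obtains b where "b \<in> B" "c \<in> refine b"
proof (cases "c \<in> \<D>")
  case True
  then show ?thesis using that[OF j] by (simp add: refine_def)
next
  case False
  then have "c \<in> B" "c \<noteq> j" using assms by (simp_all add: C_def)
  then show ?thesis using that[of c] by (simp add: refine_def)
qed

lemma refine_interiors_disjoint:
  assumes "q \<in> refine b" "q' \<in> refine b" "q \<noteq> q'"
  shows "interior q \<inter> interior q' = {}"
  using assms division_ofD(5)[OF division] by (auto simp: refine_def split: if_splits)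

lemma finite_refine: "finite (refine b)" "card (refine b) = weight k b"
  using division_ofD(1)[OF division] card_division by (auto simp: refine_def weight_def)

lemma interval_markov_C: "interval_markov T C"
proof
  show "interval_map T" by (rule map_T)
  show "countable C"
    using countable_C division_ofD(1)[OF division] by (auto simp: C_def intro: countable_finite)
  have "\<Union>C = \<Union>B" using division_ofD(6)[OF division] j unfolding C_def by blast
  then show "countable ({0..1} - \<Union>C)" using countable_rest by simp
next
  fix c assume "c \<in> C"
  then obtain b where b: "b \<in> B" "c \<in> refine b" by (rule C_refine)
  show "monotone_int T c" using refine_piece[OF b] by blast
  show "\<exists>p q. 0 \<le> p \<and> p < q \<and> q \<le> 1 \<and> c = {p..q}"
  proof (cases "b = j")
    case True
    then have "c \<in> \<D>" using b by (simp add: refine_def)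
    then obtain p s where ps: "p < s" "c = {p..s}" "c \<subseteq> j" by (rule division_interval)
    then have "{p..s} \<subseteq> {0..1}" using C_subset[OF j] by blast
    then show ?thesis using ps by auto
  next
    case False
    then show ?thesis using b intervals by (simp add: refine_def)
  qed
  fix d assume "d \<in> C"
  then obtain b' where b': "b' \<in> B" "d \<in> refine b'" by (rule C_refine)
  { assume "c \<noteq> d"
    show "interior c \<inter> interior d = {}"
    proof (cases "b = b'")
      case True
      then show ?thesis using refine_interiors_disjoint b b' \<open>c \<noteq> d\<close> by blast
    next
      case False
      then have "interior b \<inter> interior b' = {}" using interiors_disjoint b b' by blast
      then show ?thesis using interior_mono refine_piece(2)[OF b] refine_piece(2)[OF b'] by blast
    qed }
  { assume "T ` c \<inter> interior d \<noteq> {}"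
    then have "S ` b \<inter> interior b' \<noteq> {}"
      using refine_piece(4)[OF b] interior_mono[OF refine_piece(2)[OF b']] by blast
    then show "d \<subseteq> T ` c"
      using markov[OF b(1) b'(1)] refine_piece(4)[OF b] refine_piece(2)[OF b'] by blast }
qed

lemma division_not_B: "\<D> \<inter> (B - {j}) = {}"
proof -
  have False if "q \<in> \<D>" "q \<in> B" "q \<noteq> j" for q
    using interiors_disjoint[OF that(2) j that(3)] division_pieces[OF that(1)]
      interior_mono[OF division_ofD(2)[OF division that(1)]] by blast
  then show ?thesis by blast
qed

text \<open>The pieces of \<open>\<D>\<close> are covered all together or not at all, because an
  image of a piece under \<open>S\<close> that meets the interior of \<open>j\<close> contains
  \<open>j\<close>.\<close>

lemma follow_T:
  assumes b: "b \<in> B"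
  shows "{d\<in>C. d \<subseteq> S ` b} = (follow b - {j}) \<union> (if j \<in> follow b then \<D> else {})"
proof -
  have "j \<in> follow b" if "q \<in> \<D>" "q \<subseteq> S ` b" for q
  proof -
    have "S ` b \<inter> interior j \<noteq> {}"
      using that division_pieces[OF that(1)] interior_subset[of q]
        interior_mono[OF division_ofD(2)[OF division that(1)]] by blast
    then show ?thesis using markov[OF b j] j by (simp add: follow_def)
  qed
  moreover have "q \<subseteq> S ` b" if "q \<in> \<D>" "j \<in> follow b" for q
    using that division_ofD(2)[OF division that(1)] unfolding follow_def by blast
  ultimately have "\<forall>q\<in>\<D>. q \<subseteq> S ` b \<longleftrightarrow> j \<in> follow b" by blast
  then show ?thesis unfolding C_def follow_def by (cases "j \<in> {c\<in>B. c \<subseteq> S ` b}") (simp_all only: if_True if_False, blast+)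
qed

text \<open>Sharing \<open>green x j\<close> equally among the pieces of \<open>j\<close> leaves the
  row sums unchanged, so for pieces outside \<open>j\<close> the eigenvector equation is
  \<open>green_eigen\<close>. For the pieces of \<open>j\<close> it amounts to the parameter
  equation.\<close>

lemma window_eigenvector:
  assumes x: "0 < x" "x * (real K + 3) \<le> 1" and "k > 0"
    and eq: "real (2 * k) * (\<Sum>n. x ^ Suc n * real (paths (\<lambda>_. 1) (Suc n) j)) = 1"
  shows "markov_eigenvector T C (\<lambda>c. if c \<in> \<D> then green x j / real (2 * k + 1) else green x c) (1 / x)"
proof -
  have xK: "x * real K < 1" using x by (simp add: distrib_left)
  define m where "m c = (if c \<in> \<D> then green x j / real (2 * k + 1) else green x c)" for c
  interpret C: interval_markov T C by (rule interval_markov_C)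
  have fin: "finite \<D>" using division_ofD(1)[OF division] .
  have m_D: "sum m \<D> = green x j" using card_division by (simp add: m_def)
  have sum_B: "green x summable_on R" if "R \<subseteq> B" for R
    using green_summable_on[OF x(1) xK] that summable_on_subset by blast
  have m_B: "m summable_on R" "infsum m R = infsum (green x) R" if "R \<subseteq> B - {j}" for R
  proof -
    have eq: "m c = green x c" if "c \<in> R" for c
      using that \<open>R \<subseteq> B - {j}\<close> division_not_B by (auto simp: m_def)
    then show "infsum m R = infsum (green x) R" by (rule infsum_cong)
    have "green x summable_on R" using \<open>R \<subseteq> B - {j}\<close> by (intro sum_B) blast
    then show "m summable_on R" using summable_on_cong[of R m "green x"] eq by simp
  qed
  \<comment> \<open>The parameter equation fixes the row sum at \<open>1 / (2 * k)\<close>. Adding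
    the \<open>1\<close> subtracted in \<open>green_eigen\<close> gives
    \<open>green x j / x = 1 + 1 / (2 * k)\<close>, and one of its \<open>2 * k + 1\<close> equal
    shares is again \<open>1 / (2 * k)\<close>.\<close>
  have follow_j: "infsum (green x) (follow j) = 1 / real (2 * k)"
    using infsum_green_follow[OF x(1) xK j] eq \<open>k > 0\<close> by (simp add: field_simps)
  then have green_j: "green x j / x = real (2 * k + 1) / real (2 * k)"
    using green_eigen[OF x(1) xK j] \<open>k > 0\<close> by (simp add: field_simps)
  have "green x j > 0"
  proof -
    have "green x j / x > 0" unfolding green_j using \<open>k > 0\<close> by simp
    then show ?thesis using x by (simp add: zero_less_divide_iff)
  qed
  have nonneg: "0 \<le> m c" if "c \<in> C" for c
    using that green_nonneg[OF x(1) xK] \<open>green x j > 0\<close> by (auto simp: m_def C_def)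
  have summable: "m summable_on C"
    unfolding C_def using m_B(1)[of "B - {j}"] fin division_not_B
    by (intro summable_on_Un_disjoint) auto
  have total: "infsum m {d\<in>C. d \<subseteq> S ` b} = infsum (green x) (follow b)" if b: "b \<in> B" for b
  proof (cases "j \<in> follow b")
    case True
    have fb: "follow b - {j} \<subseteq> B - {j}" using follow_subset by blast
    have "{d\<in>C. d \<subseteq> S ` b} = (follow b - {j}) \<union> \<D>" using follow_T[OF b] True by simp
    moreover have "infsum m ((follow b - {j}) \<union> \<D>) = infsum m (follow b - {j}) + infsum m \<D>"
      using fb division_not_B by (intro infsum_Un_disjoint m_B(1)[OF fb] summable_on_finite[OF fin]) blast
    ultimately have "infsum m {d\<in>C. d \<subseteq> S ` b} = infsum m (follow b - {j}) + infsum m \<D>" by simp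
    also have "\<dots> = infsum (green x) (follow b - {j}) + green x j"
      using m_B(2)[OF fb] m_D fin by simp
    also have "\<dots> = infsum (green x) (insert j (follow b - {j}))"
      using sum_B[of "follow b - {j}"] fb by (subst infsum_insert) auto
    also have "insert j (follow b - {j}) = follow b" using True by blast
    finally show ?thesis .
  next
    case False
    then have "follow b \<subseteq> B - {j}" using follow_subset by blast
    then show ?thesis unfolding follow_T[OF b] using False m_B(2)[of "follow b"] by simp
  qed
  have "markov_eigenvector T C m (1 / x)"
  proof
    have "3 * x \<le> x * (real K + 3)" using x by (simp add: distrib_left)
    then have "3 * x \<le> 1" using x by linarith
    then show "2 < 1 / x" using x by (simp add: field_simps)
    show "m summable_on C" by (rule summable)
    show "0 \<le> m c" if "c \<in> C" for c using nonneg that .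
    have "\<D> \<noteq> {}" using card_division by force
    then obtain q where "q \<in> \<D>" by blast
    then have "q \<in> C" "m q > 0" using \<open>green x j > 0\<close> by (auto simp: C_def m_def)
    moreover have "sum m {q} \<le> infsum m C"
      using summable nonneg \<open>q \<in> C\<close> by (intro finite_sum_le_infsum) auto
    ultimately show "0 < infsum m C" by simp
    show "infsum m {d\<in>C. d \<subseteq> T ` c} = 1 / x * m c" if c: "c \<in> C" for c
    proof -
      obtain b where b: "b \<in> B" "c \<in> refine b" using C_refine[OF c] .
      have "infsum m {d\<in>C. d \<subseteq> T ` c} = infsum (green x) (follow b)"
        unfolding refine_piece(4)[OF b] by (rule total[OF b(1)])
      also have "\<dots> = 1 / x * m c"
      proof (cases "b = j")
        case True
        then have "m c = green x j / real (2 * k + 1)" using b by (simp add: refine_def m_def)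
        then have "1 / x * m c = (green x j / x) / real (2 * k + 1)" by simp
        also have "\<dots> = 1 / real (2 * k)" unfolding green_j by simp
        finally show ?thesis unfolding True follow_j by simp
      next
        case False
        then have "c = b" using b by (simp add: refine_def)
        then have "m c = green x b" using b False division_not_B by (auto simp: m_def)
        then show ?thesis using green_eigen[OF x(1) xK b(1)] False by simp
      qed
      finally show ?thesis .
    qed
  qed
  then show ?thesis unfolding m_def .
qed

text \<open>A weighted path is realized by pulling the branch of its tail back through one chosen
  member of \<open>refine b\<close>. The number of choices is the weight, and monotonicity of
  \<open>T\<close> on the chosen piece keeps the pull-back an interval.\<close>

lemma branches_exist:
  assumes "b \<in> B"
  shows "\<exists>\<A>. branch_family T n (interior b) (interior j) \<A> \<and> card \<A> = paths (weight k) n b"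
  using assms
proof (induction n arbitrary: b)
  case 0
  obtain e f where "e < f" "interior j = {e<..<f}" using C_interval[OF j] by metis
  then have "is_interval (interior j)" "interior j \<noteq> {}" by (auto simp: is_interval_oo)
  then show ?case
    by (intro exI[of _ "if b = j then {interior j} else {}"]) (simp add: branch_family_def)
next
  case (Suc n)
  interpret C: interval_markov T C by (rule interval_markov_C)
  have "\<forall>c\<in>B. \<exists>\<A>. branch_family T n (interior c) (interior j) \<A> \<and> card \<A> = paths (weight k) n c"
    using Suc.IH by blast
  from bchoice[OF this] obtain F where
    fam: "\<And>c. c \<in> B \<Longrightarrow> branch_family T n (interior c) (interior j) (F c)" and
    cardF: "\<And>c. c \<in> B \<Longrightarrow> card (F c) = paths (weight k) n c"
    by blast
  note F = branch_familyD(1)[OF fam] cardF branch_familyD(2,3)[OF fam]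
  define Z where "Z = {c. c \<in> follow b \<and> paths (weight k) n c \<noteq> 0}"
  have "finite {c\<in>B. paths (weight k) n c \<noteq> 0}" using weight_le by (rule paths_finite)
  moreover have "Z \<subseteq> {c\<in>B. paths (weight k) n c \<noteq> 0}"
    using follow_subset unfolding Z_def by blast
  ultimately have Z: "finite Z" "Z \<subseteq> B" by (blast intro: finite_subset)+
  define G where "G = (SIGMA c:Z. F c)"
  have finF: "\<forall>c\<in>Z. finite (F c)" using F(1) Z(2) by blast
  have "card G = (\<Sum>c\<in>Z. card (F c))" unfolding G_def by (rule card_SigmaI[OF Z(1) finF])
  also have "\<dots> = (\<Sum>c\<in>Z. paths (weight k) n c)" using F(2) Z(2) by (intro sum.cong refl) blast
  finally have G: "finite G" "card G = (\<Sum>c\<in>Z. paths (weight k) n c)"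
    unfolding G_def using Z(1) finF by (auto intro: finite_SigmaI)
  \<comment> \<open>The middle component labels a branch by the piece in which it lies, so that the
    index set is a disjoint union and its cardinality is the sum occurring in
    \<open>paths\<close>.\<close>
  define pull where "pull = (\<lambda>(q, c :: real set, A). interior q \<inter> T -` A)"
  have pull_image: "T ` pull (q, c, A) = A \<and> is_interval (pull (q, c, A))"
    if q: "q \<in> refine b" and c: "(c, A) \<in> G" for q c A
  proof -
    have cA: "c \<in> B" "c \<in> follow b" "A \<in> F c" using c Z by (auto simp: G_def Z_def)
    have qC: "q \<in> C" and Tq: "T ` q = S ` b" using refine_piece[OF Suc.prems q] by auto
    obtain e f where ef: "e < f" "q = {e..f}" "interior q = {e<..<f}" using C.C_interval[OF qC] by metis
    have A: "is_interval A" "A \<subseteq> interior c" using F(3)[OF cA(1,3)] by auto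
    have "interior c \<subseteq> interior (T ` q)" using cA Tq by (auto simp: follow_def intro!: interior_mono)
    then have Asub: "A \<subseteq> interior (T ` q)" using A by blast
    \<comment> \<open>The endpoints of \<open>q\<close> are mapped to the endpoints of its image. A
      preimage in \<open>q\<close> of an interior point of the image therefore lies in the interior
      of \<open>q\<close>, and restricting to interiors loses nothing of \<open>A\<close>.\<close>
    have img: "y \<in> T ` interior q" if "y \<in> A" for y
    proof -
      have "y \<in> interior (T ` q)" using Asub that by blast
      moreover have "T ` q = {T e..T f} \<or> T ` q = {T f..T e}"
        using C.image_C[of e f] qC ef by blast
      ultimately have "y \<noteq> T e" "y \<noteq> T f" by (auto simp: interior_atLeastAtMost_real)
      moreover obtain z where "z \<in> q" "y = T z" using \<open>y \<in> interior (T ` q)\<close> interior_subset by blast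
      ultimately have "z \<in> interior q" using ef by (cases "z = e"; cases "z = f") simp_all
      then show ?thesis using \<open>y = T z\<close> by blast
    qed
    have "pull (q, c, A) = interior q \<inter> T -` A" by (simp add: pull_def)
    then have "T ` pull (q, c, A) = A" using img by blast
    moreover have "is_interval (pull (q, c, A))"
      unfolding is_interval_1
    proof (intro ballI allI impI)
      fix u w z assume uw: "u \<in> pull (q, c, A)" "w \<in> pull (q, c, A)" and z: "u \<le> z \<and> z \<le> w"
      have zq: "z \<in> interior q" "z \<in> q" "u \<in> q" "w \<in> q" using uw z ef by (auto simp: pull_def)
      have TA: "T u \<in> A" "T w \<in> A" using uw by (auto simp: pull_def)
      have "T u \<le> T z \<and> T z \<le> T w \<or> T w \<le> T z \<and> T z \<le> T u"
        using C.monotone[OF qC] zq z unfolding monotone_int_def monotone_on_def by blast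
      then have "T z \<in> A" using A(1) TA unfolding is_interval_1 by blast
      then show "z \<in> pull (q, c, A)" using zq by (simp add: pull_def)
    qed
    ultimately show ?thesis by blast
  qed
  have disj: "pull s \<inter> pull s' = {}" if s: "s \<in> refine b \<times> G" "s' \<in> refine b \<times> G" "s \<noteq> s'" for s s'
  proof -
    obtain q c A where s1: "s = (q, c, A)" "q \<in> refine b" "c \<in> B" "A \<in> F c"
      using s(1) Z by (auto simp: G_def)
    obtain q' c' A' where s2: "s' = (q', c', A')" "q' \<in> refine b" "c' \<in> B" "A' \<in> F c'"
      using s(2) Z by (auto simp: G_def)
    consider "q \<noteq> q'" | "c \<noteq> c'" | "c = c'" "A \<noteq> A'" using s(3) s1(1) s2(1) by blast
    then show ?thesis
    proof cases
      case 1
      then show ?thesis using refine_interiors_disjoint[OF s1(2) s2(2)] by (auto simp: pull_def s1(1) s2(1))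
    next
      case 2
      then have "interior c \<inter> interior c' = {}" using interiors_disjoint s1 s2 by blast
      then have "A \<inter> A' = {}" using F(3)[OF s1(3,4)] F(3)[OF s2(3,4)] by blast
      then show ?thesis by (auto simp: pull_def s1(1) s2(1))
    next
      case 3
      then have "A \<inter> A' = {}" using F(4) s1 s2 by blast
      then show ?thesis by (auto simp: pull_def s1(1) s2(1))
    qed
  qed
  have props: "is_interval (pull s) \<and> pull s \<noteq> {} \<and> pull s \<subseteq> interior b \<and> interior j \<subseteq> (T ^^ Suc n) ` pull s"
    if s: "s \<in> refine b \<times> G" for s
  proof -
    obtain q c A where s1: "s = (q, c, A)" "q \<in> refine b" "(c, A) \<in> G" "c \<in> B" "A \<in> F c"
      using s Z by (auto simp: G_def)
    note A = F(3)[OF s1(4,5)]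
    note pull = pull_image[OF s1(2,3)]
    have "pull s \<noteq> {}" using pull A unfolding s1(1) by (metis image_is_empty)
    moreover have "pull s \<subseteq> interior b"
      using interior_mono[OF refine_piece(2)[OF Suc.prems s1(2)]] unfolding s1(1) pull_def by auto
    moreover have "(T ^^ Suc n) ` pull s = (T ^^ n) ` A"
      using pull unfolding s1(1) funpow_Suc_right image_comp[symmetric] by simp
    ultimately show ?thesis using A pull unfolding s1(1) by simp
  qed
  have "inj_on pull (refine b \<times> G)"
  proof (rule inj_onI, rule ccontr)
    fix s s' assume "s \<in> refine b \<times> G" "s' \<in> refine b \<times> G" "pull s = pull s'" "s \<noteq> s'"
    then show False using disj[of s s'] props[of s] by simp
  qed
  then have "card (pull ` (refine b \<times> G)) = card (refine b \<times> G)" by (rule card_image)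
  also have "\<dots> = paths (weight k) (Suc n) b"
    using finite_refine[of b] G by (simp add: card_cartesian_product Z_def)
  finally have card: "card (pull ` (refine b \<times> G)) = paths (weight k) (Suc n) b" .
  show ?case
  proof (intro exI[of _ "pull ` (refine b \<times> G)"] conjI card)
    show "branch_family T (Suc n) (interior b) (interior j) (pull ` (refine b \<times> G))"
      unfolding branch_family_def
    proof (intro conjI)
      show "finite (pull ` (refine b \<times> G))" using finite_refine G by simp
      show "\<forall>A\<in>pull ` (refine b \<times> G). is_interval A \<and> A \<noteq> {} \<and> A \<subseteq> interior b \<and> interior j \<subseteq> (T ^^ Suc n) ` A"
      proof
        fix A assume "A \<in> pull ` (refine b \<times> G)"
        then obtain s where s: "s \<in> refine b \<times> G" "A = pull s" by blast
        show "is_interval A \<and> A \<noteq> {} \<and> A \<subseteq> interior b \<and> interior j \<subseteq> (T ^^ Suc n) ` A"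
          unfolding s(2) by (rule props[OF s(1)])
      qed
      show "\<forall>A\<in>pull ` (refine b \<times> G). \<forall>A'\<in>pull ` (refine b \<times> G). A \<noteq> A' \<longrightarrow> A \<inter> A' = {}"
      proof (intro ballI impI)
        fix A A' assume A: "A \<in> pull ` (refine b \<times> G)" "A' \<in> pull ` (refine b \<times> G)" "A \<noteq> A'"
        then obtain s s' where "s \<in> refine b \<times> G" "s' \<in> refine b \<times> G" "A = pull s" "A' = pull s'" by blast
        then show "A \<inter> A' = {}" using disj[of s s'] A(3) by blast
      qed
    qed
  qed
qed

text \<open>With \<open>p = 2 * k\<close> the parameter equation is the normalization in
  \<open>renewal_not_summable\<close>, so the series of weighted loops diverges at \<open>x\<close>;
  \<open>branches_exist\<close> realizes the loops as disjoint branches of \<open>T\<close>.\<close>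

lemma h_top_window_ge:
  assumes x: "0 < x" "x * (real K + 3) \<le> 1" and "k > 0"
    and eq: "real (2 * k) * (\<Sum>n. x ^ Suc n * real (paths (\<lambda>_. 1) (Suc n) j)) = 1"
  shows "ereal (ln (1 / x)) \<le> h_top T"
proof -
  have xK: "x * real K < 1" using x by (simp add: distrib_left)
  have "3 * x \<le> x * (real K + 3)" using x by (simp add: distrib_left)
  then have "x < 1" using x by linarith
  obtain a b where ab: "0 \<le> a" "a < b" "b \<le> 1" "interior j = {a<..<b}" using C_interval[OF j] by metis
  have "\<not> summable (\<lambda>n. real (paths (weight k) n j) * x ^ n)"
  proof (rule renewal_not_summable[where a = "\<lambda>n. real (paths (\<lambda>_. 1) n j)" and p = "real (2 * k)"])
    have "summable (\<lambda>n. x * (real (paths (\<lambda>_. 1) n j) * x ^ n))"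
      using green_summable[OF x(1) xK j] by (simp only: power_Suc mult.assoc mult.commute[of "real _"])
    then show "summable (\<lambda>n. real (paths (\<lambda>_. 1) n j) * x ^ n)"
      using x by (subst (asm) summable_cmult_iff) auto
    show "real (2 * k) * (\<Sum>n. real (paths (\<lambda>_. 1) (Suc n) j) * x ^ Suc n) = 1"
      using eq by (simp only: mult.commute[of "real (paths _ _ _)"])
    show "(real (2 * k) + 1) * real (paths (weight k) n j) = real (paths (\<lambda>_. 1) n j) +
      real (2 * k) * (\<Sum>i\<le>n. real (paths (\<lambda>_. 1) i j) * real (paths (weight k) (n - i) j))" for n
    proof -
      have "real (2 * k) + 1 = real (2 * k + 1)" by simp
      then show ?thesis by (simp only: paths_weight_renewal)
    qed
  qed (use x \<open>k > 0\<close> in auto)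
  from h_top_ge_of_branches[OF map_T ab(1-3) _ x(1) \<open>x < 1\<close> this] show ?thesis
    using branches_exist[OF j] unfolding ab(4) by blast
qed

lemma linearizable_window:
  assumes x: "0 < x" "x * (real K + 3) \<le> 1" and "k > 0"
    and eq: "real (2 * k) * (\<Sum>n. x ^ Suc n * real (paths (\<lambda>_. 1) (Suc n) j)) = 1"
    and mix: "topologically_mixing T"
  shows "linearizable T"
proof -
  obtain \<Phi> \<Psi> where hom: "homeomorphism {0..1} {0..1} \<Phi> \<Psi>"
    and lip: "\<And>y z. y \<in> {0..1} \<Longrightarrow> z \<in> {0..1} \<Longrightarrow> \<bar>\<Phi> (T y) - \<Phi> (T z)\<bar> \<le> 1 / x * \<bar>\<Phi> y - \<Phi> z\<bar>"
    and slope: "constant_slope (\<lambda>y. \<Phi> (T (\<Psi> y))) (1 / x)"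
    using markov_eigenvector.linearizing_conjugacy[OF window_eigenvector[OF x \<open>k > 0\<close> eq] mix] by blast
  have "3 * x \<le> x * (real K + 3)" using x by (simp add: distrib_left)
  then have "x < 1" using x by linarith
  then have "1 / x > 1" using x by simp
  then have "h_top T \<le> ereal (ln (1 / x))" by (rule h_top_le_of_lipschitz[OF map_T hom _ lip])
  then have h: "h_top T = ereal (ln (1 / x))" using h_top_window_ge[OF x \<open>k > 0\<close> eq] by (rule antisym)
  then have "exp (real_of_ereal (h_top T)) = 1 / x" using x by simp
  moreover have "topologically_conjugate T (\<lambda>y. \<Phi> (T (\<Psi> y)))"
    unfolding topologically_conjugate_def using hom
    by (intro exI[of _ \<Phi>] exI[of _ \<Psi>]) (auto simp: homeomorphism_def)
  ultimately show ?thesis using slope h unfolding linearizable_def by auto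
qed

end

theorem theorem8:
  fixes S :: "real \<Rightarrow> real" and P :: "real set set" and j :: "real set"
  assumes "S \<in> CPMM" and "operator_type S"
    and "markov_partition S P"
    and "j \<in> P" and "monotone_int S j"
  shows "\<exists>k0::nat. \<forall>k\<ge>k0. \<forall>T. T \<in> CPMM \<and> window_perturbation S P j k T \<longrightarrow> linearizable T"
proof -
  have S: "interval_map S" "topologically_mixing S" using assms(1) by (simp_all add: CPMM_def)
  obtain K :: nat where
    K: "\<And>y. y \<in> {0..1} \<Longrightarrow> finite {x\<in>{0..1}. S x = y} \<and> card {x\<in>{0..1}. S x = y} \<le> K"
    using assms(2) unfolding operator_type_def by blast
  interpret mixing_map S by (unfold_locales) (fact S)+
  define B where "B = laps S P"
  interpret B: interval_markov S B unfolding B_def by (rule interval_markov_laps[OF assms(3)])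
  interpret markov_counting S B j K
  proof
    show "j \<in> B" unfolding B_def by (rule laps_monotone_element[OF assms(3-5)])
    show "card F \<le> K" if "c \<in> B" "F \<subseteq> {b\<in>B. c \<subseteq> S ` b}" for c F
      using B.card_column_le[OF K that] .
  qed
  \<comment> \<open>Everything up to \<open>k0\<close> is computed from \<open>S\<close> alone, so
    the threshold is uniform in the perturbation.\<close>
  obtain n where "n > 0" "paths (\<lambda>_. 1) n j > 0"
    using return_path_exists[OF K[THEN conjunct1] mix] by blast
  then obtain k0 where k0: "\<And>k. k \<ge> k0 \<Longrightarrow> \<exists>x>0. x * (real K + 3) \<le> 1 \<and>
      real (2 * k) * (\<Sum>n. x ^ Suc n * real (paths (\<lambda>_. 1) (Suc n) j)) = 1"
    using green_parameter_exists by blast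
  show ?thesis
  \<comment> \<open>The successor guarantees \<open>k > 0\<close>, as the construction divides by
    \<open>2 * k\<close>.\<close>
  proof (intro exI[of _ "Suc k0"] allI impI, elim conjE)
    fix k T assume k: "k \<ge> Suc k0" and T: "T \<in> CPMM" and win: "window_perturbation S P j k T"
    have T': "interval_map T" "topologically_mixing T" using T by (simp_all add: CPMM_def)
    obtain \<D> where \<D>: "\<D> division_of j" "card \<D> = 2 * k + 1"
      "\<forall>q\<in>\<D>. interior q \<noteq> {} \<and> T ` q = S ` j \<and> monotone_int T q"
      and off: "\<forall>x\<in>{0..1} - interior j. T x = S x"
      using win unfolding window_perturbation_def by blast
    interpret window S B j K T \<D> k
      by unfold_locales (use T'(1) \<D> off in blast)+
    obtain x where "x > 0" "x * (real K + 3) \<le> 1"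
      "real (2 * k) * (\<Sum>n. x ^ Suc n * real (paths (\<lambda>_. 1) (Suc n) j)) = 1"
      using k0[of k] k by auto
    then show "linearizable T" using linearizable_window T'(2) k by simp
  qed
qed

end
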